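(* Let $e\in\mathbb{S}$, let $k$ be a commutative ring and let $R$ be a (not necessarily commutative) $k$-algebra on which multiplication by every positive integer dividing $e$ is injective. Put $R'=R\otimes_{\mathbb{Z}}\mathbb{Z}[\mu_e]$, $k'=k\otimes_{\mathbb{Z}}\mathbb{Z}[\mu_e]$ and identify $R$ with $R\otimes 1\subseteq R'$. Then the maps $$(R,\mu_e,\{R_\zeta\}_{\zeta\in\mu_e})\;\mapsto\;\big(\text{the }k'\text{-linear map } r\otimes u\mapsto r\otimes \zeta u \text{ for } r\in R_\zeta,\ u\in\mathbb{Z}[\mu_e]\big)$$ and $$\sigma\;\mapsto\;(R,\mu_e,\{R'(\sigma,\zeta)\cap R\}_{\zeta\in\mu_e})$$ are well defined, mutually inverse bijections between the set of $\mu_e$-gradings of $R$ as a $k$-algebra and the set $X_e(R)$.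
   Context: Steinitz numbers $\mathbb{S}$: formal products $\prod_p p^{n_p}$ over primes $p$ with $n_p\in\mathbb{Z}_{\ge0}\cup\{\infty\}$; a positive integer $d$ divides $e=\prod p^{n_p}$ if $\mathrm{ord}_p(d)\le n_p$ for all $p$. $\mu_e\subseteq\mathbb{C}^*$ is the group of roots of unity whose order divides $e$, and $\mathbb{Z}[\mu_e]\subseteq\mathbb{C}$ the ring it generates. $\hat{\mathbb{Z}}/e\hat{\mathbb{Z}}=\varprojlim_{d\mid e,\,d\in\mathbb{Z}_{>0}}\mathbb{Z}/d\mathbb{Z}$; an element $a$ acts on $\mu_e$ by $\zeta\mapsto\zeta^{a}$ (using $a$ mod $\mathrm{ord}(\zeta)$); for $a\in(\hat{\mathbb{Z}}/e\hat{\mathbb{Z}})^*$ this induces a ring automorphism of $\mathbb{Z}[\mu_e]$ and hence a $k$-algebra automorphism $\tau_a=\mathrm{id}_R\otimes(\cdot)$ of $R'$. For an endomorphism $f$ of a module $M$ and $\lambda$ a scalar, $M(f,\lambda)=\{x\in M: f(x)=\lambda x\}$; $f$ is $\mu_e$-diagonalizable if $\bigoplus_{\zeta\in\mu_e}M(f,\zeta)\to M$ is an isomorphism. For such $f$ and $a\in\hat{\mathbb{Z}}/e\hat{\mathbb{Z}}$, $f^a$ is the endomorphism acting on $M(f,\zeta)$ as multiplication by $\zeta^a$. $X_e(R)=\{\sigma\in\mathrm{Aut}_{k'\text{-alg}}(R'):\sigma\text{ is }\mu_e\text{-diagonalizable and }\tau_a\sigma\tau_a^{-1}=\sigma^a\text{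 for all }a\in(\hat{\mathbb{Z}}/e\hat{\mathbb{Z}})^*\}$. A $\mu_e$-grading of $R$ as a $k$-algebra is a family $\{R_\zeta\}_{\zeta\in\mu_e}$ of $k$-submodules with $\bigoplus R_\zeta\to R$ an isomorphism, $1\in R_1$ and $R_\zeta R_\xi\subseteq R_{\zeta\xi}$. *)

theory Defs
  imports Complex_Main "HOL-Library.Extended_Nat" "HOL-Library.Function_Algebras" "HOL-Library.FuncSet"
    "HOL-Computational_Algebra.Primes"
begin

text \<open>A Steinitz number is given by its exponent function p |-> n_p (values at non-primes ignored).\<close>
type_synonym steinitz = "nat \<Rightarrow> enat"

definition sdvd :: "nat \<Rightarrow> steinitz \<Rightarrow> bool" where
  "sdvd d e \<longleftrightarrow> d > 0 \<and> (\<forall>p. prime p \<longrightarrow> enat (multiplicity p d) \<le> e p)"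

definition mu :: "steinitz \<Rightarrow> complex set" where
  "mu e = {z. \<exists>d. sdvd d e \<and> z ^ d = 1}"

definition ZMu :: "steinitz \<Rightarrow> complex set" where
  "ZMu e = \<Inter>{A. mu e \<subseteq> A \<and> 1 \<in> A \<and>
      (\<forall>x\<in>A. \<forall>y\<in>A. x + y \<in> A \<and> - x \<in> A \<and> x * y \<in> A)}"

definition cord :: "complex \<Rightarrow> nat" where
  "cord z = (LEAST n. n > 0 \<and> z ^ n = 1)"

definition zhat :: "steinitz \<Rightarrow> (nat \<Rightarrow> int) set" where
  "zhat e = {a. (\<forall>d. sdvd d e \<longrightarrow> 0 \<le> a d \<and> a d < int d) \<and>
                (\<forall>d. \<not> sdvd d e \<longrightarrow> a d = 0) \<and>
                (\<forall>d d'. sdvd d e \<and> sdvd d' e \<and> d dvd d' \<longrightarrow> a d' mod int d = a d)}"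

definition zhat_units :: "steinitz \<Rightarrow> (nat \<Rightarrow> int) set" where
  "zhat_units e = {a \<in> zhat e. \<forall>d. sdvd d e \<longrightarrow> coprime (a d) (int d)}"

text \<open>action zeta |-> zeta^a, using a mod ord(zeta)\<close>
definition hpow :: "complex \<Rightarrow> (nat \<Rightarrow> int) \<Rightarrow> complex" where
  "hpow z a = z ^ nat (a (cord z))"

definition tauZ :: "steinitz \<Rightarrow> (nat \<Rightarrow> int) \<Rightarrow> complex \<Rightarrow> complex" where
  "tauZ e a = (SOME h. (\<forall>z\<in>mu e. h z = hpow z a) \<and> h 1 = 1 \<and>
      (\<forall>x\<in>ZMu e. \<forall>y\<in>ZMu e. h (x + y) = h x + h y \<and> h (x * y) = h x * h y))"

text \<open>Formal Z-linear combinations of pairs (a,b), as finitely supported functions.\<close>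
definition fdelta :: "'x \<Rightarrow> 'x \<Rightarrow> int" where
  "fdelta x = (\<lambda>y. if y = x then 1 else 0)"

definition fsums :: "complex set \<Rightarrow> ('a \<times> complex \<Rightarrow> int) set" where
  "fsums B = {f. finite {x. f x \<noteq> 0} \<and> (\<forall>x. f x \<noteq> 0 \<longrightarrow> snd x \<in> B)}"

definition tgens :: "complex set \<Rightarrow> ('a::ab_group_add \<times> complex \<Rightarrow> int) set" where
  "tgens B = {fdelta (a + a', b) - fdelta (a, b) - fdelta (a', b) | a a' b. b \<in> B}
           \<union> {fdelta (a, b + b') - fdelta (a, b) - fdelta (a, b') | a b b'. b \<in> B \<and> b' \<in> B}"

definition trel :: "complex set \<Rightarrow> ('a::ab_group_add \<times> complex \<Rightarrow> int) set" where
  "trel B = \<Inter>{H. tgens B \<subseteq> H \<and> 0 \<in> H \<and> (\<forall>x\<in>H. \<forall>y\<in>H. x - y \<in> H)}"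

definition tclass :: "complex set \<Rightarrow> ('a::ab_group_add \<times> complex \<Rightarrow> int) \<Rightarrow> ('a \<times> complex \<Rightarrow> int) set" where
  "tclass B f = {g. g - f \<in> trel B}"

definition tcarrier :: "complex set \<Rightarrow> ('a::ab_group_add \<times> complex \<Rightarrow> int) set set" where
  "tcarrier B = tclass B ` fsums B"

definition trep :: "('a \<times> complex \<Rightarrow> int) set \<Rightarrow> ('a \<times> complex \<Rightarrow> int)" where
  "trep X = (SOME f. f \<in> X)"

definition tpure :: "complex set \<Rightarrow> 'a::ab_group_add \<Rightarrow> complex \<Rightarrow> ('a \<times> complex \<Rightarrow> int) set" where
  "tpure B a b = tclass B (fdelta (a, b))"

definition tzero :: "complex set \<Rightarrow> ('a::ab_group_add \<times> complex \<Rightarrow> int) set" where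
  "tzero B = tclass B 0"

definition tadd :: "complex set \<Rightarrow> ('a::ab_group_add \<times> complex \<Rightarrow> int) set \<Rightarrow> ('a \<times> complex \<Rightarrow> int) set
    \<Rightarrow> ('a \<times> complex \<Rightarrow> int) set" where
  "tadd B X Y = tclass B (trep X + trep Y)"

definition tsum :: "complex set \<Rightarrow> ('i \<Rightarrow> ('a::ab_group_add \<times> complex \<Rightarrow> int) set) \<Rightarrow> 'i set
    \<Rightarrow> ('a \<times> complex \<Rightarrow> int) set" where
  "tsum B g S = tclass B (\<Sum>i\<in>S. trep (g i))"

text \<open>bilinear extension of (a \<otimes> b)(a' \<otimes> b') = aa' \<otimes> bb'\<close>
definition fmul :: "('a::times \<times> complex \<Rightarrow> int) \<Rightarrow> ('a \<times> complex \<Rightarrow> int) \<Rightarrow> ('a \<times> complex \<Rightarrow> int)" where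
  "fmul f g = (\<lambda>z. \<Sum>(x, y) \<in> {(x, y). f x \<noteq> 0 \<and> g y \<noteq> 0 \<and> (fst x * fst y, snd x * snd y) = z}.
                    f x * g y)"

definition tmul :: "complex set \<Rightarrow> ('a::{ab_group_add,times} \<times> complex \<Rightarrow> int) set
    \<Rightarrow> ('a \<times> complex \<Rightarrow> int) set \<Rightarrow> ('a \<times> complex \<Rightarrow> int) set" where
  "tmul B X Y = tclass B (fmul (trep X) (trep Y))"

definition fpush :: "('x \<Rightarrow> 'y) \<Rightarrow> ('x \<Rightarrow> int) \<Rightarrow> ('y \<Rightarrow> int)" where
  "fpush F f = (\<lambda>z. \<Sum>x \<in> {x. f x \<noteq> 0 \<and> F x = z}. f x)"

definition tmapL :: "complex set \<Rightarrow> ('a \<Rightarrow> 'b) \<Rightarrow> ('a::ab_group_add \<times> complex \<Rightarrow> int) set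
    \<Rightarrow> ('b::ab_group_add \<times> complex \<Rightarrow> int) set" where
  "tmapL B h X = tclass B (fpush (\<lambda>(a, b). (h a, b)) (trep X))"

definition tmapR :: "complex set \<Rightarrow> (complex \<Rightarrow> complex) \<Rightarrow> ('a::ab_group_add \<times> complex \<Rightarrow> int) set
    \<Rightarrow> ('a \<times> complex \<Rightarrow> int) set" where
  "tmapR B g X = tclass B (fpush (\<lambda>(a, b). (a, g b)) (trep X))"

type_synonym 'a tens = "('a \<times> complex \<Rightarrow> int) set"

definition kalg :: "('k::comm_ring_1 \<Rightarrow> 'r::ring_1) \<Rightarrow> bool" where
  "kalg phi \<longleftrightarrow> phi 1 = 1 \<and> (\<forall>a b. phi (a + b) = phi a + phi b \<and> phi (a * b) = phi a * phi b)
      \<and> (\<forall>c r. phi c * r = r * phi c)"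

text \<open>k'-algebra automorphism of R'; k' acts on R' through phi \<otimes> id : k' -> R'.
  Functions are normalised to be extensional on the carrier of R'.\<close>
definition kp_aut :: "steinitz \<Rightarrow> ('k::comm_ring_1 \<Rightarrow> 'r::ring_1) \<Rightarrow> ('r tens \<Rightarrow> 'r tens) \<Rightarrow> bool" where
  "kp_aut e phi s \<longleftrightarrow> (let B = ZMu e in
      s \<in> extensional (tcarrier B) \<and> bij_betw s (tcarrier B) (tcarrier B) \<and>
      (\<forall>x\<in>tcarrier B. \<forall>y\<in>tcarrier B. s (tadd B x y) = tadd B (s x) (s y) \<and>
                                      s (tmul B x y) = tmul B (s x) (s y)) \<and>
      s (tpure B 1 1) = tpure B 1 1 \<and>
      (\<forall>c\<in>(tcarrier B :: 'k tens set). \<forall>x\<in>tcarrier B.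
          s (tmul B (tmapL B phi c) x) = tmul B (tmapL B phi c) (s x)))"

definition eig :: "steinitz \<Rightarrow> ('r::ring_1 tens \<Rightarrow> 'r tens) \<Rightarrow> complex \<Rightarrow> 'r tens set" where
  "eig e s z = {x \<in> tcarrier (ZMu e). s x = tmul (ZMu e) (tpure (ZMu e) 1 z) x}"

definition decomp :: "steinitz \<Rightarrow> ('r::ring_1 tens \<Rightarrow> 'r tens) \<Rightarrow> 'r tens \<Rightarrow> (complex \<Rightarrow> 'r tens) \<Rightarrow> bool" where
  "decomp e s x g \<longleftrightarrow> (\<forall>z. z \<notin> mu e \<longrightarrow> g z = tzero (ZMu e)) \<and>
      finite {z. g z \<noteq> tzero (ZMu e)} \<and> (\<forall>z\<in>mu e. g z \<in> eig e s z) \<and>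
      x = tsum (ZMu e) g {z. g z \<noteq> tzero (ZMu e)}"

text \<open>the direct sum of the eigenspaces maps isomorphically onto R'\<close>
definition mu_diag :: "steinitz \<Rightarrow> ('r::ring_1 tens \<Rightarrow> 'r tens) \<Rightarrow> bool" where
  "mu_diag e s \<longleftrightarrow> (\<forall>x\<in>tcarrier (ZMu e). \<exists>!g. decomp e s x g)"

text \<open>s^a acts on R'(s,zeta) as zeta^a\<close>
definition spow :: "steinitz \<Rightarrow> ('r::ring_1 tens \<Rightarrow> 'r tens) \<Rightarrow> (nat \<Rightarrow> int) \<Rightarrow> 'r tens \<Rightarrow> 'r tens" where
  "spow e s a x = (let g = (THE g. decomp e s x g) in
      tsum (ZMu e) (\<lambda>z. tmul (ZMu e) (tpure (ZMu e) 1 (hpow z a)) (g z)) {z. g z \<noteq> tzero (ZMu e)})"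

definition tau :: "steinitz \<Rightarrow> (nat \<Rightarrow> int) \<Rightarrow> 'r::ring_1 tens \<Rightarrow> 'r tens" where
  "tau e a = tmapR (ZMu e) (tauZ e a)"

definition Xe :: "steinitz \<Rightarrow> ('k::comm_ring_1 \<Rightarrow> 'r::ring_1) \<Rightarrow> ('r tens \<Rightarrow> 'r tens) set" where
  "Xe e phi = {s. kp_aut e phi s \<and> mu_diag e s \<and>
      (\<forall>a\<in>zhat_units e. \<forall>x\<in>tcarrier (ZMu e).
         tau e a (s (inv_into (tcarrier (ZMu e)) (tau e a) x)) = spow e s a x)}"

definition gradings :: "steinitz \<Rightarrow> ('k::comm_ring_1 \<Rightarrow> 'r::ring_1) \<Rightarrow> (complex \<Rightarrow> 'r set) set" where
  "gradings e phi = {G.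
      (\<forall>z. z \<notin> mu e \<longrightarrow> G z = {0}) \<and>
      (\<forall>z\<in>mu e. 0 \<in> G z \<and> (\<forall>x\<in>G z. \<forall>y\<in>G z. x + y \<in> G z) \<and> (\<forall>c. \<forall>x\<in>G z. phi c * x \<in> G z)) \<and>
      (\<forall>r. \<exists>!g. (\<forall>z. g z \<in> G z) \<and> finite {z. g z \<noteq> 0} \<and> r = (\<Sum>z\<in>{z. g z \<noteq> 0}. g z)) \<and>
      1 \<in> G 1 \<and>
      (\<forall>z\<in>mu e. \<forall>w\<in>mu e. \<forall>x\<in>G z. \<forall>y\<in>G w. x * y \<in> G (z * w))}"

definition grad_map_prop :: "steinitz \<Rightarrow> ('k::comm_ring_1 \<Rightarrow> 'r::ring_1) \<Rightarrow> (complex \<Rightarrow> 'r set)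
    \<Rightarrow> ('r tens \<Rightarrow> 'r tens) \<Rightarrow> bool" where
  "grad_map_prop e phi G s \<longleftrightarrow> (let B = ZMu e in
      s \<in> extensional (tcarrier B) \<and> s \<in> tcarrier B \<rightarrow> tcarrier B \<and>
      (\<forall>x\<in>tcarrier B. \<forall>y\<in>tcarrier B. s (tadd B x y) = tadd B (s x) (s y)) \<and>
      (\<forall>c\<in>(tcarrier B :: 'k tens set). \<forall>x\<in>tcarrier B.
          s (tmul B (tmapL B phi c) x) = tmul B (tmapL B phi c) (s x)) \<and>
      (\<forall>z\<in>mu e. \<forall>r\<in>G z. \<forall>u\<in>B. s (tpure B r u) = tpure B r (z * u)))"

definition Phi :: "steinitz \<Rightarrow> ('k::comm_ring_1 \<Rightarrow> 'r::ring_1) \<Rightarrow> (complex \<Rightarrow> 'r set) \<Rightarrow> ('r tens \<Rightarrow> 'r tens)" where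
  "Phi e phi G = (THE s. grad_map_prop e phi G s)"

text \<open>s |-> (R'(s,zeta) \<inter> R), R identified with R \<otimes> 1\<close>
definition Psi :: "steinitz \<Rightarrow> ('r::ring_1 tens \<Rightarrow> 'r tens) \<Rightarrow> (complex \<Rightarrow> 'r set)" where
  "Psi e s = (\<lambda>z. if z \<in> mu e then {r. tpure (ZMu e) r 1 \<in> eig e s z} else {0})"

end

theory Submission
  imports Defs "HOL-Number_Theory.Number_Theory"
begin

text \<open>Let B be the ring generated by the roots of unity. On the tensor product of R and B, the grading defines
  an automorphism by multiplying the component of degree z by z. Its eigenspaces are the components
  extended to B, because z - w divides some n dividing e, and n acts injectively on the tensor product:
  finitely generated subgroups of B are free.

  Conversely, the relation with the Galois action says precisely that Galois automorphisms preserve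
  the eigenspaces, hence fix the eigencomponents of elements of R. Taking traces
  shows that an invariant of level n has a multiple in R by a divisor g of n, and g can be cancelled
  since the tensor product of R with B/Z has no additional torsion: 1/g is not in B for g > 1.\<close>

section \<open>Finitely generated groups of complex numbers\<close>

text \<open>The hypothesis shapes the descent: only divisors of \<open>e\<close> may be cancelled in
  R, whereas the plain trace of an invariant multiplies it by the number of units modulo n, which
  need not divide \<open>e\<close>. Hence the traces of w x for all n-th roots of unity w are used
  together. They multiply x by Ramanujan sums, and Fourier inversion on Z/n shows that these sums
  generate an ideal containing n.

  Z[mu_e] is in general not finitely generated, so no finite basis serves globally. A relation in
  the tensor product involves finitely many elements, and questions of torsion and divisibility are
  moved to a finitely generated subgroup, where a basis exists. Such bases also bound divisibility,
  and this replaces the theory of algebraic integers: it yields Z[mu_e] \<inter> Q = Z as well as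
  the irreducibility statement that makes the Galois action well defined.

  The condition in \<open>Xe\<close> quantifies over profinite units, so units modulo n must be
  lifted to them before a trace of level n can be formed.\<close>

inductive_set zspan :: "complex set \<Rightarrow> complex set" for E where
  zspan_zero: "0 \<in> zspan E"
| zspan_add_gen: "x \<in> zspan E \<Longrightarrow> g \<in> E \<Longrightarrow> x + g \<in> zspan E"
| zspan_diff_gen: "x \<in> zspan E \<Longrightarrow> g \<in> E \<Longrightarrow> x - g \<in> zspan E"

lemma zspan_base: "g \<in> E \<Longrightarrow> g \<in> zspan E"
  using zspan_add_gen[OF zspan_zero] by simp

lemma zspan_add: "y \<in> zspan E \<Longrightarrow> x \<in> zspan E \<Longrightarrow> x + y \<in> zspan E"
  by (induction rule: zspan.induct)
     (auto simp: add.assoc[symmetric] add_diff_eq intro: zspan_add_gen zspan_diff_gen)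

lemma zspan_uminus: "x \<in> zspan E \<Longrightarrow> - x \<in> zspan E"
proof (induction rule: zspan.induct)
  case (zspan_add_gen x g)
  then show ?case using zspan_diff_gen[of "-x" E g] by simp
next
  case (zspan_diff_gen x g)
  then show ?case using zspan_add_gen[of "-x" E g] by simp
qed (simp add: zspan_zero)

lemma zspan_diff: "x \<in> zspan E \<Longrightarrow> y \<in> zspan E \<Longrightarrow> x - y \<in> zspan E"
  using zspan_add[OF zspan_uminus, of y E x] by simp

lemma zspan_sum: "(\<And>i. i \<in> I \<Longrightarrow> f i \<in> zspan E) \<Longrightarrow> sum f I \<in> zspan E"
  by (induction I rule: infinite_finite_induct) (auto intro: zspan_zero zspan_add)

lemma zspan_of_nat: "x \<in> zspan E \<Longrightarrow> of_nat k * x \<in> zspan E"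
  by (induction k) (auto simp: ring_distribs intro: zspan_zero zspan_add)

lemma zspan_of_int: "x \<in> zspan E \<Longrightarrow> of_int k * x \<in> zspan E"
  by (cases k) (auto simp: zspan_of_nat minus_mult_left[symmetric] simp del: of_nat_Suc minus_add_distrib
      intro!: zspan_uminus)

lemma zspan_least:
  assumes "E \<subseteq> zspan F" shows "zspan E \<subseteq> zspan F"
proof
  fix x assume "x \<in> zspan E"
  then show "x \<in> zspan F"
    by induction (use assms in \<open>auto intro: zspan_zero zspan_add zspan_diff\<close>)
qed

lemma zspan_mono: "E \<subseteq> F \<Longrightarrow> zspan E \<subseteq> zspan F"
  by (rule zspan_least) (auto intro: zspan_base)

lemma zspan_mult:
  assumes "\<And>x y. x \<in> E \<Longrightarrow> y \<in> E \<Longrightarrow> x * y \<in> zspan E"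
    and "x \<in> zspan E" "y \<in> zspan E"
  shows "x * y \<in> zspan E"
proof -
  have *: "x * y \<in> zspan E" if "x \<in> zspan E" "y \<in> E" for x y
    using that(1) by induction (use assms(1) that in \<open>auto simp: ring_distribs intro: zspan_zero zspan_add zspan_diff\<close>)
  show ?thesis
    using assms(3) by induction (use * assms(2) in \<open>auto simp: ring_distribs intro: zspan_zero zspan_add zspan_diff\<close>)
qed

lemma zspan_finite:
  "x \<in> zspan E \<Longrightarrow> \<exists>F. finite F \<and> F \<subseteq> E \<and> x \<in> zspan F"
proof (induction rule: zspan.induct)
  case zspan_zero
  then show ?case using zspan.zspan_zero[of "{}"] by blast
next
  case (zspan_add_gen x g)
  then obtain F where "finite F" "F \<subseteq> E" "x \<in> zspan F" by auto
  then show ?case using zspan_add_gen zspan_mono[of F "insert g F"]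
    by (intro exI[of _ "insert g F"]) (auto intro!: zspan.zspan_add_gen)
next
  case (zspan_diff_gen x g)
  then obtain F where "finite F" "F \<subseteq> E" "x \<in> zspan F" by auto
  then show ?case using zspan_diff_gen zspan_mono[of F "insert g F"]
    by (intro exI[of _ "insert g F"]) (auto intro!: zspan.zspan_diff_gen)
qed

abbreviation lcomb :: "nat \<Rightarrow> (nat \<Rightarrow> int) \<Rightarrow> (nat \<Rightarrow> complex) \<Rightarrow> complex" where
  "lcomb d c b \<equiv> (\<Sum>i<d. of_int (c i) * b i)"

lemma zspan_lcombE:
  assumes "x \<in> zspan (b ` {..<d})"
  shows "\<exists>c. x = lcomb d c b"
  using assms
proof (induction rule: zspan.induct)
  case zspan_zero
  show ?case by (rule exI[of _ "\<lambda>_. 0"]) simp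
next
  case (zspan_add_gen x g)
  then obtain c j where c: "x = lcomb d c b" and j: "j < d" "g = b j" by auto
  have "(\<Sum>i<d. of_int ((c(j := c j + 1)) i) * b i) = (\<Sum>i<d. of_int (c i) * b i + (if i = j then b i else 0))"
    by (intro sum.cong) (auto simp: ring_distribs)
  also have "\<dots> = x + g" using j by (simp add: sum.distrib c)
  finally show ?case by (intro exI[of _ "c(j := c j + 1)"]) simp
next
  case (zspan_diff_gen x g)
  then obtain c j where c: "x = lcomb d c b" and j: "j < d" "g = b j" by auto
  have "(\<Sum>i<d. of_int ((c(j := c j - 1)) i) * b i) = (\<Sum>i<d. of_int (c i) * b i - (if i = j then b i else 0))"
    by (intro sum.cong) (auto simp: ring_distribs)
  also have "\<dots> = x - g" using j by (simp add: sum_subtractf c)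
  finally show ?case by (intro exI[of _ "c(j := c j - 1)"]) simp
qed

lemma lcomb_split2:
  assumes "i < d" "j < d" "i \<noteq> j"
  shows "lcomb d c b = of_int (c i) * b i + of_int (c j) * b j + (\<Sum>k\<in>{..<d} - {i,j}. of_int (c k) * b k)"
proof -
  have "lcomb d c b = of_int (c i) * b i + (\<Sum>k\<in>{..<d} - {i}. of_int (c k) * b k)"
    using assms by (simp add: sum.remove)
  also have "(\<Sum>k\<in>{..<d} - {i}. of_int (c k) * b k) = of_int (c j) * b j + (\<Sum>k\<in>{..<d} - {i} - {j}. of_int (c k) * b k)"
    using assms by (subst sum.remove[of _ j]) auto
  also have "{..<d} - {i} - {j} = {..<d} - {i,j}" by auto
  finally show ?thesis by simp
qed

text \<open>A Euclidean step on the coefficients of a relation, mirrored on the generators, makes the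
  relation smaller; once it has a single term, torsion-freeness says that this generator is 0.\<close>

lemma zspan_drop_generator:
  assumes "lcomb d c b = 0" "\<exists>i<d. c i \<noteq> 0"
  shows "\<exists>b'. zspan (b' ` {..<d - 1}) = zspan (b ` {..<d})"
  using assms
proof (induction "nat (\<Sum>i<d. \<bar>c i\<bar>)" arbitrary: b c rule: less_induct)
  case less
  show ?case
  proof (cases "\<exists>i j. i < d \<and> j < d \<and> i \<noteq> j \<and> c i \<noteq> 0 \<and> c j \<noteq> 0")
    case True
    then obtain i j where ij: "i < d" "j < d" "i \<noteq> j" "c i \<noteq> 0" "c j \<noteq> 0" "\<bar>c j\<bar> \<le> \<bar>c i\<bar>"
    proof -
      obtain i j where *: "i < d" "j < d" "i \<noteq> j" "c i \<noteq> 0" "c j \<noteq> 0" using True by blast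
      show thesis
      proof (cases "\<bar>c j\<bar> \<le> \<bar>c i\<bar>")
        case True show ?thesis by (rule that[OF *(1-5) True])
      next
        case False
        then have "\<bar>c i\<bar> \<le> \<bar>c j\<bar>" by simp
        then show ?thesis by (rule that[OF *(2,1) *(3)[symmetric] *(5,4)])
      qed
    qed
    \<comment> \<open>As |c j| <= |c i|, the number s * c j has the sign of c i, and subtracting it
      makes |c i| smaller; adding s * b i to b j restores the value of the combination.\<close>
    define s where "s = sgn (c i) * sgn (c j)"
    define b' where "b' = b(j := b j + of_int s * b i)"
    define c' where "c' = c(i := c i - s * c j)"
    have "lcomb d c' b' = lcomb d c b"
      unfolding lcomb_split2[OF ij(1-3)] b'_def c'_def using ij by (simp add: algebra_simps)
    then have z: "lcomb d c' b' = 0" using less by simp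
    have nz: "\<exists>k<d. c' k \<noteq> 0" using ij by (intro exI[of _ j]) (auto simp: c'_def)
    have ci: "\<bar>c' i\<bar> < \<bar>c i\<bar>" using ij by (auto simp: c'_def s_def sgn_if split: if_splits)
    have "(\<Sum>k<d. \<bar>c' k\<bar>) < (\<Sum>k<d. \<bar>c k\<bar>)"
      by (rule sum_strict_mono_ex1) (use ci ij in \<open>auto simp: c'_def\<close>)
    moreover have "0 \<le> (\<Sum>k<d. \<bar>c' k\<bar>)" by (simp add: sum_nonneg)
    ultimately have "nat (\<Sum>k<d. \<bar>c' k\<bar>) < nat (\<Sum>k<d. \<bar>c k\<bar>)" by linarith
    from less.hyps[OF this z nz] obtain b''
      where b'': "zspan (b'' ` {..<d - 1}) = zspan (b' ` {..<d})" by auto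
    have bk: "b k \<in> zspan (b ` {..<d})" if "k < d" for k using that by (auto intro: zspan_base)
    have "b' k \<in> zspan (b ` {..<d})" if "k < d" for k
      using bk[OF that] bk[OF ij(1)] bk[OF ij(2)] by (cases "k = j") (auto simp: b'_def intro: zspan_add zspan_of_int)
    then have "b' ` {..<d} \<subseteq> zspan (b ` {..<d})" by auto
    moreover have "b ` {..<d} \<subseteq> zspan (b' ` {..<d})"
    proof
      fix x assume "x \<in> b ` {..<d}"
      then obtain k where k: "k < d" "x = b k" by auto
      have *: "b' m \<in> zspan (b' ` {..<d})" if "m < d" for m using that by (auto intro: zspan_base)
      have "b j = b' j - of_int s * b' i" using ij by (simp add: b'_def)
      then have "b j \<in> zspan (b' ` {..<d})" using * ij by (auto intro!: zspan_diff zspan_of_int)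
      moreover have "k \<noteq> j \<Longrightarrow> b k = b' k" by (simp add: b'_def)
      ultimately show "x \<in> zspan (b' ` {..<d})" using * k by metis
    qed
    ultimately have "zspan (b' ` {..<d}) = zspan (b ` {..<d})"
      by (intro subset_antisym zspan_least)
    with b'' show ?thesis by auto
  next
    case False
    with less(3) obtain i where i: "i < d" "c i \<noteq> 0" "\<And>j. j < d \<Longrightarrow> j \<noteq> i \<Longrightarrow> c j = 0" by blast
    have "lcomb d c b = of_int (c i) * b i + (\<Sum>k\<in>{..<d} - {i}. of_int (c k) * b k)"
      using i by (simp add: sum.remove)
    also have "(\<Sum>k\<in>{..<d} - {i}. of_int (c k) * b k) = 0" by (rule sum.neutral) (use i in auto)
    finally have bi: "b i = 0" using i less by simp
    \<comment> \<open>The vanishing generator is overwritten by the last one, so the indices below d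
      - 1 still reach every other generator.\<close>
    define b' where "b' = b(i := b (d - 1))"
    have "b' ` {..<d - 1} \<subseteq> b ` {..<d}" using i by (auto simp: b'_def)
    moreover have "b ` {..<d} \<subseteq> zspan (b' ` {..<d - 1})"
    proof
      fix x assume "x \<in> b ` {..<d}"
      then obtain k where k: "k < d" "x = b k" by auto
      consider "k = i" | "k \<noteq> i" "k = d - 1" | "k \<noteq> i" "k < d - 1" using k by linarith
      then show "x \<in> zspan (b' ` {..<d - 1})"
      proof cases
        case 1 then show ?thesis using bi k zspan_zero by simp
      next
        case 2 then have "x = b' i" "i < d - 1" using k i by (auto simp: b'_def)
        then show ?thesis by (auto intro: zspan_base)
      next
        case 3 then have "x = b' k" using k by (auto simp: b'_def)
        then show ?thesis using 3 by (auto intro: zspan_base)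
      qed
    qed
    ultimately have "zspan (b' ` {..<d - 1}) = zspan (b ` {..<d})"
      by (intro subset_antisym zspan_least zspan_mono)
    then show ?thesis by auto
  qed
qed

text \<open>A generating family of least possible length is independent, because a nontrivial
  relation would let \<open>zspan_drop_generator\<close> shorten it.\<close>

lemma zspan_basis_exists:
  assumes "finite E"
  shows "\<exists>b d. zspan (b ` {..<d}) = zspan E \<and> (\<forall>c. lcomb d c b = 0 \<longrightarrow> (\<forall>i<d. c i = 0))"
proof -
  let ?P = "\<lambda>d::nat. \<exists>b. zspan (b ` {..<d}) = zspan E"
  obtain h where "E = h ` {i. i < card E}"
    using finite_imp_nat_seg_image_inj_on[OF assms] card_image by (metis card_Collect_less_nat)
  then have "zspan (h ` {..<card E}) = zspan E" by (simp add: lessThan_def)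
  then have "?P (card E)" by blast
  then have *: "?P (Least ?P)" by (rule LeastI[of ?P])
  define d where "d = Least ?P"
  from * obtain b where b: "zspan (b ` {..<d}) = zspan E" unfolding d_def by blast
  have "\<forall>i<d. c i = 0" if "lcomb d c b = 0" for c
  proof (rule ccontr)
    assume "\<not> (\<forall>i<d. c i = 0)"
    then have ex: "\<exists>i<d. c i \<noteq> 0" by auto
    from zspan_drop_generator[OF that this] b have "?P (d - 1)" by simp
    then have "d \<le> d - 1" unfolding d_def by (rule Least_le)
    with ex show False by auto
  qed
  with b show ?thesis by blast
qed

text \<open>The coordinates \<kappa> are chosen separately for every number; independence makes them
  unique on the group, which forces additivity. An expansion with additive integer coefficients is
  the form in which freeness is used later.\<close>

lemma zspan_free_coordinates:
  assumes "finite E"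
  obtains d b \<kappa> where "\<And>i. i < (d::nat) \<Longrightarrow> b i \<in> zspan E"
    "\<And>x. x \<in> zspan E \<Longrightarrow> x = (\<Sum>i<d. of_int (\<kappa> i x) * b i)"
    "\<And>x y i. x \<in> zspan E \<Longrightarrow> y \<in> zspan E \<Longrightarrow> i < d \<Longrightarrow> \<kappa> i (x + y) = \<kappa> i x + (\<kappa> i y :: int)"
proof -
  obtain b d where b: "zspan (b ` {..<d}) = zspan E"
    and ind: "\<And>c i. lcomb d c b = 0 \<Longrightarrow> i < d \<Longrightarrow> c i = 0"
    using zspan_basis_exists[OF assms] by metis
  define \<kappa> where "\<kappa> i x = (SOME c. x = lcomb d c b) i" for i :: nat and x
  have 1: "b i \<in> zspan E" if "i < d" for i unfolding b[symmetric] using that by (auto intro: zspan_base)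
  have 2: "x = (\<Sum>i<d. of_int (\<kappa> i x) * b i)" if "x \<in> zspan E" for x
    unfolding \<kappa>_def using someI_ex[OF zspan_lcombE[of x b d]] that b by simp
  have 3: "\<kappa> i (x + y) = \<kappa> i x + \<kappa> i y" if "x \<in> zspan E" "y \<in> zspan E" "i < d" for x y i
  proof -
    have "lcomb d (\<lambda>i. \<kappa> i (x + y) - (\<kappa> i x + \<kappa> i y)) b = (x + y) - (x + y)"
      using 2[OF zspan_add[OF that(2,1)]] 2[OF that(1)] 2[OF that(2)]
      by (simp add: ring_distribs sum.distrib sum_subtractf)
    then have "lcomb d (\<lambda>i. \<kappa> i (x + y) - (\<kappa> i x + \<kappa> i y)) b = 0" by simp
    from ind[OF this that(3)] show ?thesis by simp
  qed
  show ?thesis using that[OF 1 2 3] by blast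
qed

lemma additive_coord_of_nat:
  fixes \<kappa> :: "complex \<Rightarrow> int"
  assumes "\<And>x y. x \<in> zspan E \<Longrightarrow> y \<in> zspan E \<Longrightarrow> \<kappa> (x + y) = \<kappa> x + \<kappa> y" "x \<in> zspan E"
  shows "\<kappa> (of_nat n * x) = int n * \<kappa> x"
proof (induction n)
  case 0
  have "\<kappa> (0 + 0) = \<kappa> 0 + \<kappa> 0" by (rule assms(1)) (auto intro: zspan_zero)
  then show ?case by simp
next
  case (Suc n)
  have "\<kappa> (of_nat (Suc n) * x) = \<kappa> (x + of_nat n * x)" by (simp add: ring_distribs)
  also have "\<dots> = \<kappa> x + \<kappa> (of_nat n * x)" by (intro assms zspan_of_nat)
  finally show ?case using Suc by (simp add: ring_distribs)
qed

text \<open>Some coordinate k of x is nonzero, and x = n * y makes n a divisor of k, so n <=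
  |k|.\<close>

lemma zspan_divisible_bound:
  assumes "finite E" "x \<in> zspan E" "x \<noteq> 0"
  shows "\<exists>N. \<forall>n>N. \<forall>y\<in>zspan E. x \<noteq> of_nat n * y"
proof -
  obtain d b \<kappa> where b: "\<And>i. i < (d::nat) \<Longrightarrow> b i \<in> zspan E"
    "\<And>x. x \<in> zspan E \<Longrightarrow> x = (\<Sum>i<d. of_int (\<kappa> i x) * b i)"
    "\<And>x y i. x \<in> zspan E \<Longrightarrow> y \<in> zspan E \<Longrightarrow> i < d \<Longrightarrow> \<kappa> i (x + y) = \<kappa> i x + (\<kappa> i y :: int)"
    by (rule zspan_free_coordinates[OF assms(1)], rule that)
  obtain i where i: "i < d" "\<kappa> i x \<noteq> 0"
  proof (rule ccontr)
    assume "\<not> thesis"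
    with that have "\<And>i. i < d \<Longrightarrow> \<kappa> i x = 0" by blast
    then have "(\<Sum>i<d. of_int (\<kappa> i x) * b i) = 0" by (intro sum.neutral) auto
    with b(2)[OF assms(2)] assms(3) show False by simp
  qed
  have "x \<noteq> of_nat n * y" if n: "n > nat \<bar>\<kappa> i x\<bar>" and y: "y \<in> zspan E" for n y
  proof
    assume "x = of_nat n * y"
    then have "\<kappa> i x = int n * \<kappa> i y"
      using additive_coord_of_nat[of E "\<kappa> i" y n] b(3) i y by auto
    then have "int n dvd \<kappa> i x" by simp
    then have "int n \<le> \<bar>\<kappa> i x\<bar>" using i dvd_imp_le_int[of "\<kappa> i x" "int n"] by simp
    with n show False by linarith
  qed
  then show ?thesis by blast
qed

section \<open>Irreducibility of cyclotomic polynomials\<close>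

lemma zspan_roots_mult: "x \<in> zspan {w. w ^ n = 1} \<Longrightarrow> y \<in> zspan {w. w ^ n = 1} \<Longrightarrow> x * y \<in> zspan {w. w ^ n = 1}"
  by (rule zspan_mult) (auto intro: zspan_base simp: power_mult_distrib)

lemma zspan_roots_power: "x \<in> zspan {w. w ^ n = 1} \<Longrightarrow> x ^ k \<in> zspan {w. w ^ n = 1}"
  by (induction k) (auto intro: zspan_roots_mult zspan_base)

text \<open>All binomial coefficients except the outer two are multiples of p, and the cofactor
  remains in the span because the n-th roots of unity are closed under products.\<close>

lemma frobenius_add:
  assumes "prime p" "x \<in> zspan {w. w ^ n = 1}" "y \<in> zspan {w. w ^ n = 1}"
  shows "\<exists>z\<in>zspan {w. w ^ n = 1}. (x + y) ^ p - (x ^ p + y ^ p) = of_nat p * z"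
proof -
  have p0: "p > 0" using assms(1) prime_gt_0_nat by simp
  define z where "z = (\<Sum>k\<in>{1..<p}. of_nat ((p choose k) div p) * (x ^ k * y ^ (p - k)))"
  have "{..p} = insert 0 (insert p {1..<p})" using p0 by auto
  then have "(x + y) ^ p = y ^ p + (x ^ p + (\<Sum>k\<in>{1..<p}. of_nat (p choose k) * x ^ k * y ^ (p - k)))"
    using p0 by (simp add: binomial_ring)
  also have "(\<Sum>k\<in>{1..<p}. of_nat (p choose k) * x ^ k * y ^ (p - k)) = of_nat p * z"
    unfolding z_def sum_distrib_left
  proof (rule sum.cong[OF refl])
    fix k assume "k \<in> {1..<p}"
    then have "p dvd (p choose k)" using assms(1) by (intro dvd_choose_prime) auto
    then have "of_nat (p choose k) = (of_nat p * of_nat ((p choose k) div p) :: complex)"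
      by (metis dvd_mult_div_cancel of_nat_mult)
    then show "of_nat (p choose k) * x ^ k * y ^ (p - k) =
        of_nat p * (of_nat ((p choose k) div p) * (x ^ k * y ^ (p - k)))" by (simp add: mult.assoc)
  qed
  finally have "(x + y) ^ p - (x ^ p + y ^ p) = of_nat p * z" by simp
  moreover have "z \<in> zspan {w. w ^ n = 1}"
    unfolding z_def by (intro zspan_sum zspan_of_nat zspan_roots_mult zspan_roots_power assms)
  ultimately show ?thesis by blast
qed

lemma frobenius_sum:
  assumes "prime p" "finite I" "\<And>i. i \<in> I \<Longrightarrow> x i \<in> zspan {w. w ^ n = 1}"
  shows "\<exists>z\<in>zspan {w. w ^ n = 1}. (\<Sum>i\<in>I. x i) ^ p - (\<Sum>i\<in>I. x i ^ p) = of_nat p * z"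
  using assms(2,3)
proof (induction I rule: finite_induct)
  case empty
  then show ?case using prime_gt_0_nat[OF assms(1)] by (auto intro: bexI[of _ 0] zspan_zero simp: zero_power)
next
  case (insert i I)
  then obtain z where z: "z \<in> zspan {w. w ^ n = 1}" "(\<Sum>i\<in>I. x i) ^ p - (\<Sum>i\<in>I. x i ^ p) = of_nat p * z" by auto
  obtain z' where z': "z' \<in> zspan {w. w ^ n = 1}"
    "(x i + sum x I) ^ p - (x i ^ p + sum x I ^ p) = of_nat p * z'"
    using frobenius_add[OF assms(1), of "x i" n "sum x I"] insert by (auto intro: zspan_sum)
  have "(\<Sum>i\<in>insert i I. x i) ^ p - (\<Sum>i\<in>insert i I. x i ^ p) = of_nat p * (z + z')"
    using insert z z' by (simp add: algebra_simps)
  then show ?case using zspan_add z z' by blast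
qed

lemma fermat_int:
  assumes "prime p" shows "int p dvd c ^ p - c"
proof -
  have p0: "p > 0" using assms prime_gt_0_nat by simp
  define a where "a = nat (c mod int p)"
  have a: "[int a = c] (mod int p)" using p0 by (simp add: a_def)
  have "[a ^ p = a] (mod p)"
  proof (cases "p dvd a")
    case True
    then show ?thesis using p0 by (simp add: cong_def mod_eq_0_iff_dvd dvd_power_iff dvd_trans[OF True] dvd_power)
  next
    case False
    from cong_mult[OF fermat_theorem[OF assms False] cong_refl[of a]] p0
    show ?thesis by (cases p) (simp_all add: mult.commute)
  qed
  then have "[int a ^ p = int a] (mod int p)" by (metis cong_int_iff of_nat_power)
  then have "[c ^ p = c] (mod int p)" using a by (meson cong_pow cong_sym cong_trans)
  then show ?thesis by (simp add: cong_iff_dvd_diff)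
qed

text \<open>Landau's argument for the irreducibility of cyclotomic polynomials: for a prime p, raising the exponents of a vanishing
  sum to the power p yields a multiple of p, by Frobenius; only finitely many values occur, so for
  large p it vanishes. Every unit modulo n is represented by a number without small prime factors.\<close>

lemma cyclotomic_conjugate:
  assumes n: "n > 0" and z: "z ^ n = (1::complex)" and cop: "coprime a n"
    and c: "(\<Sum>j\<in>J. of_int (c j) * z ^ r j) = 0" and J: "finite J"
  shows "(\<Sum>j\<in>J. of_int (c j) * z ^ (a * r j)) = 0"
proof -
  define L where "L = zspan {w::complex. w ^ n = 1}"
  \<comment> \<open>\<open>ev m\<close> is the relation with z replaced by z^m. It depends only on m
    modulo n, so a single bound M controls the divisibility of all its nonzero values.\<close>
  define ev where "ev m = (\<Sum>j\<in>J. of_int (c j) * z ^ (m * r j))" for m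
  have zm: "z ^ k = z ^ (k mod n)" for k
    by (metis div_mult_mod_eq power_add power_mult power_one mult.commute mult_1 z)
  have ev_mod: "ev m = ev (m mod n)" for m
  proof -
    have "z ^ (m * r j) = z ^ (m mod n * r j)" for j
      using zm[of "m * r j"] zm[of "m mod n * r j"] by (simp add: mod_mult_left_eq)
    then show ?thesis by (simp add: ev_def)
  qed
  have zL: "z ^ k \<in> L" for k
    unfolding L_def using z by (intro zspan_base) (metis (mono_tags) mem_Collect_eq mult.commute power_mult power_one)
  have evL: "ev m \<in> L" for m
    using zL unfolding ev_def L_def by (auto intro!: zspan_sum zspan_of_int)
  have fin: "finite {w::complex. w ^ n = 1}" using n by (intro finite_roots_unity) auto
  have "\<exists>N. \<forall>m. ev m \<noteq> 0 \<longrightarrow> (\<forall>k>N m. \<forall>y\<in>L. ev m \<noteq> of_nat k * y)"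
  proof (rule choice_iff[THEN iffD1], rule allI)
    fix m
    show "\<exists>N. ev m \<noteq> 0 \<longrightarrow> (\<forall>k>N. \<forall>y\<in>L. ev m \<noteq> of_nat k * y)"
      using zspan_divisible_bound[OF fin] evL[of m] unfolding L_def by blast
  qed
  then obtain N where N: "\<And>m k y. ev m \<noteq> 0 \<Longrightarrow> k > N m \<Longrightarrow> y \<in> L \<Longrightarrow> ev m \<noteq> of_nat k * y" by blast
  define M where "M = Max (N ` {..<n})"
  have M: "N m \<le> M" if "m < n" for m unfolding M_def using that by (intro Max_ge) auto
  have step: "ev (m * p) = 0" if ev0: "ev m = 0" and p: "prime p" "p > M" for m p
  proof (rule ccontr)
    assume nz: "ev (m * p) \<noteq> 0"
    obtain q where q: "q \<in> L" "(\<Sum>j\<in>J. of_int (c j) * z ^ (m * r j)) ^ p -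
        (\<Sum>j\<in>J. (of_int (c j) * z ^ (m * r j)) ^ p) = of_nat p * q"
      using frobenius_sum[OF p(1) J, of "\<lambda>j. of_int (c j) * z ^ (m * r j)" n] zL
      unfolding L_def by (auto intro: zspan_of_int)
    have p0: "p > 0" using p by (simp add: prime_gt_0_nat)
    \<comment> \<open>Frobenius produces the coefficients c j ^ p; by Fermat they differ from c j by
      multiples of p, which are absorbed into the error term.\<close>
    define d where "d j = (c j ^ p - c j) div int p" for j
    have d: "c j ^ p = c j + int p * d j" for j
      unfolding d_def using fermat_int[OF p(1), of "c j"] by simp
    have "(of_int (c j) * z ^ (m * r j)) ^ p = of_int (c j) * z ^ (m * p * r j) + of_nat p * (of_int (d j) * z ^ (m * p * r j))" for j
    proof -
      have "(of_int (c j) * z ^ (m * r j)) ^ p = of_int (c j ^ p) * z ^ (m * p * r j)"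
        by (simp add: power_mult_distrib power_mult[symmetric] algebra_simps)
      also have "c j ^ p = c j + int p * d j" by (rule d)
      finally show ?thesis by (simp add: algebra_simps)
    qed
    then have 1: "(\<Sum>j\<in>J. (of_int (c j) * z ^ (m * r j)) ^ p) = ev (m * p) + of_nat p * (\<Sum>j\<in>J. of_int (d j) * z ^ (m * p * r j))"
      by (simp add: ev_def sum.distrib sum_distrib_left)
    have 2: "(\<Sum>j\<in>J. of_int (c j) * z ^ (m * r j)) ^ p = 0"
      using ev0 p0 by (simp add: ev_def zero_power)
    have "ev (m * p) = of_nat p * (- q - (\<Sum>j\<in>J. of_int (d j) * z ^ (m * p * r j)))"
      using q(2)[symmetric] unfolding 1 2 by (simp add: right_diff_distrib)
    moreover have "- q - (\<Sum>j\<in>J. of_int (d j) * z ^ (m * p * r j)) \<in> L"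
      using q(1) zL unfolding L_def by (auto intro!: zspan_diff zspan_uminus zspan_sum zspan_of_int)
    moreover have "p > N (m * p mod n)" using M[of "m * p mod n"] n p by (simp add: le_less_trans)
    ultimately show False using N[of "m * p mod n" p] nz ev_mod by metis
  qed
  have big: "ev k = 0" if "k > 0" "\<And>p. prime p \<Longrightarrow> p dvd k \<Longrightarrow> p > M" for k
    using that
  proof (induction k rule: less_induct)
    case (less k)
    show ?case
    proof (cases "k = 1")
      case True then show ?thesis using c by (simp add: ev_def)
    next
      case False
      then obtain p where p: "prime p" "p dvd k" using prime_factor_nat by blast
      then obtain l where l: "k = l * p" by (metis dvd_def mult.commute)
      have "ev l = 0"
      proof (rule less.IH)
        show "l < k" using l less.prems prime_gt_1_nat[OF p(1)] by simp
        show "l > 0" using l less.prems by simp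
        show "\<And>q. prime q \<Longrightarrow> q dvd l \<Longrightarrow> M < q" using l less.prems by simp
      qed
      then show ?thesis using step p less.prems l by simp
    qed
  qed
  \<comment> \<open>A prime up to M divides exactly one of a and n * P: if it divides a, it is
    coprime to n and absent from P, and otherwise it is a factor of P. So a + n * P has only prime
    factors above M, and it is congruent to a modulo n.\<close>
  define P where "P = (\<Prod>q\<in>{q. prime q \<and> q \<le> M \<and> \<not> q dvd a}. q)"
  have finP: "finite {q. prime q \<and> q \<le> M \<and> \<not> q dvd a}" by (rule finite_subset[of _ "{..M}"]) auto
  have "P > 0" unfolding P_def by (rule prod_pos) (auto intro: prime_gt_0_nat)
  have "ev (a + n * P) = 0"
  proof (rule big)
    show "a + n * P > 0" using n \<open>P > 0\<close> by simp
    fix p assume p: "prime p" "p dvd a + n * P"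
    show "p > M"
    proof (rule ccontr)
      assume le: "\<not> p > M"
      show False
      proof (cases "p dvd a")
        case True
        then have "p dvd n * P" using p by (metis dvd_add_right_iff)
        moreover have "\<not> p dvd n" using True cop p(1) by (meson coprime_common_divisor not_prime_unit)
        ultimately have "p dvd P" using p(1) prime_dvd_mult_iff by blast
        then obtain q where q: "prime q" "\<not> q dvd a" "p dvd q"
          unfolding P_def using prime_dvd_prod_iff[OF finP p(1), of "\<lambda>q. q"] by auto
        then have "p = q" using p(1) primes_dvd_imp_eq by blast
        with q True show False by simp
      next
        case False
        then have "p dvd P" unfolding P_def using p(1) le finP by (intro dvd_prodI) auto
        with p(2) False show False by (metis dvd_add_left_iff dvd_mult)
      qed
    qed
  qed
  moreover have "ev (a + n * P) = ev a" using ev_mod[of "a + n * P"] ev_mod[of a] by simp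
  ultimately show ?thesis by (simp add: ev_def)
qed

section \<open>Integer-valued functions of finite support and the cyclotomic ring\<close>

definition fsupp :: "('x \<Rightarrow> int) \<Rightarrow> bool" where
  "fsupp f \<longleftrightarrow> finite {x. f x \<noteq> 0}"

text \<open>The additive extension of \<beta> to the free abelian group with basis
  \<open>fdelta x\<close>. Products, pushforwards and tensor coordinates below are all expressed
  through it.\<close>

definition lin :: "('x \<Rightarrow> 'b::ring_1) \<Rightarrow> ('x \<Rightarrow> int) \<Rightarrow> 'b" where
  "lin \<beta> f = (\<Sum>x | f x \<noteq> 0. of_int (f x) * \<beta> x)"

lemma lin_superset:
  assumes "finite S" "{x. f x \<noteq> 0} \<subseteq> S"
  shows "lin \<beta> f = (\<Sum>x\<in>S. of_int (f x) * \<beta> x)"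
  unfolding lin_def by (rule sum.mono_neutral_left) (use assms in auto)

lemma fsupp_add [intro]: "fsupp f \<Longrightarrow> fsupp g \<Longrightarrow> fsupp (f + g)"
  unfolding fsupp_def by (rule finite_subset[of _ "{x. f x \<noteq> 0} \<union> {x. g x \<noteq> 0}"]) auto

lemma fsupp_uminus [intro]: "fsupp f \<Longrightarrow> fsupp (- f)"
  unfolding fsupp_def by simp

lemma fsupp_diff [intro]: "fsupp f \<Longrightarrow> fsupp g \<Longrightarrow> fsupp (f - g)"
  unfolding fsupp_def by (rule finite_subset[of _ "{x. f x \<noteq> 0} \<union> {x. g x \<noteq> 0}"]) auto

lemma fsupp_zero [simp]: "fsupp 0"
  by (simp add: fsupp_def)

lemma fsupp_fdelta [simp]: "fsupp (fdelta x)"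
  by (simp add: fsupp_def fdelta_def)

lemma lin_add:
  assumes "fsupp f" "fsupp g"
  shows "lin \<beta> (f + g) = lin \<beta> f + lin \<beta> g"
proof -
  let ?S = "{x. f x \<noteq> 0} \<union> {x. g x \<noteq> 0}"
  have "finite ?S" using assms by (auto simp: fsupp_def)
  then show ?thesis
    by (subst (1 2 3) lin_superset[of ?S]) (auto simp: ring_distribs sum.distrib)
qed

lemma lin_uminus: "lin \<beta> (- f) = - lin \<beta> f"
  by (simp add: lin_def sum_negf)

lemma lin_diff: "fsupp f \<Longrightarrow> fsupp g \<Longrightarrow> lin \<beta> (f - g) = lin \<beta> f - lin \<beta> g"
  using lin_add[of f "- g" \<beta>] by (simp add: fsupp_uminus lin_uminus)

lemma lin_zero [simp]: "lin \<beta> 0 = 0"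
  by (simp add: lin_def)

lemma lin_fdelta [simp]: "lin \<beta> (fdelta x) = \<beta> x"
  by (subst lin_superset[of "{x}"]) (auto simp: fdelta_def)

text \<open>Removing a unit with the sign of f x at a point x of the support lowers the sum of
  absolute values and does not enlarge the support. Additive statements thus need checking only on
  \<open>fdelta\<close>.\<close>

lemma fsupp_induct [consumes 2, case_names zero add diff]:
  assumes "fsupp f" "\<And>x. f x \<noteq> 0 \<Longrightarrow> x \<in> A"
    and zero: "P 0"
    and add: "\<And>f x. fsupp f \<Longrightarrow> (\<And>y. f y \<noteq> 0 \<Longrightarrow> y \<in> A) \<Longrightarrow> P f \<Longrightarrow> x \<in> A \<Longrightarrow> P (f + fdelta x)"
    and diff: "\<And>f x. fsupp f \<Longrightarrow> (\<And>y. f y \<noteq> 0 \<Longrightarrow> y \<in> A) \<Longrightarrow> P f \<Longrightarrow> x \<in> A \<Longrightarrow> P (f - fdelta x)"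
  shows "P f"
  using assms(1,2)
proof (induction "nat (\<Sum>x | f x \<noteq> 0. \<bar>f x\<bar>)" arbitrary: f rule: less_induct)
  case less
  show ?case
  proof (cases "f = 0")
    case True then show ?thesis using zero by simp
  next
    case False
    then obtain x where x: "f x \<noteq> 0" by (auto simp: fun_eq_iff)
    define d where "d = (if f x > 0 then fdelta x else - fdelta x)"
    have fs: "fsupp (f - d)" using less.prems by (auto simp: d_def)
    have sub: "{y. (f - d) y \<noteq> 0} \<subseteq> {y. f y \<noteq> 0}"
      using x by (auto simp: d_def fdelta_def split: if_splits)
    have fin: "finite {y. f y \<noteq> 0}" using less.prems by (simp add: fsupp_def)
    have "(\<Sum>y | (f - d) y \<noteq> 0. \<bar>(f - d) y\<bar>) = (\<Sum>y | f y \<noteq> 0. \<bar>(f - d) y\<bar>)"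
      by (rule sum.mono_neutral_left) (use fin sub in auto)
    also have "\<dots> < (\<Sum>y | f y \<noteq> 0. \<bar>f y\<bar>)"
      by (rule sum_strict_mono_ex1) (use fin x in \<open>auto simp: d_def fdelta_def\<close>)
    finally have lt: "(\<Sum>y | (f - d) y \<noteq> 0. \<bar>(f - d) y\<bar>) < (\<Sum>y | f y \<noteq> 0. \<bar>f y\<bar>)" .
    moreover have "0 \<le> (\<Sum>y | (f - d) y \<noteq> 0. \<bar>(f - d) y\<bar>)" by (simp add: sum_nonneg)
    ultimately have lt': "nat (\<Sum>y | (f - d) y \<noteq> 0. \<bar>(f - d) y\<bar>) < nat (\<Sum>y | f y \<noteq> 0. \<bar>f y\<bar>)" by linarith
    have A: "(f - d) y \<noteq> 0 \<Longrightarrow> y \<in> A" for y using sub less.prems(2) by auto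
    have P: "P (f - d)" by (rule less.hyps[OF lt' fs A])
    have "P ((f - d) + fdelta x)" "P ((f - d) - fdelta x)"
      using add[OF fs A P] diff[OF fs A P] less.prems(2) x by auto
    then show ?thesis by (auto simp: d_def split: if_splits)
  qed
qed

section \<open>Divisors of a Steinitz number, roots of unity and the ring they generate\<close>

lemma sdvd_one [simp]: "sdvd (Suc 0) e"
  by (simp add: sdvd_def zero_enat_def[symmetric])

lemma sdvd_pos: "sdvd n e \<Longrightarrow> n > 0"
  by (simp add: sdvd_def)

lemma sdvd_dvd: "sdvd n e \<Longrightarrow> m dvd n \<Longrightarrow> sdvd m e"
  unfolding sdvd_def
  by (metis dvd_imp_multiplicity_le dvd_pos_nat enat_ord_simps(1) not_gr_zero order_trans)

lemma sdvd_lcm: "sdvd m e \<Longrightarrow> sdvd n e \<Longrightarrow> sdvd (lcm m n) e"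
  by (auto simp: sdvd_def multiplicity_lcm lcm_pos_nat max_def)

lemma mu_rootsI: "sdvd n e \<Longrightarrow> z ^ n = 1 \<Longrightarrow> z \<in> mu e"
  by (auto simp: mu_def)

lemma mu_rootsE: assumes "z \<in> mu e" obtains n where "sdvd n e" "z ^ n = 1"
  using assms by (auto simp: mu_def)

lemma power_eq_one_dvd: "z ^ m = (1::'a::monoid_mult) \<Longrightarrow> m dvd n \<Longrightarrow> z ^ n = 1"
  by (auto simp: power_mult)

text \<open>Divisors of \<open>e\<close> are closed under least common multiples, so
  \<open>mu e\<close> is a directed union of finite groups and finitely many roots can be treated at
  one level.\<close>

lemma mu_common_order:
  assumes "finite W" "W \<subseteq> mu e"
  shows "\<exists>n. sdvd n e \<and> (\<forall>w\<in>W. w ^ n = 1)"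
  using assms
proof (induction W rule: finite_induct)
  case (insert w W)
  then obtain n m where "sdvd n e" "\<forall>w\<in>W. w ^ n = 1" "sdvd m e" "w ^ m = 1"
    by (auto elim: mu_rootsE)
  then show ?case
    by (intro exI[of _ "lcm n m"]) (auto intro: sdvd_lcm power_eq_one_dvd)
qed (auto intro: exI[of _ "Suc 0"])

lemma mu_common_order2:
  assumes "z \<in> mu e" "w \<in> mu e" obtains n where "sdvd n e" "z ^ n = 1" "w ^ n = 1"
  using mu_common_order[of "{z,w}" e] assms by auto

lemma one_in_mu [simp]: "1 \<in> mu e"
  by (rule mu_rootsI[of 1]) auto

lemma mu_mult: assumes "z \<in> mu e" "w \<in> mu e" shows "z * w \<in> mu e"
  by (rule mu_common_order2[OF assms]) (auto intro: mu_rootsI simp: power_mult_distrib)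

lemma mu_power: "z \<in> mu e \<Longrightarrow> z ^ k \<in> mu e"
  by (induction k) (auto intro: mu_mult)

lemma mu_inverse: assumes "z \<in> mu e" shows "inverse z \<in> mu e"
  by (rule mu_rootsE[OF assms]) (auto intro: mu_rootsI simp: power_inverse)

lemma mu_nonzero: assumes "z \<in> mu e" shows "z \<noteq> 0"
  by (rule mu_rootsE[OF assms]) (auto dest: sdvd_pos simp: zero_power)

text \<open>Because \<open>mu e\<close> is closed under products, its additive span is already a
  ring.\<close>

lemma ZMu_eq_zspan: "ZMu e = zspan (mu e)"
proof
  have m: "x * y \<in> zspan (mu e)" if "x \<in> zspan (mu e)" "y \<in> zspan (mu e)" for x y
    by (rule zspan_mult[OF _ that]) (auto intro: zspan_base mu_mult)
  show "ZMu e \<subseteq> zspan (mu e)"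
    unfolding ZMu_def by (rule Inter_lower) (auto intro: zspan_base zspan_add zspan_uminus m)
  show "zspan (mu e) \<subseteq> ZMu e"
    unfolding ZMu_def
  proof (intro Inter_greatest)
    fix A assume "A \<in> {A. mu e \<subseteq> A \<and> 1 \<in> A \<and> (\<forall>x\<in>A. \<forall>y\<in>A. x + y \<in> A \<and> - x \<in> A \<and> x * y \<in> A)}"
    then have A: "mu e \<subseteq> A" "1 \<in> A" "\<And>x y. x \<in> A \<Longrightarrow> y \<in> A \<Longrightarrow> x + y \<in> A" "\<And>x. x \<in> A \<Longrightarrow> - x \<in> A" by auto
    have 0: "0 \<in> A" using A(3)[OF A(2) A(4)[OF A(2)]] by simp
    have d: "x - y \<in> A" if "x \<in> A" "y \<in> A" for x y
      using A(3)[OF that(1) A(4)[OF that(2)]] by simp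
    have "x \<in> A" if "x \<in> zspan (mu e)" for x
      using that by induction (use A 0 d in auto)
    then show "zspan (mu e) \<subseteq> A" by blast
  qed
qed

lemma ZMu_mu: "z \<in> mu e \<Longrightarrow> z \<in> ZMu e"
  by (simp add: ZMu_eq_zspan zspan_base)

lemma ZMu_zero [simp]: "0 \<in> ZMu e"
  by (simp add: ZMu_eq_zspan zspan_zero)

lemma ZMu_one [simp]: "1 \<in> ZMu e"
  by (simp add: ZMu_mu)

lemma ZMu_add: "x \<in> ZMu e \<Longrightarrow> y \<in> ZMu e \<Longrightarrow> x + y \<in> ZMu e"
  by (simp add: ZMu_eq_zspan zspan_add)

lemma ZMu_diff: "x \<in> ZMu e \<Longrightarrow> y \<in> ZMu e \<Longrightarrow> x - y \<in> ZMu e"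
  by (simp add: ZMu_eq_zspan zspan_diff)

lemma ZMu_mult: "x \<in> ZMu e \<Longrightarrow> y \<in> ZMu e \<Longrightarrow> x * y \<in> ZMu e"
  unfolding ZMu_eq_zspan by (rule zspan_mult) (auto intro: zspan_base mu_mult)

lemma ZMu_sum: "(\<And>i. i \<in> I \<Longrightarrow> f i \<in> ZMu e) \<Longrightarrow> sum f I \<in> ZMu e"
  by (simp add: ZMu_eq_zspan zspan_sum)

lemma ZMu_of_int [simp]: "of_int k \<in> ZMu e"
  using zspan_of_int[of 1 "mu e" k] by (simp add: ZMu_eq_zspan zspan_base)

lemma ZMu_of_nat [simp]: "of_nat k \<in> ZMu e"
  using ZMu_of_int[of "int k" e] by simp

lemma ZMu_finite_level:
  assumes "x \<in> ZMu e" obtains n where "sdvd n e" "x \<in> zspan {w. w ^ n = 1}"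
proof -
  obtain F where F: "finite F" "F \<subseteq> mu e" "x \<in> zspan F"
    using assms zspan_finite unfolding ZMu_eq_zspan by metis
  obtain n where "sdvd n e" "\<forall>w\<in>F. w ^ n = 1" using mu_common_order[OF F(1,2)] by blast
  then show ?thesis using that zspan_mono[of F "{w. w ^ n = 1}"] F by auto
qed

text \<open>Otherwise 1 = g^N * u^N for every N, while all powers of u stay in one finitely
  generated group, where the integers dividing 1 are bounded.\<close>

lemma ZMu_unit_nat:
  assumes "u \<in> ZMu e" "of_nat g * u = 1" shows "g = 1"
proof (rule ccontr)
  assume g1: "g \<noteq> 1"
  obtain n where n: "sdvd n e" "u \<in> zspan {w. w ^ n = 1}" using ZMu_finite_level[OF assms(1)] .
  have fin: "finite {w::complex. w ^ n = 1}" using sdvd_pos[OF n(1)] by (intro finite_roots_unity) auto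
  obtain N where N: "\<And>k y. k > N \<Longrightarrow> y \<in> zspan {w. w ^ n = 1} \<Longrightarrow> 1 \<noteq> of_nat k * y"
    using zspan_divisible_bound[OF fin, of 1] zspan_base[of 1 "{w. w ^ n = 1}"] by auto
  have "g \<noteq> 0" using assms(2) by (cases g) auto
  with g1 have "g \<ge> 2" by simp
  have "N < 2 ^ N" by simp
  also have "\<dots> \<le> g ^ N" using \<open>g \<ge> 2\<close> by (simp add: power_mono)
  finally have "N < g ^ N" .
  moreover have "1 = of_nat (g ^ N) * u ^ N" using assms(2) by (simp add: power_mult_distrib[symmetric])
  ultimately show False using N zspan_roots_power[OF n(2)] by blast
qed

text \<open>This is Z[mu_e] \<inter> Q = Z. With d = gcd s t and t = d t', Bezout gives 1/t' = x u +
  y in the ring, so t' = 1.\<close>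

lemma ZMu_int_dvd:
  assumes "u \<in> ZMu e" "of_int s = of_nat t * u" "t > 0"
  shows "int t dvd s"
proof -
  define d where "d = gcd s (int t)"
  have d0: "d > 0" using assms(3) by (simp add: d_def)
  obtain x y where xy: "x * s + y * int t = d" unfolding d_def using bezout_int by blast
  define t' where "t' = nat (int t div d)"
  have t': "int t = d * int t'" using d0 by (simp add: t'_def pos_imp_zdiv_nonneg_iff d_def)
  have "of_nat t' * (of_int x * u + of_int y) * of_int d = (of_int d :: complex)"
  proof -
    have "of_nat t = (of_int d * of_nat t' :: complex)" by (metis t' of_int_mult of_int_of_nat_eq)
    then have "of_nat t' * (of_int x * u + of_int y) * of_int d = of_int x * (of_nat t * u) + of_int y * (of_nat t)"
      by (simp add: algebra_simps)
    also have "\<dots> = of_int (x * s + y * int t)" using assms(2) by simp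
    finally show ?thesis using xy by simp
  qed
  then have "of_nat t' * (of_int x * u + of_int y) = 1" using d0 by simp
  moreover have "of_int x * u + of_int y \<in> ZMu e" by (intro ZMu_add ZMu_mult ZMu_of_int assms)
  ultimately have "t' = 1" by (metis ZMu_unit_nat)
  then have "int t = d" using t' by simp
  then show ?thesis by (metis d_def gcd_dvd1)
qed

section \<open>Exponentiation of roots of unity by profinite integers\<close>

lemma cord_props:
  assumes "z ^ n = 1" "n > 0"
  shows "cord z > 0" "z ^ cord z = 1" "cord z dvd n"
proof -
  have *: "cord z > 0 \<and> z ^ cord z = 1" unfolding cord_def by (rule LeastI[of _ n]) (use assms in auto)
  then show "cord z > 0" "z ^ cord z = 1" by auto
  have "1 = (z ^ cord z) ^ (n div cord z) * z ^ (n mod cord z)"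
    by (metis assms(1) mult_div_mod_eq power_add power_mult)
  then have "z ^ (n mod cord z) = 1" using * by simp
  moreover have "n mod cord z < cord z" using * by simp
  ultimately have "\<not> n mod cord z > 0"
    using not_less_Least[of "n mod cord z" "\<lambda>k. k > 0 \<and> z ^ k = 1"] by (simp add: cord_def[symmetric])
  then show "cord z dvd n" by auto
qed

lemma power_mod_order: "z ^ n = 1 \<Longrightarrow> z ^ k = (z::complex) ^ (k mod n)"
  by (metis div_mult_mod_eq mult.commute mult_1 power_add power_mult power_one)

lemma zhatD:
  assumes "a \<in> zhat e" "sdvd n e"
  shows "0 \<le> a n" "a n < int n" "m dvd n \<Longrightarrow> a n mod int m = a m"
  using assms sdvd_dvd by (auto simp: zhat_def)

text \<open>\<open>hpow\<close> reads \<open>a\<close> at the exact order of z; compatibility of the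
  residues allows any n with z^n = 1 instead, so that several roots can be treated with one
  exponent.\<close>

lemma hpow_eq:
  assumes "a \<in> zhat e" "sdvd n e" "z ^ n = 1"
  shows "hpow z a = z ^ nat (a n)"
proof -
  note c = cord_props[OF assms(3) sdvd_pos[OF assms(2)]]
  have "nat (a n) mod cord z = nat (a (cord z))"
    using zhatD(3)[OF assms(1,2) c(3)] zhatD(1)[OF assms(1,2)] by (metis nat_int nat_mod_distrib of_nat_0_le_iff)
  then show ?thesis unfolding hpow_def using power_mod_order[OF c(2), of "nat (a n)"] by simp
qed

lemma hpow_mult:
  assumes "a \<in> zhat e" "z \<in> mu e" "w \<in> mu e"
  shows "hpow (z * w) a = hpow z a * hpow w a"
  by (rule mu_common_order2[OF assms(2,3)]) (use assms(1) in \<open>simp add: hpow_eq power_mult_distrib\<close>)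

lemma hpow_one: "hpow 1 a = 1"
  by (simp add: hpow_def)

lemma hpow_mu:
  assumes "a \<in> zhat e" "z \<in> mu e" shows "hpow z a \<in> mu e"
  by (rule mu_rootsE[OF assms(2)]) (use assms mu_power in \<open>auto simp: hpow_eq\<close>)

lemma zhat_units_subset: "a \<in> zhat_units e \<Longrightarrow> a \<in> zhat e"
  by (simp add: zhat_units_def)

lemma zhat_units_coprime:
  assumes "a \<in> zhat_units e" "sdvd n e" shows "coprime (nat (a n)) n"
proof -
  have "0 \<le> a n" "coprime (a n) (int n)" using assms zhatD(1) by (auto simp: zhat_units_def)
  then show ?thesis by (metis coprime_int_iff nat_0_le)
qed

lemma ex_inverse_mod:
  assumes "coprime a (int d)" "d > 0"
  shows "\<exists>x. 0 \<le> x \<and> x < int d \<and> [a * x = 1] (mod int d)"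
proof -
  obtain x where "[a * x = 1] (mod int d)" using assms(1) cong_solve_coprime_int by blast
  then have "[a * (x mod int d) = 1] (mod int d)" by (simp add: cong_def mod_mult_right_eq)
  then show ?thesis using assms(2) by (intro exI[of _ "x mod int d"]) auto
qed

text \<open>Inverse residues are chosen at each level separately; inverses modulo d being unique,
  the choices are automatically compatible.\<close>

lemma zhat_units_inverse:
  assumes a: "a \<in> zhat_units e"
  obtains b where "b \<in> zhat_units e" "\<And>z. z \<in> mu e \<Longrightarrow> hpow (hpow z a) b = z" "\<And>z. z \<in> mu e \<Longrightarrow> hpow (hpow z b) a = z"
proof -
  note az = zhat_units_subset[OF a]
  define b where "b d = (if sdvd d e then SOME x. 0 \<le> x \<and> x < int d \<and> [a d * x = 1] (mod int d) else 0)" for d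
  have b: "0 \<le> b d" "b d < int d" "[a d * b d = 1] (mod int d)" if "sdvd d e" for d
  proof -
    have "coprime (a d) (int d)" "d > 0" using a that sdvd_pos by (auto simp: zhat_units_def)
    from someI_ex[OF ex_inverse_mod[OF this]] that
    show "0 \<le> b d" "b d < int d" "[a d * b d = 1] (mod int d)" by (auto simp: b_def)
  qed
  have compat: "b d' mod int d = b d" if d: "sdvd d e" "sdvd d' e" "d dvd d'" for d d'
  proof -
    have "[a d' = a d] (mod int d)" using zhatD(3)[OF az d(2,3)] zhatD(1,2)[OF az d(1)] by (simp add: cong_def)
    then have "[a d' * b d' = a d * b d'] (mod int d)" by (rule cong_scalar_right)
    moreover have "[a d' * b d' = 1] (mod int d)"
      by (rule cong_dvd_modulus[OF b(3)[OF d(2)]]) (use d in auto)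
    ultimately have "[a d * b d' = a d * b d] (mod int d)"
      using b(3)[OF d(1)] by (metis cong_sym cong_trans)
    moreover have "coprime (a d) (int d)" using a d by (auto simp: zhat_units_def)
    ultimately have "[b d' = b d] (mod int d)" using cong_mult_lcancel by blast
    then show ?thesis using b[OF d(1)] by (simp add: cong_def)
  qed
  have "b \<in> zhat e" using b compat by (auto simp: zhat_def) (auto simp: b_def)
  moreover have "coprime (b d) (int d)" if "sdvd d e" for d
    using b(3)[OF that] coprime_iff_invertible_int mult.commute by metis
  ultimately have bu: "b \<in> zhat_units e" by (auto simp: zhat_units_def)
  have main: "z ^ (nat (a n) * nat (b n)) = z" if "sdvd n e" "z ^ n = 1" for z :: complex and n
  proof -
    have "[nat (a n) * nat (b n) = 1] (mod n)"
    proof -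
      have "int (nat (a n) * nat (b n)) = a n * b n" using b(1)[OF that(1)] zhatD(1)[OF az that(1)] by simp
      then show ?thesis using b(3)[OF that(1)] by (metis cong_int_iff of_nat_1)
    qed
    then have "(nat (a n) * nat (b n)) mod n = 1 mod n" by (simp add: cong_def)
    then show ?thesis using power_mod_order[OF that(2)] by (metis power_one_right)
  qed
  have "hpow (hpow z a) b = z \<and> hpow (hpow z b) a = z" if zm: "z \<in> mu e" for z
  proof -
    obtain n where n: "sdvd n e" "z ^ n = 1" using zm by (rule mu_rootsE)
    have zk: "(z ^ k) ^ n = 1" for k by (metis n(2) mult.commute power_mult power_one)
    show ?thesis
      using main[OF n] by (simp add: hpow_eq[OF az n] hpow_eq[OF \<open>b \<in> zhat e\<close> n] hpow_eq[OF az n(1) zk]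
          hpow_eq[OF \<open>b \<in> zhat e\<close> n(1) zk] power_mult[symmetric] mult.commute)
  qed
  then show ?thesis using that bu by blast
qed

section \<open>Galois action on the cyclotomic ring\<close>

lemma fdelta_nonzero: "fdelta x y \<noteq> 0 \<longleftrightarrow> y = x"
  by (simp add: fdelta_def)

lemma primitive_root_exists:
  assumes "n > 0"
  shows "\<exists>z::complex. z ^ n = 1 \<and> (\<forall>w. w ^ n = 1 \<longrightarrow> (\<exists>k<n. w = z ^ k)) \<and> inj_on (\<lambda>k. z ^ k) {..<n}"
proof -
  define z where "z = cis (2 * pi / n)"
  have zk: "z ^ k = cis (2 * pi * real k / real n)" for k
    by (simp add: z_def DeMoivre mult.commute)
  have "z ^ n = 1" using assms by (simp add: zk)
  moreover have "\<exists>k<n. w = z ^ k" if "w ^ n = 1" for w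
    using bij_betw_roots_unity[OF assms] that unfolding bij_betw_def zk by auto
  moreover have "inj_on (\<lambda>k. z ^ k) {..<n}"
    using bij_betw_roots_unity[OF assms] unfolding bij_betw_def zk by simp
  ultimately show ?thesis by blast
qed

text \<open>All roots in the sum are powers of one n-th root of unity, on which \<open>a\<close>
  acts with the exponent \<open>a n\<close>, a unit modulo n; so \<open>cyclotomic_conjugate\<close>
  applies. The consequence is that a Galois conjugate does not depend on how a number is written as
  a sum of roots.\<close>

lemma hpow_vanishing_sum:
  assumes a: "a \<in> zhat_units e" and c: "fsupp c" "\<And>w. c w \<noteq> 0 \<Longrightarrow> w \<in> mu e" and z: "lin (\<lambda>w. w) c = 0"
  shows "lin (\<lambda>w. hpow w a) c = 0"
proof -
  define W where "W = {w. c w \<noteq> 0}"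
  have W: "finite W" "W \<subseteq> mu e" using c by (auto simp: W_def fsupp_def)
  obtain n where n: "sdvd n e" "\<And>w. w \<in> W \<Longrightarrow> w ^ n = 1" using mu_common_order[OF W] by blast
  obtain z :: complex where z: "z ^ n = 1" "\<And>w. w ^ n = 1 \<Longrightarrow> \<exists>k<n. w = z ^ k"
    using primitive_root_exists[OF sdvd_pos[OF n(1)]] by blast
  have "\<forall>w\<in>W. \<exists>k. w = z ^ k" using z(2) n(2) by blast
  then obtain r where "\<forall>w\<in>W. w = z ^ r w" using bchoice[of W "\<lambda>w k. w = z ^ k"] by blast
  then have r: "w = z ^ r w" if "w \<in> W" for w using that by blast
  have hw: "hpow w a = z ^ (nat (a n) * r w)" if "w \<in> W" for w
    using hpow_eq[OF zhat_units_subset[OF a] n(1) n(2)[OF that]] r[OF that]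
    by (metis mult.commute power_mult)
  have "(\<Sum>w\<in>W. of_int (c w) * z ^ r w) = lin (\<lambda>w. w) c"
    unfolding lin_def W_def[symmetric] using r by (intro sum.cong) auto
  then have "(\<Sum>w\<in>W. of_int (c w) * z ^ (nat (a n) * r w)) = 0"
    using assms(4) by (intro cyclotomic_conjugate[OF sdvd_pos[OF n(1)] z(1) zhat_units_coprime[OF a n(1)] _ W(1)]) simp
  then show ?thesis unfolding lin_def W_def[symmetric] using hw by simp
qed

lemma ZMu_lin:
  assumes "x \<in> ZMu e"
  shows "\<exists>c. fsupp c \<and> (\<forall>w. c w \<noteq> 0 \<longrightarrow> w \<in> mu e) \<and> x = lin (\<lambda>w. w) c"
  using assms unfolding ZMu_eq_zspan
proof (induction rule: zspan.induct)
  case zspan_zero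
  show ?case by (intro exI[of _ "\<lambda>_. 0"]) (simp add: zero_fun_def[symmetric])
next
  case (zspan_add_gen x g)
  then obtain c where "fsupp c" "\<forall>w. c w \<noteq> 0 \<longrightarrow> w \<in> mu e" "x = lin (\<lambda>w. w) c" by auto
  then have "fsupp (c + fdelta g) \<and> (\<forall>w. (c + fdelta g) w \<noteq> 0 \<longrightarrow> w \<in> mu e) \<and> x + g = lin (\<lambda>w. w) (c + fdelta g)"
    using zspan_add_gen(2) by (intro conjI allI impI) (auto simp: lin_add, auto simp: fdelta_def split: if_splits)
  then show ?case by blast
next
  case (zspan_diff_gen x g)
  then obtain c where "fsupp c" "\<forall>w. c w \<noteq> 0 \<longrightarrow> w \<in> mu e" "x = lin (\<lambda>w. w) c" by auto
  then have "fsupp (c - fdelta g) \<and> (\<forall>w. (c - fdelta g) w \<noteq> 0 \<longrightarrow> w \<in> mu e) \<and> x - g = lin (\<lambda>w. w) (c - fdelta g)"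
    using zspan_diff_gen(2) by (intro conjI allI impI) (auto simp: lin_diff, auto simp: fdelta_def split: if_splits)
  then show ?case by blast
qed

text \<open>Gives the choice in \<open>tauZ\<close> a meaning: the value at x can be read off from
  any expression of x as a sum of roots. Multiplicativity is inherited from
  \<open>hpow_mult\<close>, one factor at a time.\<close>

lemma ZMu_hom_exists:
  assumes a: "a \<in> zhat_units e"
  shows "\<exists>h. (\<forall>z\<in>mu e. h z = hpow z a) \<and> h 1 = 1 \<and>
      (\<forall>x\<in>ZMu e. \<forall>y\<in>ZMu e. h (x + y) = h x + h y \<and> h (x * y) = h x * h y)"
proof -
  note az = zhat_units_subset[OF a]
  let ?l = "lin (\<lambda>w. w)" and ?h = "lin (\<lambda>w. hpow w a)"
  define C where "C x = (SOME c. fsupp c \<and> (\<forall>w. c w \<noteq> 0 \<longrightarrow> w \<in> mu e) \<and> x = ?l c)" for x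
  have C: "fsupp (C x)" "C x w \<noteq> 0 \<Longrightarrow> w \<in> mu e" "?l (C x) = x" if "x \<in> ZMu e" for x w
    using someI_ex[OF ZMu_lin[OF that]] unfolding C_def[symmetric] by auto
  define h where "h x = ?h (C x)" for x
  have h_eq: "h x = ?h c" if "x \<in> ZMu e" "fsupp c" and supp: "\<And>w. c w \<noteq> 0 \<Longrightarrow> w \<in> mu e" and "?l c = x" for x c
  proof -
    have "?h (C x - c) = 0"
    proof (rule hpow_vanishing_sum[OF a])
      show "fsupp (C x - c)" using that C by auto
      show "?l (C x - c) = 0" using that C by (simp add: lin_diff)
      show "w \<in> mu e" if "(C x - c) w \<noteq> 0" for w
        using that \<open>x \<in> ZMu e\<close> supp C(2)[of x w] by (cases "c w = 0") auto
    qed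
    then show ?thesis using that C by (simp add: h_def lin_diff)
  qed
  have h_mu: "h z = hpow z a" if "z \<in> mu e" for z
  proof -
    have "h z = ?h (fdelta z)" using that by (intro h_eq) (auto simp: ZMu_mu fdelta_nonzero)
    then show ?thesis by simp
  qed
  have h_add: "h (x + y) = h x + h y" if "x \<in> ZMu e" "y \<in> ZMu e" for x y
  proof -
    have "h (x + y) = ?h (C x + C y)"
    proof (rule h_eq)
      show "w \<in> mu e" if "(C x + C y) w \<noteq> 0" for w
        using that \<open>x \<in> ZMu e\<close> \<open>y \<in> ZMu e\<close> C(2)[of x w] C(2)[of y w] by (cases "C x w = 0") auto
    qed (use that C in \<open>auto simp: lin_add ZMu_add\<close>)
    then show ?thesis using that C by (simp add: lin_add h_def)
  qed
  have h_diff: "h (x - y) = h x - h y" if "x \<in> ZMu e" "y \<in> ZMu e" for x y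
    using h_add[of "x - y" y] that by (simp add: ZMu_diff)
  have h0: "h 0 = 0" using h_diff[of 0 0] by simp
  have m1: "h (x * w) = h x * h w" if x: "x \<in> ZMu e" and w: "w \<in> mu e" for x w
    using x unfolding ZMu_eq_zspan
  proof (induction rule: zspan.induct)
    case (zspan_add_gen x g)
    then have "h ((x + g) * w) = h (x * w) + h (g * w)"
      using w by (simp add: ring_distribs h_add ZMu_mult ZMu_mu ZMu_eq_zspan[symmetric])
    then show ?case using zspan_add_gen w
      by (simp add: ring_distribs h_add ZMu_mu ZMu_eq_zspan[symmetric] h_mu mu_mult hpow_mult[OF az])
  next
    case (zspan_diff_gen x g)
    then have "h ((x - g) * w) = h (x * w) - h (g * w)"
      using w by (simp add: ring_distribs h_diff ZMu_mult ZMu_mu ZMu_eq_zspan[symmetric])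
    then show ?case using zspan_diff_gen w
      by (simp add: ring_distribs h_diff ZMu_mu ZMu_eq_zspan[symmetric] h_mu mu_mult hpow_mult[OF az])
  qed (simp add: h0)
  have m2: "h (x * y) = h x * h y" if x: "x \<in> ZMu e" and y: "y \<in> ZMu e" for x y
    using y unfolding ZMu_eq_zspan
  proof (induction rule: zspan.induct)
    case (zspan_add_gen y g)
    then show ?case using x
      by (simp add: ring_distribs h_add ZMu_mult ZMu_mu ZMu_eq_zspan[symmetric] m1)
  next
    case (zspan_diff_gen y g)
    then show ?case using x
      by (simp add: ring_distribs h_diff ZMu_mult ZMu_mu ZMu_eq_zspan[symmetric] m1)
  qed (simp add: h0)
  have "h 1 = 1" using h_mu[OF one_in_mu] by (simp add: hpow_one)
  with h_mu h_add m2 show ?thesis by blast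
qed

lemma tauZ_spec:
  assumes "a \<in> zhat_units e"
  shows "z \<in> mu e \<Longrightarrow> tauZ e a z = hpow z a" "tauZ e a 1 = 1"
    "x \<in> ZMu e \<Longrightarrow> y \<in> ZMu e \<Longrightarrow> tauZ e a (x + y) = tauZ e a x + tauZ e a y"
    "x \<in> ZMu e \<Longrightarrow> y \<in> ZMu e \<Longrightarrow> tauZ e a (x * y) = tauZ e a x * tauZ e a y"
  using someI_ex[OF ZMu_hom_exists[OF assms]] unfolding tauZ_def[symmetric] by auto

lemma tauZ_diff:
  assumes "a \<in> zhat_units e" "x \<in> ZMu e" "y \<in> ZMu e"
  shows "tauZ e a (x - y) = tauZ e a x - tauZ e a y"
  using tauZ_spec(3)[OF assms(1), of "x - y" y] assms by (simp add: ZMu_diff)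

lemma tauZ_zero: "a \<in> zhat_units e \<Longrightarrow> tauZ e a 0 = 0"
  using tauZ_diff[of a e 0 0] by simp

lemma tauZ_in_ZMu:
  assumes a: "a \<in> zhat_units e" and x: "x \<in> ZMu e"
  shows "tauZ e a x \<in> ZMu e"
  using x unfolding ZMu_eq_zspan
proof (induction rule: zspan.induct)
  case (zspan_add_gen x g)
  then show ?case
    using a by (simp add: ZMu_eq_zspan[symmetric] tauZ_spec ZMu_mu ZMu_add hpow_mu zhat_units_subset)
next
  case (zspan_diff_gen x g)
  then show ?case
    using a by (simp add: ZMu_eq_zspan[symmetric] tauZ_diff tauZ_spec(1) ZMu_mu ZMu_diff hpow_mu zhat_units_subset)
qed (simp add: a tauZ_zero zspan_zero)

lemma tauZ_inverse:
  assumes a: "a \<in> zhat_units e" and b: "b \<in> zhat_units e"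
    and ab: "\<And>z. z \<in> mu e \<Longrightarrow> hpow (hpow z a) b = z" and x: "x \<in> ZMu e"
  shows "tauZ e b (tauZ e a x) = x"
  using x unfolding ZMu_eq_zspan
proof (induction rule: zspan.induct)
  case (zspan_add_gen x g)
  then show ?case using a b ab
    by (simp add: ZMu_eq_zspan[symmetric] tauZ_spec ZMu_mu tauZ_in_ZMu hpow_mu zhat_units_subset)
next
  case (zspan_diff_gen x g)
  then show ?case using a b ab
    by (simp add: ZMu_eq_zspan[symmetric] tauZ_diff tauZ_spec(1) ZMu_mu tauZ_in_ZMu hpow_mu zhat_units_subset)
qed (simp add: a b tauZ_zero)

section \<open>Ideals of integers, Ramanujan sums and lifts of units modulo n\<close>

lemma bezout_finite:
  fixes c :: "'i \<Rightarrow> int"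
  assumes "finite I"
  shows "\<exists>m. \<forall>i\<in>I. (\<Sum>j\<in>I. m j * c j) dvd c i"
  using assms
proof (induction I rule: finite_induct)
  case (insert i I)
  then obtain m where m: "\<forall>k\<in>I. (\<Sum>j\<in>I. m j * c j) dvd c k" by blast
  define s where "s = (\<Sum>j\<in>I. m j * c j)"
  obtain x y where xy: "x * c i + y * s = gcd (c i) s" using bezout_int by blast
  define m' where "m' = (\<lambda>j. if j = i then x else y * m j)"
  have "(\<Sum>j\<in>insert i I. m' j * c j) = x * c i + (\<Sum>j\<in>I. m' j * c j)"
    using insert by (simp add: m'_def)
  also have "(\<Sum>j\<in>I. m' j * c j) = y * s"
    unfolding s_def sum_distrib_left using insert by (intro sum.cong) (auto simp: m'_def)
  finally have "(\<Sum>j\<in>insert i I. m' j * c j) = gcd (c i) s" using xy by simp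
  moreover have "gcd (c i) s dvd c k" if "k \<in> insert i I" for k
    using that m s_def by (auto intro: dvd_trans[OF gcd_dvd2])
  ultimately show ?case by metis
qed auto

lemma sum_powers_root_of_unity:
  assumes "w ^ n = (1::complex)" "n > 0"
  shows "(\<Sum>a<n. w ^ a) = (if w = 1 then of_nat n else 0)"
  using assms by (simp add: sum_gp_strict)

text \<open>These are Ramanujan sums. Sorting the exponents a < n by d = gcd a n splits the full
  power sum, which is n or 0, into such sums of level n / d at w^d; all those with d > 1 are
  integers by induction, hence so is the one with d = 1.\<close>

lemma coprime_power_sum_int:
  assumes "n > 0" "w ^ n = (1::complex)"
  shows "\<exists>k::int. (\<Sum>a | a < n \<and> coprime a n. w ^ a) = of_int k"
  using assms
proof (induction n arbitrary: w rule: less_induct)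
  case (less n)
  define A where "A d = {a. a < n \<and> gcd a n = d}" for d
  have "(\<Sum>a<n. w ^ a) = (\<Sum>d\<in>{d. d dvd n}. \<Sum>a\<in>{a\<in>{..<n}. gcd a n = d}. w ^ a)"
    using less.prems by (intro sum.group[symmetric]) auto
  also have "\<dots> = (\<Sum>d\<in>{d. d dvd n}. \<Sum>a\<in>A d. w ^ a)" by (simp add: A_def)
  also have "\<dots> = (\<Sum>a\<in>A 1. w ^ a) + (\<Sum>d\<in>{d. d dvd n} - {1}. \<Sum>a\<in>A d. w ^ a)"
    using less.prems by (intro sum.remove) auto
  finally have eq: "(\<Sum>a\<in>A 1. w ^ a) = (\<Sum>a<n. w ^ a) - (\<Sum>d\<in>{d. d dvd n} - {1}. \<Sum>a\<in>A d. w ^ a)"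
    by simp
  have "\<exists>k::int. (\<Sum>a\<in>A d. w ^ a) = of_int k" if d: "d dvd n" "d \<noteq> 1" for d
  proof -
    obtain m where m: "n = d * m" using d by auto
    have dm: "d > 0" "m > 0" "m < n" using less.prems d m by (auto simp: nat_neq_iff)
    have "bij_betw (\<lambda>a. d * a) {a. a < m \<and> coprime a m} (A d)"
      unfolding bij_betw_def
    proof
      show "inj_on ((*) d) {a. a < m \<and> coprime a m}" using dm by (auto intro: inj_onI)
      have "a \<in> (*) d ` {a. a < m \<and> coprime a m}" if "a \<in> A d" for a
      proof -
        have "d dvd a" using that unfolding A_def by (metis (mono_tags, lifting) gcd_dvd1 mem_Collect_eq)
        then obtain a' where a': "a = d * a'" by auto
        moreover have "a' < m" using that a' dm by (auto simp: A_def m)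
        moreover have "gcd (d * a') (d * m) = d" using that a' m by (simp add: A_def)
        then have "d * gcd a' m = d * 1" by (simp only: gcd_mult_distrib_nat mult_1_right)
        then have "gcd a' m = 1" by (simp only: nat_mult_eq_cancel1[OF dm(1)])
        then have "coprime a' m" by (simp only: coprime_iff_gcd_eq_1)
        ultimately show ?thesis by auto
      qed
      then show "(*) d ` {a. a < m \<and> coprime a m} = A d"
        using dm by (auto simp: A_def m gcd_mult_left)
    qed
    then have "(\<Sum>a\<in>A d. w ^ a) = (\<Sum>a | a < m \<and> coprime a m. w ^ (d * a))"
      by (rule sum.reindex_bij_betw[symmetric])
    also have "\<dots> = (\<Sum>a | a < m \<and> coprime a m. (w ^ d) ^ a)" by (simp add: power_mult)
    finally show ?thesis using less.IH[OF dm(3) dm(2), of "w ^ d"] less.prems by (simp add: m power_mult)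
  qed
  then obtain k :: "nat \<Rightarrow> int" where "\<And>d. d dvd n \<Longrightarrow> d \<noteq> 1 \<Longrightarrow> (\<Sum>a\<in>A d. w ^ a) = of_int (k d)" by metis
  then have "(\<Sum>d\<in>{d. d dvd n} - {1}. \<Sum>a\<in>A d. w ^ a) = of_int (\<Sum>d\<in>{d. d dvd n} - {1}. k d)" by simp
  moreover have "(\<Sum>a<n. w ^ a) = of_int (if w = 1 then int n else 0)"
    using sum_powers_root_of_unity less.prems by auto
  ultimately have "(\<Sum>a\<in>A 1. w ^ a) = of_int ((if w = 1 then int n else 0) - (\<Sum>d\<in>{d. d dvd n} - {1}. k d))"
    using eq by simp
  then show ?case unfolding A_def coprime_iff_gcd_eq_1 by blast
qed

text \<open>Two of the exponents 0, ..., d give the same residue, so the powers are periodic from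
  some exponent i <= d on, with a period t <= d. As \<open>fact d\<close> divides N, both N >= i and
  t dvd N hold, and M - N is a multiple of t.\<close>

lemma power_fact_periodic_mod:
  fixes n :: nat
  assumes "d > 0" "N dvd M" "M > 0" "fact d dvd N"
  shows "[n ^ M = n ^ N] (mod d)"
proof -
  have "\<not> inj_on (\<lambda>i. n ^ i mod d) {..d}"
  proof
    assume "inj_on (\<lambda>i. n ^ i mod d) {..d}"
    then have "card {..d} = card ((\<lambda>i. n ^ i mod d) ` {..d})" by (simp add: card_image)
    also have "\<dots> \<le> card {..<d}" using assms(1) by (intro card_mono) auto
    finally show False by simp
  qed
  then obtain i j where ij: "i < j" "j \<le> d" "n ^ i mod d = n ^ j mod d"
    unfolding inj_on_def by (metis atMost_iff linorder_neqE_nat)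
  define t where "t = j - i"
  have t: "t > 0" "t \<le> d" "i \<le> d" using ij by (auto simp: t_def)
  have base: "[n ^ (i + t) = n ^ i] (mod d)" using ij by (simp add: t_def cong_def)
  have step: "[n ^ (k + t * m) = n ^ k] (mod d)" if "k \<ge> i" for k m
  proof (induction m)
    case (Suc m)
    have "n ^ (k + t * Suc m) = n ^ (i + t) * n ^ (k - i + t * m)"
      using that by (simp add: power_add[symmetric] algebra_simps)
    also have "[n ^ (i + t) * n ^ (k - i + t * m) = n ^ i * n ^ (k - i + t * m)] (mod d)"
      using base by (rule cong_scalar_right)
    also have "n ^ i * n ^ (k - i + t * m) = n ^ (k + t * m)" using that by (simp add: power_add[symmetric])
    finally show ?case using Suc cong_trans by blast
  qed simp
  have "N > 0" using assms by (auto intro: Nat.gr0I)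
  then have "N \<ge> d" using assms(1,4) by (meson dvd_imp_le fact_ge_self order_trans)
  have "t dvd fact d" using t by (intro dvd_fact) auto
  then have "t dvd N" using assms(4) dvd_trans by blast
  obtain q where q: "M = N * q" using assms(2) by auto
  have "q > 0" using q assms(3) by (auto intro: Nat.gr0I)
  then have "M = N + N * (q - 1)" using q by (cases q) auto
  then obtain m where "M = N + t * m" using \<open>t dvd N\<close> by (metis dvdE mult.assoc)
  then show ?thesis using step[of N m] t \<open>N \<ge> d\<close> by simp
qed

text \<open>The sequence n raised to d! converges in the profinite integers to the idempotent that is 0 at the primes dividing n
  and 1 elsewhere; it glues the residue a at the former with the residue 1 at the latter.\<close>

lemma zhat_units_lift:
  assumes n: "sdvd n e" and a: "a < n" "coprime a n"
  obtains b where "b \<in> zhat_units e" "b n = int a"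
proof -
  \<comment> \<open>Modulo a prime divisor p of d that divides n, the power vanishes and x d is a.
    For any other prime divisor p of d the power is 1 by Fermat, since p - 1 divides
    \<open>fact d\<close>, and x d is 1. In both cases x d is prime to p.\<close>
  define x where "x d = int a + (1 - int a) * int (n ^ fact d)" for d
  define b where "b d = (if sdvd d e then x d mod int d else 0)" for d
  have x_cong: "[x d' = x d] (mod int d)" if "d > 0" "d dvd d'" "d' > 0" for d d'
  proof -
    have "[n ^ fact d' = n ^ fact d] (mod d)"
      by (rule power_fact_periodic_mod) (use that in \<open>auto intro!: fact_dvd dvd_imp_le\<close>)
    then show ?thesis unfolding x_def by (intro cong_add cong_mult cong_refl) (simp only: cong_int_iff)
  qed
  have "b \<in> zhat e"
  proof -
    have "b d' mod int d = b d" if "sdvd d e" "sdvd d' e" "d dvd d'" for d d'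
    proof -
      have "[x d' = x d] (mod int d)" by (rule x_cong) (use that sdvd_pos in auto)
      then show ?thesis using that by (simp add: b_def cong_def mod_mod_cancel)
    qed
    then show ?thesis using sdvd_pos by (auto simp: zhat_def) (auto simp: b_def)
  qed
  moreover have "coprime (b d) (int d)" if d: "sdvd d e" for d
  proof (rule ccontr)
    assume "\<not> coprime (b d) (int d)"
    then have "\<not> coprime (x d) (int d)" using d sdvd_pos[OF d] by (simp add: b_def)
    then obtain g where g: "g dvd x d" "g dvd int d" "\<not> is_unit g" by (auto simp: coprime_def)
    have "g \<noteq> 0" using g(2) sdvd_pos[OF d] by auto
    with g(3) obtain q where q: "prime q" "q dvd g" using prime_divisor_exists[of g] by blast
    define p where "p = nat q"
    have p: "prime p" "int p dvd x d" "p dvd d"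
      using q g by (auto simp: p_def prime_nat_iff_prime prime_ge_0_int dvd_trans nat_dvd_iff)
    show False
    proof (cases "p dvd n")
      case True
      then have "p dvd n ^ fact d" by (metis dvd_power dvd_trans fact_gt_zero)
      then have "int p dvd int (n ^ fact d)" by (simp only: int_dvd_int_iff)
      then have "int p dvd int a" using p(2) unfolding x_def by (metis dvd_add_left_iff dvd_mult)
      then have "p dvd a" by simp
      with True a(2) p(1) show False by (meson coprime_common_divisor not_prime_unit)
    next
      case False
      have "p - 1 dvd fact d"
        using prime_gt_1_nat[OF p(1)] dvd_imp_le[OF p(3) sdvd_pos[OF d]] by (intro dvd_fact) auto
      then obtain m where m: "fact d = (p - 1) * m" by auto
      have "[(n ^ (p - 1)) ^ m = 1 ^ m] (mod p)" by (rule cong_pow[OF fermat_theorem[OF p(1) False]])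
      then have "[int (n ^ fact d) = int 1] (mod int p)" unfolding m power_mult cong_int_iff by simp
      then have "[x d = int a + (1 - int a) * 1] (mod int p)"
        unfolding x_def by (intro cong_add cong_mult cong_refl) simp
      then have "int p dvd 1" using p(2) by (simp add: cong_dvd_iff)
      with p(1) show False by simp
    qed
  qed
  ultimately have "b \<in> zhat_units e" by (auto simp: zhat_units_def)
  moreover have "b n = int a"
  proof -
    have "n dvd n ^ fact n" by (rule dvd_power) simp
    then have "[int (n ^ fact n) = 0] (mod int n)" by (simp only: cong_0_iff int_dvd_int_iff)
    then have "[x n = int a + (1 - int a) * 0] (mod int n)"
      unfolding x_def by (intro cong_add cong_mult cong_refl) simp
    then show ?thesis using n a by (simp add: b_def cong_def)
  qed
  ultimately show ?thesis using that by blast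
qed

section \<open>Tensor products by generators and relations\<close>

text \<open>The induct method eta-expands functions in goals; these rules would then rewrite under the binder.\<close>

lemmas fun_apply = minus_apply plus_fun_apply zero_fun_apply uminus_apply
declare fun_apply [simp del]

lemma sum_fun_apply: "(\<Sum>i\<in>I. f i) x = (\<Sum>i\<in>I. f i x)"
  by (induction I rule: infinite_finite_induct) (auto simp: fun_apply)

lemma of_int_fun_apply: "of_int k x = (of_int k :: 'b::ring_1)"
  by (cases k) (auto simp: fun_apply)

lemma lin_add_fun: "lin (\<lambda>x. \<beta> x + \<gamma> x) f = lin \<beta> f + lin \<gamma> f"
  by (simp add: lin_def ring_distribs sum.distrib)

lemma lin_of_nat: "fsupp f \<Longrightarrow> fsupp (of_nat n * f) \<and> lin \<beta> (of_nat n * f) = of_nat n * lin \<beta> f"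
  by (induction n) (auto simp: ring_distribs lin_add)

lemma fsums_iff: "f \<in> fsums B \<longleftrightarrow> fsupp f \<and> (\<forall>x. f x \<noteq> 0 \<longrightarrow> snd x \<in> B)"
  by (simp add: fsums_def fsupp_def)

lemma fsums_fsupp: "f \<in> fsums B \<Longrightarrow> fsupp f"
  by (simp add: fsums_iff)

lemma fsums_zero [simp]: "0 \<in> fsums B"
  by (simp add: fsums_iff fun_apply)

lemma fsums_add: "f \<in> fsums B \<Longrightarrow> g \<in> fsums B \<Longrightarrow> f + g \<in> fsums B"
  by (auto simp: fsums_iff fun_apply) (metis add.right_neutral)

lemma fsums_uminus: "f \<in> fsums B \<Longrightarrow> - f \<in> fsums B"
  by (auto simp: fsums_iff fun_apply)

lemma fsums_diff: "f \<in> fsums B \<Longrightarrow> g \<in> fsums B \<Longrightarrow> f - g \<in> fsums B"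
  using fsums_add[OF _ fsums_uminus, of f B g] by simp

lemma fsums_fdelta [simp]: "fdelta x \<in> fsums B \<longleftrightarrow> snd x \<in> B"
  by (auto simp: fsums_iff fdelta_nonzero)

lemma fsums_sum: "(\<And>i. i \<in> I \<Longrightarrow> f i \<in> fsums B) \<Longrightarrow> sum f I \<in> fsums B"
  by (induction I rule: infinite_finite_induct) (auto intro: fsums_add)

lemma fsums_of_nat: "f \<in> fsums B \<Longrightarrow> of_nat n * f \<in> fsums B"
  by (induction n) (auto simp: ring_distribs intro: fsums_add)

lemma fsums_mono: "B \<subseteq> B' \<Longrightarrow> f \<in> fsums B \<Longrightarrow> f \<in> fsums B'"
  by (auto simp: fsums_iff)

lemma fsums_induct [consumes 1, case_names zero add diff]:
  fixes f :: "'a \<times> complex \<Rightarrow> int"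
  assumes "f \<in> fsums B" and "P 0"
    and "\<And>f r u. f \<in> fsums B \<Longrightarrow> P f \<Longrightarrow> u \<in> B \<Longrightarrow> P (f + fdelta (r, u))"
    and "\<And>f r u. f \<in> fsums B \<Longrightarrow> P f \<Longrightarrow> u \<in> B \<Longrightarrow> P (f - fdelta (r, u))"
  shows "P f"
proof -
  show ?thesis
  proof (rule fsupp_induct[of f "{x. snd x \<in> B}" P])
    show "fsupp f" "\<And>x. f x \<noteq> 0 \<Longrightarrow> x \<in> {x. snd x \<in> B}" using assms(1) by (auto simp: fsums_iff)
    show "P 0" by fact
    fix f :: "'a \<times> complex \<Rightarrow> int" and x :: "'a \<times> complex"
    assume "fsupp f" "\<And>y. f y \<noteq> 0 \<Longrightarrow> y \<in> {x. snd x \<in> B}" "P f" "x \<in> {x. snd x \<in> B}"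
    then show "P (f + fdelta x)" "P (f - fdelta x)"
      using assms(3,4)[of f "snd x" "fst x"] by (auto simp: fsums_iff)
  qed
qed

lemma trel_base: "t \<in> tgens B \<Longrightarrow> t \<in> trel B"
  by (auto simp: trel_def)

lemma trel_zero [simp]: "0 \<in> trel B"
  by (auto simp: trel_def)

lemma trel_diff: "s \<in> trel B \<Longrightarrow> t \<in> trel B \<Longrightarrow> s - t \<in> trel B"
  by (auto simp: trel_def)

lemma trel_uminus: "t \<in> trel B \<Longrightarrow> - t \<in> trel B"
  using trel_diff[of 0 B t] by simp

lemma trel_add: "s \<in> trel B \<Longrightarrow> t \<in> trel B \<Longrightarrow> s + t \<in> trel B"
  using trel_diff[OF _ trel_uminus, of s B t] by simp

lemma trel_sum: "(\<And>i. i \<in> I \<Longrightarrow> f i \<in> trel B) \<Longrightarrow> sum f I \<in> trel B"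
  by (induction I rule: infinite_finite_induct) (auto intro: trel_add)

lemma trel_induct [consumes 1, case_names base zero diff]:
  assumes "t \<in> trel B" "\<And>t. t \<in> tgens B \<Longrightarrow> P t" "P 0"
    "\<And>s t. P s \<Longrightarrow> P t \<Longrightarrow> P (s - t)"
  shows "P t"
proof -
  have "trel B \<subseteq> {t. P t}" unfolding trel_def by (rule Inter_lower) (use assms in auto)
  with assms(1) show ?thesis by auto
qed

lemma trel_add_left: "u \<in> B \<Longrightarrow> fdelta (a + a', u) - fdelta (a, u) - fdelta (a', u) \<in> trel B"
  by (rule trel_base) (auto simp: tgens_def)

lemma trel_add_right:
  "u \<in> B \<Longrightarrow> v \<in> B \<Longrightarrow> fdelta (a, u + v) - fdelta (a, u) - fdelta (a, v) \<in> trel B"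
  by (rule trel_base) (auto simp: tgens_def)

lemma trel_mono:
  assumes "B \<subseteq> B'" "t \<in> trel B" shows "t \<in> trel B'"
  using assms(2)
proof (induction rule: trel_induct)
  case (base t)
  then have "t \<in> tgens B'" using assms(1) unfolding tgens_def by blast
  then show ?case by (rule trel_base)
qed (auto intro: trel_diff)

lemma trel_fsums: "t \<in> trel (zspan E) \<Longrightarrow> t \<in> fsums (zspan E)"
proof (induction rule: trel_induct)
  case (base t)
  then show ?case by (auto simp: tgens_def intro!: fsums_diff zspan_add)
qed (auto intro: fsums_diff)

lemma trel_zero_right: "0 \<in> B \<Longrightarrow> fdelta (a, 0) \<in> trel B"
  using trel_uminus[OF trel_add_right[of 0 B 0 a]] by simp

lemma trel_zero_left: "u \<in> B \<Longrightarrow> fdelta (0, u) \<in> trel B"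
  using trel_uminus[OF trel_add_left[of u B 0 0]] by simp

text \<open>A relation is built from finitely many defining ones, so it already holds over a
  finitely generated subgroup. This is the injectivity half of the fact that tensor products commute
  with directed unions.\<close>

lemma trel_finite_level:
  assumes "t \<in> trel B"
  shows "\<exists>E. finite E \<and> E \<subseteq> B \<and> t \<in> trel (zspan E)"
  using assms
proof (induction rule: trel_induct)
  case (base t)
  then consider a a' b where "t = fdelta (a + a', b) - fdelta (a, b) - fdelta (a', b)" "b \<in> B"
    | a b b' where "t = fdelta (a, b + b') - fdelta (a, b) - fdelta (a, b')" "b \<in> B" "b' \<in> B"
    by (auto simp: tgens_def)
  then show ?case
  proof cases
    case 1 then show ?thesis
      by (intro exI[of _ "{b}"]) (auto intro: trel_add_left zspan_base)
  next
    case 2 then show ?thesis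
      by (intro exI[of _ "{b, b'}"]) (auto intro: trel_add_right zspan_base)
  qed
next
  case (diff s t)
  then obtain E F where "finite E" "E \<subseteq> B" "s \<in> trel (zspan E)" "finite F" "F \<subseteq> B" "t \<in> trel (zspan F)" by auto
  then show ?case
    by (intro exI[of _ "E \<union> F"])
       (auto intro!: trel_diff intro: trel_mono[OF zspan_mono, of E "E \<union> F"] trel_mono[OF zspan_mono, of F "E \<union> F"])
qed auto

abbreviation teq :: "complex set \<Rightarrow> ('a::ab_group_add \<times> complex \<Rightarrow> int) \<Rightarrow> ('a \<times> complex \<Rightarrow> int) \<Rightarrow> bool" where
  "teq B f g \<equiv> f - g \<in> trel B"

lemma teq_trans: "teq B f g \<Longrightarrow> teq B g h \<Longrightarrow> teq B f h"
  using trel_add[of "f - g" B "g - h"] by simp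

lemma teq_sym: "teq B f g \<Longrightarrow> teq B g f"
  using trel_uminus[of "f - g" B] by simp

lemma teq_add: "teq B f f' \<Longrightarrow> teq B g g' \<Longrightarrow> teq B (f + g) (f' + g')"
  using trel_add[of "f - f'" B "g - g'"] by (simp add: algebra_simps)

lemma teq_diff: "teq B f f' \<Longrightarrow> teq B g g' \<Longrightarrow> teq B (f - g) (f' - g')"
  using trel_diff[of "f - f'" B "g - g'"] by (simp add: algebra_simps)

lemma teq_sum: "(\<And>i. i \<in> I \<Longrightarrow> teq B (f i) (g i)) \<Longrightarrow> teq B (sum f I) (sum g I)"
  using trel_sum[of I "\<lambda>i. f i - g i" B] by (simp add: sum_subtractf)

lemma teq_fdelta_add_left: "u \<in> B \<Longrightarrow> teq B (fdelta (a + a', u)) (fdelta (a, u) + fdelta (a', u))"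
  using trel_add_left[of u B a a'] by (simp add: algebra_simps)

lemma teq_fdelta_add_right:
  "u \<in> B \<Longrightarrow> v \<in> B \<Longrightarrow> teq B (fdelta (a, u + v)) (fdelta (a, u) + fdelta (a, v))"
  using trel_add_right[of u B v a] by (simp add: algebra_simps)

lemma teq_fdelta_minus_left: "u \<in> B \<Longrightarrow> teq B (fdelta (- a, u)) (- fdelta (a, u))"
  using trel_add[OF trel_uminus[OF trel_add_left[of u B "- a" a]] trel_zero_left[of u B]]
  by (simp add: algebra_simps)

lemma teq_fdelta_diff_left: "u \<in> B \<Longrightarrow> teq B (fdelta (a - a', u)) (fdelta (a, u) - fdelta (a', u))"
  using trel_uminus[OF trel_add_left[of u B "a - a'" a']] by (simp add: algebra_simps)

lemma teq_fdelta_of_nat: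
  assumes "u \<in> zspan E"
  shows "teq (zspan E) (fdelta (r, of_nat n * u)) (fdelta (of_nat n * r, u))"
proof (induction n)
  case 0
  show ?case using trel_diff[OF trel_zero_right trel_zero_left[OF assms], of r] by (simp add: zspan_zero)
next
  case (Suc n)
  have "teq (zspan E) (fdelta (r, u + of_nat n * u)) (fdelta (r, u) + fdelta (r, of_nat n * u))"
    by (intro teq_fdelta_add_right zspan_of_nat assms)
  also have "teq (zspan E) (fdelta (r, u) + fdelta (r, of_nat n * u)) (fdelta (r, u) + fdelta (of_nat n * r, u))"
    using Suc by simp
  finally (teq_trans) have "teq (zspan E) (fdelta (r, u + of_nat n * u)) (fdelta (r, u) + fdelta (of_nat n * r, u))" .
  from teq_trans[OF this teq_sym[OF teq_fdelta_add_left[OF assms]]]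
  show ?case by (simp add: ring_distribs)
qed

lemma teq_fdelta_of_int:
  assumes "u \<in> zspan E"
  shows "teq (zspan E) (fdelta (r, of_int k * u)) (fdelta (of_int k * r, u))"
proof (cases "k \<ge> 0")
  case True
  then show ?thesis using teq_fdelta_of_nat[OF assms, of r "nat k"] by simp
next
  case False
  define n where "n = nat (- k)"
  have k: "k = - int n" using False by (simp add: n_def)
  have "teq (zspan E) (fdelta (r, of_nat n * u) + fdelta (r, of_int k * u)) 0"
    using teq_trans[OF teq_sym[OF teq_fdelta_add_right[of "of_nat n * u" "zspan E" "of_int k * u" r]], of 0]
      trel_zero_right[of "zspan E" r] by (simp add: k zspan_zero zspan_of_nat zspan_uminus assms)
  from teq_diff[OF this teq_fdelta_of_nat[OF assms, of r n]]
  have "teq (zspan E) (fdelta (r, of_int k * u)) (- fdelta (of_nat n * r, u))" by simp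
  from teq_trans[OF this teq_sym[OF teq_fdelta_minus_left[OF assms]]]
  show ?thesis by (simp add: k)
qed

lemma teq_fdelta_sum:
  assumes "\<And>i. i \<in> I \<Longrightarrow> v i \<in> zspan E"
  shows "teq (zspan E) (fdelta (r, \<Sum>i\<in>I. v i)) (\<Sum>i\<in>I. fdelta (r, v i))"
  using assms
proof (induction I rule: infinite_finite_induct)
  case (insert i I)
  have "teq (zspan E) (fdelta (r, v i + (\<Sum>i\<in>I. v i))) (fdelta (r, v i) + fdelta (r, \<Sum>i\<in>I. v i))"
    using insert.prems by (intro teq_fdelta_add_right zspan_sum) auto
  also have "teq (zspan E) (fdelta (r, v i) + fdelta (r, \<Sum>i\<in>I. v i)) (fdelta (r, v i) + (\<Sum>i\<in>I. fdelta (r, v i)))"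
    using insert by simp
  finally (teq_trans) show ?case using insert by (simp add:)
qed (auto simp: trel_zero_right zspan_zero)

text \<open>A basis of a finitely generated group L of complex numbers identifies the tensor product of R and L with a power of R.\<close>

lemma tensor_coordinates:
  assumes "finite E"
  obtains d b \<Lambda> where "\<And>i. i < (d::nat) \<Longrightarrow> b i \<in> zspan E"
    "\<And>i f. i < d \<Longrightarrow> f \<in> trel (zspan E) \<Longrightarrow> \<Lambda> i f = (0::'r::ring_1)"
    "\<And>f. f \<in> fsums (zspan E) \<Longrightarrow> teq (zspan E) f (\<Sum>i<d. fdelta (\<Lambda> i f, b i))"
    "\<And>i f g. fsupp f \<Longrightarrow> fsupp g \<Longrightarrow> \<Lambda> i (f - g) = \<Lambda> i f - \<Lambda> i g"
    "\<And>i f n. fsupp f \<Longrightarrow> \<Lambda> i (of_nat n * f) = of_nat n * \<Lambda> i f"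
    "\<And>u. u \<in> zspan E \<Longrightarrow> \<exists>k. u = (\<Sum>i<d. of_int (k i) * b i) \<and> (\<forall>i<d. \<forall>r. \<Lambda> i (fdelta (r, u)) = of_int (k i) * r)"
proof -
  obtain d b \<kappa> where b: "\<And>i. i < (d::nat) \<Longrightarrow> b i \<in> zspan E"
    "\<And>x. x \<in> zspan E \<Longrightarrow> x = (\<Sum>i<d. of_int (\<kappa> i x) * b i)"
    "\<And>x y i. x \<in> zspan E \<Longrightarrow> y \<in> zspan E \<Longrightarrow> i < d \<Longrightarrow> \<kappa> i (x + y) = \<kappa> i x + (\<kappa> i y :: int)"
    by (rule zspan_free_coordinates[OF assms(1)], rule that)
  \<comment> \<open>The map that sends r \<otimes> u to \<kappa> i u times r, evaluated on formal
    sums: the i-th coordinate of the tensor product with values in R.\<close>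
  define \<Lambda> where "\<Lambda> i = lin (\<lambda>(r::'r, u). of_int (\<kappa> i u) * r)" for i
  let ?L = "zspan E"
  have delta: "\<Lambda> i (fdelta (r, u)) = of_int (\<kappa> i u) * r" for i r u by (simp add: \<Lambda>_def)
  have ldiff: "\<Lambda> i (f - g) = \<Lambda> i f - \<Lambda> i g" if "fsupp f" "fsupp g" for i f g
    using that by (simp add: \<Lambda>_def lin_diff)
  have ladd: "\<Lambda> i (f + g) = \<Lambda> i f + \<Lambda> i g" if "fsupp f" "fsupp g" for i f g
    using that by (simp add: \<Lambda>_def lin_add)
  have z: "fsupp f \<and> \<Lambda> i f = 0" if i: "i < d" and "f \<in> trel ?L" for i f
    using that(2)
  proof (induction rule: trel_induct)
    case (base t)
    then show ?case using i
      by (auto simp: tgens_def ldiff delta b(3) ring_distribs fsupp_diff intro!: fsupp_diff)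
  qed (auto simp: ldiff, simp add: \<Lambda>_def)
  let ?S = "\<lambda>f. \<Sum>i<d. fdelta (\<Lambda> i f, b i)"
  have gen: "teq ?L (fdelta (r, u)) (?S (fdelta (r, u)))" if u: "u \<in> ?L" for r u
  proof -
    have "teq ?L (fdelta (r, \<Sum>i<d. of_int (\<kappa> i u) * b i)) (\<Sum>i<d. fdelta (r, of_int (\<kappa> i u) * b i))"
      by (rule teq_fdelta_sum) (auto intro: zspan_of_int b)
    also have "teq ?L (\<Sum>i<d. fdelta (r, of_int (\<kappa> i u) * b i)) (?S (fdelta (r, u)))"
      unfolding delta by (intro teq_sum teq_fdelta_of_int b) auto
    finally (teq_trans) show ?thesis using b(2)[OF u] by simp
  qed
  have rep: "teq ?L f (?S f)" if "f \<in> fsums ?L" for f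
    using that
  proof (induction rule: fsums_induct)
    case zero
    have "?S 0 \<in> trel ?L" by (auto simp: \<Lambda>_def intro!: trel_sum trel_zero_left b)
    from trel_uminus[OF this] show ?case by simp
  next
    case (add f r u)
    have "teq ?L (f + fdelta (r, u)) (?S f + ?S (fdelta (r, u)))"
      by (intro teq_add add gen)
    also have "teq ?L (?S f + ?S (fdelta (r, u))) (?S (f + fdelta (r, u)))"
      unfolding sum.distrib[symmetric] ladd[OF fsums_fsupp[OF add(1)] fsupp_fdelta]
      by (intro teq_sum teq_sym[OF teq_fdelta_add_left] b) auto
    finally (teq_trans) show ?case .
  next
    case (diff f r u)
    have "teq ?L (f - fdelta (r, u)) (?S f - ?S (fdelta (r, u)))"
      by (intro teq_diff diff gen)
    also have "teq ?L (?S f - ?S (fdelta (r, u))) (?S (f - fdelta (r, u)))"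
    proof -
      have eq: "?S f - ?S (fdelta (r, u)) = (\<Sum>i<d. fdelta (\<Lambda> i f, b i) - fdelta (\<Lambda> i (fdelta (r, u)), b i))"
        by (simp add: sum_subtractf)
      show ?thesis
        unfolding eq ldiff[OF fsums_fsupp[OF diff(1)] fsupp_fdelta]
        by (intro teq_sum teq_sym[OF teq_fdelta_diff_left] b) auto
    qed
    finally (teq_trans) show ?case .
  qed
  have lnat: "\<Lambda> i (of_nat n * f) = of_nat n * \<Lambda> i f" if "fsupp f" for i f n
    by (simp add: \<Lambda>_def lin_of_nat[OF that])
  have coord: "\<exists>k. u = (\<Sum>i<d. of_int (k i) * b i) \<and> (\<forall>i<d. \<forall>r. \<Lambda> i (fdelta (r, u)) = of_int (k i) * r)"
    if "u \<in> ?L" for u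
    using b(2)[OF that] delta by (intro exI[of _ "\<lambda>i. \<kappa> i u"]) simp
  show ?thesis
  proof (rule that[of d b \<Lambda>])
    show "\<Lambda> i f = 0" if "i < d" "f \<in> trel ?L" for i f using z[OF that] by blast
  qed (fact b(1) rep ldiff lnat coord)+
qed

lemma fsums_finite_level:
  assumes "f \<in> fsums B" shows "\<exists>E. finite E \<and> E \<subseteq> B \<and> f \<in> fsums (zspan E)"
proof (intro exI conjI)
  let ?E = "snd ` {x. f x \<noteq> 0}"
  show "finite ?E" using assms by (auto simp: fsums_def)
  show "?E \<subseteq> B" using assms by (auto simp: fsums_def)
  have "snd x \<in> zspan ?E" if "f x \<noteq> 0" for x using that by (intro zspan_base) auto
  then show "f \<in> fsums (zspan ?E)" using assms unfolding fsums_def by blast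
qed

text \<open>Over a finitely generated group large enough for both f and the relation that kills n f,
  the tensor product is a power of R, where n acts injectively.\<close>

lemma trel_torsion_free:
  fixes f :: "'r::ring_1 \<times> complex \<Rightarrow> int"
  assumes f: "f \<in> fsums (zspan A)" and nf: "of_nat n * f \<in> trel (zspan A)"
    and inj: "\<And>r::'r. of_nat n * r = 0 \<Longrightarrow> r = 0"
  shows "f \<in> trel (zspan A)"
proof -
  obtain E F where E: "finite E" "E \<subseteq> zspan A" "f \<in> fsums (zspan E)"
    and F: "finite F" "F \<subseteq> zspan A" "of_nat n * f \<in> trel (zspan F)"
    using fsums_finite_level[OF f] trel_finite_level[OF nf] by blast
  define G where "G = E \<union> F"
  have G: "finite G" "G \<subseteq> zspan A" "f \<in> fsums (zspan G)" "of_nat n * f \<in> trel (zspan G)"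
    using E F fsums_mono[OF zspan_mono, of E G f] trel_mono[OF zspan_mono, of F G] by (auto simp: G_def)
  obtain d b \<Lambda> where L: "\<And>i. i < (d::nat) \<Longrightarrow> b i \<in> zspan G"
    "\<And>i f. i < d \<Longrightarrow> f \<in> trel (zspan G) \<Longrightarrow> \<Lambda> i f = (0::'r::ring_1)"
    "\<And>f. f \<in> fsums (zspan G) \<Longrightarrow> teq (zspan G) f (\<Sum>i<d. fdelta (\<Lambda> i f, b i))"
    "\<And>i f n. fsupp f \<Longrightarrow> \<Lambda> i (of_nat n * f) = of_nat n * \<Lambda> i f"
    by (rule tensor_coordinates[OF G(1), where 'r='r], rule that)
  have "\<Lambda> i f = 0" if "i < d" for i
    using L(2)[OF that G(4)] L(4)[OF fsums_fsupp[OF f], of i n] inj by simp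
  then have "(\<Sum>i<d. fdelta (\<Lambda> i f, b i)) \<in> trel (zspan G)"
    using L(1) by (auto intro!: trel_sum trel_zero_left)
  from trel_add[OF L(3)[OF G(3)] this] have "f \<in> trel (zspan G)" by simp
  then show ?thesis using trel_mono[OF zspan_least[OF G(2)]] by blast
qed

text \<open>The coordinates of 1 with respect to a basis are jointly coprime, because no 1/g with g > 1 lies in the cyclotomic ring.\<close>

lemma trel_pure:
  fixes y :: "'r::ring_1 \<times> complex \<Rightarrow> int"
  assumes y: "y \<in> fsums (ZMu e)" and t: "fdelta (s, 1) - of_nat n * y \<in> trel (ZMu e)"
  shows "\<exists>t. s = of_nat n * t"
proof -
  obtain E F where E: "finite E" "E \<subseteq> ZMu e" "y \<in> fsums (zspan E)"
    and F: "finite F" "F \<subseteq> ZMu e" "fdelta (s, 1) - of_nat n * y \<in> trel (zspan F)"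
    using fsums_finite_level[OF y] trel_finite_level[OF t] by blast
  define G where "G = insert 1 (E \<union> F)"
  have G: "finite G" "G \<subseteq> ZMu e" "y \<in> fsums (zspan G)" "fdelta (s, 1) - of_nat n * y \<in> trel (zspan G)"
    using E F fsums_mono[OF zspan_mono, of E G y] trel_mono[OF zspan_mono, of F G]
    by (auto simp: G_def)
  obtain d b \<Lambda> where L: "\<And>i. i < (d::nat) \<Longrightarrow> b i \<in> zspan G"
    "\<And>i f. i < d \<Longrightarrow> f \<in> trel (zspan G) \<Longrightarrow> \<Lambda> i f = (0::'r::ring_1)"
    "\<And>i f g. fsupp f \<Longrightarrow> fsupp g \<Longrightarrow> \<Lambda> i (f - g) = \<Lambda> i f - \<Lambda> i g"
    "\<And>i f n. fsupp f \<Longrightarrow> \<Lambda> i (of_nat n * f) = of_nat n * \<Lambda> i f"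
    "\<And>u. u \<in> zspan G \<Longrightarrow> \<exists>k. u = (\<Sum>i<d. of_int (k i) * b i) \<and> (\<forall>i<d. \<forall>r. \<Lambda> i (fdelta (r, u)) = of_int (k i) * r)"
    by (rule tensor_coordinates[OF G(1), where 'r='r], rule that)
  have "1 \<in> zspan G" by (rule zspan_base) (simp add: G_def)
  then obtain c where c: "1 = (\<Sum>i<d. of_int (c i) * b i)" "\<And>i r. i < d \<Longrightarrow> \<Lambda> i (fdelta (r, 1)) = of_int (c i) * r"
    using L(5)[of 1] by blast
  have cs: "of_int (c i) * s = of_nat n * \<Lambda> i y" if "i < d" for i
    using L(2)[OF that G(4)] L(3)[of "fdelta (s, 1)" "of_nat n * y" i] L(4)[of y i n] c(2)[OF that, of s]
      fsums_fsupp[OF y] lin_of_nat[of y n] by auto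
  obtain m where m: "\<And>i. i < d \<Longrightarrow> (\<Sum>j<d. m j * c j) dvd c i" using bezout_finite[of "{..<d}" c] by auto
  define g where "g = (\<Sum>j<d. m j * c j)"
  \<comment> \<open>Here g generates the ideal of the coordinates of 1. Dividing these coordinates
    by g exhibits 1/g as the element q of the ring, so g is 1 or -1.\<close>
  define q where "q = (\<Sum>i<d. of_int (c i div g) * b i)"
  have "of_int g * q = (\<Sum>i<d. of_int (g * (c i div g)) * b i)"
    by (simp add: q_def sum_distrib_left mult.assoc)
  also have "\<dots> = 1" using m unfolding c(1) g_def by (intro sum.cong) auto
  finally have gq: "of_int g * q = 1" .
  have "zspan G \<subseteq> ZMu e" using G(2) zspan_least unfolding ZMu_eq_zspan by blast
  then have q: "q \<in> ZMu e" unfolding q_def using L(1)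
    by (intro ZMu_sum ZMu_mult ZMu_of_int) auto
  have "int (nat \<bar>g\<bar>) dvd 1"
  proof (rule ZMu_int_dvd)
    show "of_int (sgn g) * q \<in> ZMu e" using q by (intro ZMu_mult ZMu_of_int)
    have "\<bar>g\<bar> * sgn g = g" by (simp add: abs_mult_sgn)
    then have "of_int \<bar>g\<bar> * (of_int (sgn g) * q) = of_int g * q"
      by (metis mult.assoc of_int_mult)
    then show "of_int 1 = of_nat (nat \<bar>g\<bar>) * (of_int (sgn g) * q)" using gq by simp
    show "nat \<bar>g\<bar> > 0" using gq by auto
  qed
  then have g1: "g = 1 \<or> g = -1" by (auto simp: zdvd1_eq)
  \<comment> \<open>Every c j * s is a multiple of n by comparison of coordinates, hence so is their
    combination g * s, which is s up to sign.\<close>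
  have "of_int g * s = (\<Sum>j<d. of_int (m j) * (of_int (c j) * s))"
    by (simp add: g_def sum_distrib_right mult.assoc)
  also have "\<dots> = (\<Sum>j<d. of_int (m j) * (of_nat n * \<Lambda> j y))" using cs by simp
  also have "\<dots> = of_nat n * (\<Sum>j<d. of_int (m j) * \<Lambda> j y)"
    unfolding sum_distrib_left by (intro sum.cong refl) (metis mult.assoc mult_of_nat_commute)
  finally have gs: "of_int g * s = of_nat n * (\<Sum>j<d. of_int (m j) * \<Lambda> j y)" .
  from g1 show ?thesis
  proof
    assume "g = 1" with gs show ?thesis by auto
  next
    assume "g = -1"
    with gs have "- s = of_nat n * (\<Sum>j<d. of_int (m j) * \<Lambda> j y)" by simp
    from arg_cong[OF this, of uminus] have "s = of_nat n * - (\<Sum>j<d. of_int (m j) * \<Lambda> j y)" by simp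
    then show ?thesis by blast
  qed
qed

text \<open>Writing the sum over a fibre of the product map as an iterated linear extension reduces
  bilinearity to the additivity of \<open>lin\<close>.\<close>

lemma fmul_eq_lin:
  assumes "fsupp f" "fsupp g"
  shows "fmul f g = lin (\<lambda>x. lin (\<lambda>y. fdelta (fst x * fst y, snd x * snd y)) g) f"
proof
  fix z
  let ?F = "{x. f x \<noteq> 0}" and ?G = "{y. g y \<noteq> 0}" and ?p = "\<lambda>x y. (fst x * fst y, snd x * snd y)"
  have fin: "finite ?F" "finite ?G" using assms by (auto simp: fsupp_def)
  have "fmul f g z = (\<Sum>p \<in> {p \<in> ?F \<times> ?G. ?p (fst p) (snd p) = z}. f (fst p) * g (snd p))"
    unfolding fmul_def by (rule sum.cong) auto
  also have "\<dots> = (\<Sum>p \<in> ?F \<times> ?G. if ?p (fst p) (snd p) = z then f (fst p) * g (snd p) else 0)"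
    by (rule sum.inter_filter[of "?F \<times> ?G" "\<lambda>p. f (fst p) * g (snd p)" "\<lambda>p. ?p (fst p) (snd p) = z", OF finite_cartesian_product[OF fin]])
  also have "\<dots> = (\<Sum>p \<in> ?F \<times> ?G. f (fst p) * (g (snd p) * fdelta (?p (fst p) (snd p)) z))"
    by (intro sum.cong refl) (auto simp: fdelta_def)
  also have "\<dots> = (\<Sum>x\<in>?F. \<Sum>y\<in>?G. f x * (g y * fdelta (?p x y) z))"
    unfolding sum.cartesian_product by (simp add: case_prod_beta)
  also have "\<dots> = lin (\<lambda>x. lin (\<lambda>y. fdelta (?p x y)) g) f z"
    by (simp add: lin_def sum_fun_apply of_int_fun_apply sum_distrib_left)
  finally show "fmul f g z = lin (\<lambda>x. lin (\<lambda>y. fdelta (?p x y)) g) f z" .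
qed

lemma fmul_add_left: "fsupp f \<Longrightarrow> fsupp g \<Longrightarrow> fsupp h \<Longrightarrow> fmul (f + g) h = fmul f h + fmul g h"
  by (simp add: fmul_eq_lin lin_add fsupp_add)

lemma fmul_diff_left: "fsupp f \<Longrightarrow> fsupp g \<Longrightarrow> fsupp h \<Longrightarrow> fmul (f - g) h = fmul f h - fmul g h"
  by (simp add: fmul_eq_lin lin_diff fsupp_diff)

lemma fmul_add_right: "fsupp f \<Longrightarrow> fsupp g \<Longrightarrow> fsupp h \<Longrightarrow> fmul h (f + g) = fmul h f + fmul h g"
  by (simp add: fmul_eq_lin lin_add fsupp_add lin_add_fun)

lemma fmul_zero_left: "fsupp h \<Longrightarrow> fmul 0 h = 0"
  by (simp add: fmul_eq_lin)

lemma fmul_diff_right: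
  assumes "fsupp f" "fsupp g" "fsupp h" shows "fmul h (f - g) = fmul h f - fmul h g"
  using fmul_add_right[of "f - g" g h] assms by (simp add: fsupp_diff)

lemma fmul_zero_right: "fsupp h \<Longrightarrow> fmul h 0 = 0"
  using fmul_diff_right[of 0 0 h] by simp

lemma fmul_fdelta: "fmul (fdelta (a, u)) (fdelta (b, v)) = fdelta (a * b, u * v)"
  by (simp add: fmul_eq_lin)

lemmas fmul_distribs = fmul_add_left fmul_diff_left fmul_add_right fmul_diff_right

lemma fmul_fsums:
  assumes B: "\<And>u v. u \<in> B \<Longrightarrow> v \<in> B \<Longrightarrow> u * v \<in> B" and f: "f \<in> fsums B" and g: "g \<in> fsums B"
  shows "fmul f g \<in> fsums B"
  using f
proof (induction rule: fsums_induct)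
  have *: "fmul (fdelta (r, u)) g \<in> fsums B" if u: "u \<in> B" for r u
    using g by (induction rule: fsums_induct)
      (auto simp: fmul_zero_right fmul_distribs fsums_fsupp fmul_fdelta B u intro!: fsums_add fsums_diff)
  case (add f r u)
  then show ?case using g * by (simp add: fmul_distribs fsums_fsupp fsums_add)
next
  have *: "fmul (fdelta (r, u)) g \<in> fsums B" if u: "u \<in> B" for r u
    using g by (induction rule: fsums_induct)
      (auto simp: fmul_zero_right fmul_distribs fsums_fsupp fmul_fdelta B u intro!: fsums_add fsums_diff)
  case (diff f r u)
  then show ?case using g * by (simp add: fmul_distribs fsums_fsupp fsums_diff)
qed (use g in \<open>simp add: fmul_zero_left fsums_fsupp\<close>)

lemma fmul_assoc:
  assumes f: "f \<in> fsums UNIV" and g: "g \<in> fsums UNIV" and h: "h \<in> fsums UNIV"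
  shows "fmul (fmul f g) h = fmul f (fmul g (h :: 'r::ring_1 \<times> complex \<Rightarrow> int))"
proof -
  note fm = fsums_fsupp[OF fmul_fsums[of UNIV, simplified]]
  note s = fm fmul_zero_left fmul_zero_right fmul_distribs fsums_fsupp fmul_fdelta mult.assoc
  have 1: "fmul (fmul (fdelta (a, u)) (fdelta (b, v))) h = fmul (fdelta (a, u)) (fmul (fdelta (b, v)) h)" for a b :: 'r and u v
    using h by (induction rule: fsums_induct) (simp_all add: s)
  have 2: "fmul (fmul (fdelta (a, u)) g) h = fmul (fdelta (a, u)) (fmul g h)" for a u
    using g by (induction rule: fsums_induct) (use h 1 in \<open>simp_all add: s\<close>)
  show ?thesis
    using f by (induction rule: fsums_induct) (use h g 2 in \<open>simp_all add: s\<close>)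
qed

text \<open>A defining relation times a single \<open>fdelta\<close>, on either side, is again a
  defining relation, because the right factors are closed under products. So the relations form a
  two-sided ideal.\<close>

lemma trel_fmul:
  fixes t :: "'r::ring_1 \<times> complex \<Rightarrow> int"
  assumes B: "B = ZMu e" and t: "t \<in> trel B" and g: "g \<in> fsums B"
  shows "fmul t g \<in> trel B" "fmul g t \<in> trel B"
proof -
  have Bm: "u * v \<in> B" if "u \<in> B" "v \<in> B" for u v using that B ZMu_mult by simp
  have tf: "fsupp t" if "t \<in> trel B" for t :: "'r \<times> complex \<Rightarrow> int"
    using that trel_fsums fsums_fsupp unfolding B ZMu_eq_zspan by blast
  have gen: "fmul t (fdelta (r, u)) \<in> trel B \<and> fmul (fdelta (r, u)) t \<in> trel B" if t: "t \<in> tgens B" and u: "u \<in> B" for r :: 'r and u t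
  proof -
    consider a a' b where "t = fdelta (a + a', b) - fdelta (a, b) - fdelta (a', b)" "b \<in> B"
    | a b b' where "t = fdelta (a, b + b') - fdelta (a, b) - fdelta (a, b')" "b \<in> B" "b' \<in> B"
      using t by (auto simp: tgens_def)
    then show ?thesis
      by cases (auto simp: fmul_distribs fsupp_diff fmul_fdelta ring_distribs intro!: trel_add_left trel_add_right Bm u)
  qed
  have gen': "fmul t g \<in> trel B \<and> fmul g t \<in> trel B" if "t \<in> tgens B" for t :: "'r \<times> complex \<Rightarrow> int"
    using g
  proof (induction rule: fsums_induct)
    case zero then show ?case using tf[OF trel_base[OF that]] by (simp add: fmul_zero_left fmul_zero_right)
  next
    case (add f r u) then show ?case using gen[OF that, of u r] tf[OF trel_base[OF that]]
      by (simp add: fmul_distribs fsums_fsupp trel_add)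
  next
    case (diff f r u) then show ?case using gen[OF that, of u r] tf[OF trel_base[OF that]]
      by (simp add: fmul_distribs fsums_fsupp trel_diff)
  qed
  have "fsupp t \<and> fmul t g \<in> trel B \<and> fmul g t \<in> trel B"
    using t
  proof (induction rule: trel_induct)
    case (base t) then show ?case using gen' tf trel_base by blast
  next
    case zero then show ?case using g by (simp add: fmul_zero_left fmul_zero_right fsums_fsupp)
  next
    case (diff s t) then show ?case using g by (simp add: fmul_distribs fsums_fsupp trel_diff fsupp_diff)
  qed
  then show "fmul t g \<in> trel B" "fmul g t \<in> trel B" by auto
qed

lemma fpush_eq_lin:
  assumes "fsupp f" shows "fpush F f = lin (\<lambda>x. fdelta (F x)) f"
proof
  fix z
  have fin: "finite {x. f x \<noteq> 0}" using assms by (simp add: fsupp_def)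
  have "fpush F f z = (\<Sum>x | f x \<noteq> 0. f x * fdelta (F x) z)"
    unfolding fpush_def by (rule sum.mono_neutral_cong_left) (use fin in \<open>auto simp: fdelta_def\<close>)
  then show "fpush F f z = lin (\<lambda>x. fdelta (F x)) f z"
    by (simp add: lin_def sum_fun_apply of_int_fun_apply times_fun_apply)
qed

section \<open>The tensor products as subsets of a ring type\<close>

definition tqrel :: "(steinitz \<Rightarrow> 'r::ring_1 \<times> complex \<Rightarrow> int) \<Rightarrow> (steinitz \<Rightarrow> 'r \<times> complex \<Rightarrow> int) \<Rightarrow> bool" where
  "tqrel f g \<longleftrightarrow> (\<forall>e. f e \<in> fsums (ZMu e) \<and> g e \<in> fsums (ZMu e) \<and> teq (ZMu e) (f e) (g e))"

text \<open>The carriers of the tensor products depend on the term e, so no single one of them is a type. Their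
  product over all e is, and its ring structure restricts to each factor.\<close>

quotient_type (overloaded) 'r tq = "steinitz \<Rightarrow> 'r::ring_1 \<times> complex \<Rightarrow> int" / partial: tqrel
proof (rule part_equivpI)
  show "\<exists>f::steinitz \<Rightarrow> 'r \<times> complex \<Rightarrow> int. tqrel f f"
    by (rule exI[of _ "\<lambda>_. 0"]) (simp add: tqrel_def)
  show "symp tqrel" by (auto simp: symp_def tqrel_def intro: teq_sym)
  show "transp tqrel" unfolding transp_def tqrel_def by (blast intro: teq_trans)
qed

lemma trel_fsums_ZMu: "t \<in> trel (ZMu e) \<Longrightarrow> t \<in> fsums (ZMu e)"
  unfolding ZMu_eq_zspan by (rule trel_fsums)

lemma fmul_fsums_ZMu: "f \<in> fsums (ZMu e) \<Longrightarrow> g \<in> fsums (ZMu e) \<Longrightarrow> fmul f g \<in> fsums (ZMu e)"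
  by (rule fmul_fsums[OF ZMu_mult])

lemma teq_fmul:
  fixes f f' g g' :: "'r::ring_1 \<times> complex \<Rightarrow> int"
  assumes fs: "f \<in> fsums (ZMu e)" "f' \<in> fsums (ZMu e)" "g \<in> fsums (ZMu e)" "g' \<in> fsums (ZMu e)"
    and t: "teq (ZMu e) f f'" "teq (ZMu e) g g'"
  shows "teq (ZMu e) (fmul f g) (fmul f' g')"
proof -
  have "fmul f g - fmul f' g' = fmul (f - f') g + fmul f' (g - g')"
    using fs by (simp add: fmul_distribs fsums_fsupp)
  then show ?thesis using trel_fmul[OF refl t(1) fs(3)] trel_fmul[OF refl t(2) fs(2)] by (simp add: trel_add)
qed

instantiation tq :: (ring_1) ring
begin

lift_definition zero_tq :: "'a tq" is "\<lambda>_. 0"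
  by (simp add: tqrel_def)

lift_definition plus_tq :: "'a tq \<Rightarrow> 'a tq \<Rightarrow> 'a tq" is "\<lambda>f g e. f e + g e"
  by (auto simp: tqrel_def intro: fsums_add teq_add)

lift_definition minus_tq :: "'a tq \<Rightarrow> 'a tq \<Rightarrow> 'a tq" is "\<lambda>f g e. f e - g e"
  by (auto simp: tqrel_def intro: fsums_diff teq_diff)

lift_definition uminus_tq :: "'a tq \<Rightarrow> 'a tq" is "\<lambda>f e. - f e"
proof -
  fix f g :: "steinitz \<Rightarrow> 'a \<times> complex \<Rightarrow> int" assume *: "tqrel f g"
  have "teq (ZMu e) (g e) (f e)" for e by (rule teq_sym) (use * in \<open>simp add: tqrel_def\<close>)
  then show "tqrel (\<lambda>e. - f e) (\<lambda>e. - g e)" using * by (simp add: tqrel_def fsums_uminus)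
qed

lift_definition times_tq :: "'a tq \<Rightarrow> 'a tq \<Rightarrow> 'a tq" is "\<lambda>f g e. fmul (f e) (g e)"
proof -
  fix f f' g g' :: "steinitz \<Rightarrow> 'a \<times> complex \<Rightarrow> int" assume *: "tqrel f f'" "tqrel g g'"
  have "teq (ZMu e) (fmul (f e) (g e)) (fmul (f' e) (g' e))" for e
    by (rule teq_fmul) (use * in \<open>simp_all add: tqrel_def\<close>)
  moreover have "fmul (f e) (g e) \<in> fsums (ZMu e)" "fmul (f' e) (g' e) \<in> fsums (ZMu e)" for e
    by (rule fmul_fsums_ZMu; use * in \<open>simp add: tqrel_def\<close>)+
  ultimately show "tqrel (\<lambda>e. fmul (f e) (g e)) (\<lambda>e. fmul (f' e) (g' e))"
    unfolding tqrel_def by blast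
qed

instance
proof
  fix a b c :: "'a tq"
  show "a + b + c = a + (b + c)"
  proof transfer
    fix a b c :: "steinitz \<Rightarrow> 'a \<times> complex \<Rightarrow> int"
    assume *: "tqrel a a" "tqrel b b" "tqrel c c"
    show "tqrel (\<lambda>e. a e + b e + c e) (\<lambda>e. a e + (b e + c e))"
      unfolding tqrel_def add.assoc using * by (simp add: tqrel_def fsums_add)
  qed
  show "a + b = b + a"
    by transfer (simp add: tqrel_def add.commute fsums_add)
  show "0 + a = a"
    by transfer (auto simp: tqrel_def)
  show "- a + a = 0"
    by transfer (auto simp: tqrel_def)
  show "a - b = a + - b"
    by transfer (simp add: tqrel_def fsums_add fsums_diff fsums_uminus)
  show "a * b * c = a * (b * c)"
  proof transfer
    fix a b c :: "steinitz \<Rightarrow> 'a \<times> complex \<Rightarrow> int"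
    assume *: "tqrel a a" "tqrel b b" "tqrel c c"
    have "fmul (fmul (a e) (b e)) (c e) = fmul (a e) (fmul (b e) (c e))" for e
      by (rule fmul_assoc) (use * fsums_mono[of "ZMu e" UNIV] in \<open>auto simp: tqrel_def\<close>)
    then show "tqrel (\<lambda>e. fmul (fmul (a e) (b e)) (c e)) (\<lambda>e. fmul (a e) (fmul (b e) (c e)))"
      using * by (simp add: tqrel_def fmul_fsums_ZMu)
  qed
  show "(a + b) * c = a * c + b * c"
  proof transfer
    fix a b c :: "steinitz \<Rightarrow> 'a \<times> complex \<Rightarrow> int"
    assume "tqrel a a" "tqrel b b" "tqrel c c"
    then have *: "a e \<in> fsums (ZMu e)" "b e \<in> fsums (ZMu e)" "c e \<in> fsums (ZMu e)" for e
      by (simp_all add: tqrel_def)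
    have "fmul (a e + b e) (c e) = fmul (a e) (c e) + fmul (b e) (c e)" for e
      by (rule fmul_add_left) (rule fsums_fsupp, rule *)+
    then show "tqrel (\<lambda>e. fmul (a e + b e) (c e)) (\<lambda>e. fmul (a e) (c e) + fmul (b e) (c e))"
      using * by (simp add: tqrel_def fmul_fsums_ZMu fsums_add)
  qed
  show "a * (b + c) = a * b + a * c"
  proof transfer
    fix a b c :: "steinitz \<Rightarrow> 'a \<times> complex \<Rightarrow> int"
    assume "tqrel a a" "tqrel b b" "tqrel c c"
    then have *: "a e \<in> fsums (ZMu e)" "b e \<in> fsums (ZMu e)" "c e \<in> fsums (ZMu e)" for e
      by (simp_all add: tqrel_def)
    have "fmul (a e) (b e + c e) = fmul (a e) (b e) + fmul (a e) (c e)" for e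
      by (rule fmul_add_right) (rule fsums_fsupp, rule *)+
    then show "tqrel (\<lambda>e. fmul (a e) (b e + c e)) (\<lambda>e. fmul (a e) (b e) + fmul (a e) (c e))"
      using * by (simp add: tqrel_def fmul_fsums_ZMu fsums_add)
  qed
qed

end

text \<open>The factor belonging to \<open>e\<close> inside the product: all other components are 0,
  and so is the value on formal sums with right entries outside Z[mu_e]. Multiplicative identity on
  this factor is the image of 1 \<otimes> 1, not the unit of the whole product.\<close>

lift_definition tfac :: "steinitz \<Rightarrow> ('r::ring_1 \<times> complex \<Rightarrow> int) \<Rightarrow> 'r tq"
  is "\<lambda>e f e'. if e' = e \<and> f \<in> fsums (ZMu e) then f else 0"
  by (simp add: tqrel_def)

lemma tfac_eq_iff:
  "f \<in> fsums (ZMu e) \<Longrightarrow> g \<in> fsums (ZMu e) \<Longrightarrow> tfac e f = tfac e g \<longleftrightarrow> teq (ZMu e) f g"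
  by transfer (auto simp: tqrel_def)

lemma tfac_add: "f \<in> fsums (ZMu e) \<Longrightarrow> g \<in> fsums (ZMu e) \<Longrightarrow> tfac e (f + g) = tfac e f + tfac e g"
  by transfer (simp add: tqrel_def fsums_add)

lemma tfac_diff: "f \<in> fsums (ZMu e) \<Longrightarrow> g \<in> fsums (ZMu e) \<Longrightarrow> tfac e (f - g) = tfac e f - tfac e g"
  by transfer (simp add: tqrel_def fsums_diff)

lemma tfac_zero [simp]: "tfac e 0 = 0"
  by transfer (auto simp: tqrel_def)

lemma tfac_mult: "f \<in> fsums (ZMu e) \<Longrightarrow> g \<in> fsums (ZMu e) \<Longrightarrow> tfac e (fmul f g) = tfac e f * tfac e g"
  by transfer (simp add: tqrel_def fmul_zero_left fmul_fsums_ZMu)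

lemma tfac_sum: "(\<And>i. i \<in> I \<Longrightarrow> f i \<in> fsums (ZMu e)) \<Longrightarrow> tfac e (sum f I) = (\<Sum>i\<in>I. tfac e (f i))"
  by (induction I rule: infinite_finite_induct) (auto simp: tfac_add fsums_sum)

definition tqcarrier :: "steinitz \<Rightarrow> 'r::ring_1 tq set" where
  "tqcarrier e = tfac e ` fsums (ZMu e)"

definition tp :: "steinitz \<Rightarrow> 'r::ring_1 \<Rightarrow> complex \<Rightarrow> 'r tq" where
  "tp e r u = tfac e (fdelta (r, u))"

lemma tp_tqcarrier: "u \<in> ZMu e \<Longrightarrow> tp e r u \<in> tqcarrier e"
  by (auto simp: tp_def tqcarrier_def)

lemma tqcarrier_zero [simp]: "0 \<in> tqcarrier e"
  unfolding tqcarrier_def by (rule image_eqI[of _ _ 0]) auto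

lemma tqcarrier_add: "x \<in> tqcarrier e \<Longrightarrow> y \<in> tqcarrier e \<Longrightarrow> x + y \<in> tqcarrier e"
  by (auto simp: tqcarrier_def tfac_add[symmetric] intro: fsums_add)

lemma tqcarrier_diff: "x \<in> tqcarrier e \<Longrightarrow> y \<in> tqcarrier e \<Longrightarrow> x - y \<in> tqcarrier e"
  by (auto simp: tqcarrier_def tfac_diff[symmetric] intro: fsums_diff)

lemma tqcarrier_mult: "x \<in> tqcarrier e \<Longrightarrow> y \<in> tqcarrier e \<Longrightarrow> x * y \<in> tqcarrier e"
  by (auto simp: tqcarrier_def tfac_mult[symmetric] intro: fmul_fsums_ZMu)

lemma tqcarrier_sum: "(\<And>i. i \<in> I \<Longrightarrow> f i \<in> tqcarrier e) \<Longrightarrow> sum f I \<in> tqcarrier e"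
  by (induction I rule: infinite_finite_induct) (auto intro: tqcarrier_add)

lemma tp_add_left: "u \<in> ZMu e \<Longrightarrow> tp e (r + s) u = tp e r u + tp e s u"
  unfolding tp_def by (subst tfac_add[symmetric]) (auto simp: tfac_eq_iff fsums_add teq_fdelta_add_left)

lemma tp_add_right: "u \<in> ZMu e \<Longrightarrow> v \<in> ZMu e \<Longrightarrow> tp e r (u + v) = tp e r u + tp e r v"
  unfolding tp_def by (subst tfac_add[symmetric]) (auto simp: tfac_eq_iff fsums_add ZMu_add teq_fdelta_add_right)

lemma tp_mult: "u \<in> ZMu e \<Longrightarrow> v \<in> ZMu e \<Longrightarrow> tp e r u * tp e s v = tp e (r * s) (u * v)"
  unfolding tp_def by (subst tfac_mult[symmetric]) (auto simp: fmul_fdelta)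

lemma tp_zero_left: "u \<in> ZMu e \<Longrightarrow> tp e 0 u = 0"
  using tp_add_left[of u e 0 0] by simp

lemma tp_zero_right: "tp e r 0 = 0"
  using tp_add_right[of 0 e 0 r] by simp

lemma tp_minus_left: "u \<in> ZMu e \<Longrightarrow> tp e (- r) u = - tp e r u"
  using tp_add_left[of u e "- r" r] by (simp add: tp_zero_left add_eq_0_iff2)

lemma tp_sum_left: "u \<in> ZMu e \<Longrightarrow> tp e (sum f I) u = (\<Sum>i\<in>I. tp e (f i) u)"
  by (induction I rule: infinite_finite_induct) (auto simp: tp_zero_left tp_add_left)

lemma tp_sum_right: "(\<And>i. i \<in> I \<Longrightarrow> f i \<in> ZMu e) \<Longrightarrow> tp e r (sum f I) = (\<Sum>i\<in>I. tp e r (f i))"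
  by (induction I rule: infinite_finite_induct) (auto simp: tp_zero_right tp_add_right ZMu_sum)

lemma tqcarrier_induct [consumes 1, case_names zero add]:
  assumes "x \<in> tqcarrier e" and "P 0"
    and add: "\<And>x r u. x \<in> tqcarrier e \<Longrightarrow> P x \<Longrightarrow> u \<in> ZMu e \<Longrightarrow> P (x + tp e r u)"
  shows "P x"
proof -
  obtain f where f: "f \<in> fsums (ZMu e)" "x = tfac e f" using assms(1) by (auto simp: tqcarrier_def)
  have "P (tfac e f)"
    using f(1)
  proof (induction rule: fsums_induct)
    case zero show ?case using assms(2) by simp
  next
    case (add f r u)
    then show ?case using assms(3)[of "tfac e f" u r] by (simp add: tqcarrier_def tfac_add tp_def[symmetric])
  next
    case (diff f r u)
    then show ?case using assms(3)[of "tfac e f" u "- r"]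
      by (simp add: tqcarrier_def tfac_diff tp_minus_left tp_def[symmetric])
  qed
  then show ?thesis using f by simp
qed

text \<open>Signs can be moved into the left entry, so the sums of r \<otimes> w with w a root of
  unity exhaust the carrier. Traces and Galois conjugates are explicit on such elements.\<close>

lemma tqcarrier_mu_induct [consumes 1, case_names zero add]:
  assumes "x \<in> tqcarrier e" and "P 0"
    and add: "\<And>x r w. x \<in> tqcarrier e \<Longrightarrow> P x \<Longrightarrow> w \<in> mu e \<Longrightarrow> P (x + tp e r w)"
  shows "P x"
  using assms(1)
proof (induction rule: tqcarrier_induct)
  case (add x r u)
  from add(2) show ?case
    unfolding ZMu_eq_zspan
  proof (induction rule: zspan.induct)
    case zspan_zero
    show ?case using add(3) by (simp add: tp_zero_right)
  next
    case (zspan_add_gen u w)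
    then show ?case using assms(3)[of "x + tp e r u" w r] add(1)
      by (simp add: ZMu_eq_zspan[symmetric] ZMu_mu tqcarrier_add tp_tqcarrier tp_add_right add.assoc)
  next
    case (zspan_diff_gen u w)
    then have u: "u \<in> ZMu e" "w \<in> ZMu e" by (auto simp: ZMu_eq_zspan[symmetric] ZMu_mu)
    have "tp e r (u - w) = tp e r u - tp e r w"
      using tp_add_right[of "u - w" e w r] u by (simp add: ZMu_diff)
    then show ?case using assms(3)[of "x + tp e r u" w "- r"] add(1) u zspan_diff_gen
      by (simp add: tqcarrier_add tp_tqcarrier tp_minus_left add_diff_eq)
  qed
qed (fact assms(2))

lemma tp_of_int: "tp e r (of_int k) = tp e (of_int k * r) 1"
  using teq_fdelta_of_int[of 1 "mu e" r k]
  by (simp add: tp_def tfac_eq_iff ZMu_eq_zspan[symmetric])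

definition act :: "steinitz \<Rightarrow> complex \<Rightarrow> 'r::ring_1 tq \<Rightarrow> 'r tq" where
  "act e u x = tp e 1 u * x"

lemma act_tqcarrier: "u \<in> ZMu e \<Longrightarrow> x \<in> tqcarrier e \<Longrightarrow> act e u x \<in> tqcarrier e"
  by (simp add: act_def tqcarrier_mult tp_tqcarrier)

lemma act_add: "act e u (x + y) = act e u x + act e u y"
  by (simp add: act_def ring_distribs)

lemma act_zero [simp]: "act e u 0 = 0"
  by (simp add: act_def)

lemma act_sum: "act e u (sum f I) = (\<Sum>i\<in>I. act e u (f i))"
  by (simp add: act_def sum_distrib_left)

lemma act_add_left: "u \<in> ZMu e \<Longrightarrow> v \<in> ZMu e \<Longrightarrow> act e (u + v) x = act e u x + act e v x"
  by (simp add: act_def tp_add_right ring_distribs)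

lemma act_diff_left: "u \<in> ZMu e \<Longrightarrow> v \<in> ZMu e \<Longrightarrow> act e (u - v) x = act e u x - act e v x"
  using act_add_left[of "u - v" e v x] by (simp add: ZMu_diff)

lemma act_sum_left: "(\<And>i. i \<in> I \<Longrightarrow> f i \<in> ZMu e) \<Longrightarrow> act e (sum f I) x = (\<Sum>i\<in>I. act e (f i) x)"
  by (simp add: act_def tp_sum_right sum_distrib_right)

lemma act_act: "u \<in> ZMu e \<Longrightarrow> v \<in> ZMu e \<Longrightarrow> act e u (act e v x) = act e (u * v) x"
  by (simp add: act_def mult.assoc[symmetric] tp_mult)

lemma act_tp: "u \<in> ZMu e \<Longrightarrow> v \<in> ZMu e \<Longrightarrow> act e u (tp e r v) = tp e r (u * v)"
  by (simp add: act_def tp_mult)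

lemma act_one: "x \<in> tqcarrier e \<Longrightarrow> act e 1 x = x"
  by (induction rule: tqcarrier_induct) (auto simp: act_add act_tp)

text \<open>Although R need not be commutative, 1 \<otimes> v commutes with every element, since the
  right entries are complex numbers.\<close>

lemma act_mult:
  assumes "u \<in> ZMu e" "v \<in> ZMu e" "x \<in> tqcarrier e"
  shows "act e u x * act e v y = act e (u * v) (x * y)"
proof -
  have "x * tp e 1 v = tp e 1 v * x"
    using assms(3) by (induction rule: tqcarrier_induct) (auto simp: ring_distribs tp_mult assms mult.commute)
  then have "tp e 1 u * x * (tp e 1 v * y) = tp e 1 u * (tp e 1 v * x) * y"
    by (simp add: mult.assoc[symmetric]) (simp add: mult.assoc)
  then show ?thesis using assms by (simp add: act_def mult.assoc[symmetric] tp_mult)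
qed

lemma act_of_nat_tfac:
  "f \<in> fsums (ZMu e) \<Longrightarrow> act e (of_nat n) (tfac e f) = tfac e (of_nat n * f)"
proof (induction n)
  case 0 show ?case by (simp add: act_def tp_zero_right del: times_fun_apply of_nat_fun_apply)
next
  case (Suc n)
  have "act e (of_nat (Suc n)) (tfac e f) = act e 1 (tfac e f) + act e (of_nat n) (tfac e f)"
    by (subst act_add_left[symmetric]) auto
  then show ?case using Suc by (simp add: act_one tqcarrier_def ring_distribs tfac_add fsums_of_nat
      del: times_fun_apply of_nat_fun_apply)
qed

lemma act_of_nat_eq_zero:
  assumes "x \<in> tqcarrier e" "act e (of_nat n) x = (0 :: 'r::ring_1 tq)" "\<And>r::'r. of_nat n * r = 0 \<Longrightarrow> r = 0"
  shows "x = 0"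
proof -
  obtain f where f: "f \<in> fsums (ZMu e)" "x = tfac e f" using assms(1) by (auto simp: tqcarrier_def)
  have "tfac e (of_nat n * f) = tfac e 0" using assms(2) f by (simp add: act_of_nat_tfac)
  then have "of_nat n * f \<in> trel (ZMu e)" using f by (subst (asm) tfac_eq_iff) (auto intro: fsums_of_nat)
  then have "f \<in> trel (ZMu e)" using trel_torsion_free[OF f(1)[unfolded ZMu_eq_zspan]] assms(3) unfolding ZMu_eq_zspan by blast
  then have "tfac e f = tfac e 0" using f by (subst tfac_eq_iff) auto
  with f show ?thesis by simp
qed

lemma tp_eq_act_of_nat:
  assumes "y \<in> tqcarrier e" "tp e s 1 = act e (of_nat n) y"
  shows "\<exists>t. s = of_nat n * t"
proof -
  obtain f where f: "f \<in> fsums (ZMu e)" "y = tfac e f" using assms(1) by (auto simp: tqcarrier_def)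
  have "tfac e (fdelta (s, 1)) = tfac e (of_nat n * f)" using assms(2) f by (simp add: act_of_nat_tfac tp_def)
  then have "fdelta (s, 1) - of_nat n * f \<in> trel (ZMu e)"
    using f by (subst (asm) tfac_eq_iff) (auto intro: fsums_of_nat)
  then show ?thesis by (rule trel_pure[OF f(1)])
qed

text \<open>The case n = 0 of the divisibility statement; it says that R embeds in the tensor
  product.\<close>

lemma tp_one_eq_zero: "tp e s 1 = 0 \<Longrightarrow> s = 0"
  using tp_eq_act_of_nat[of 0 e s 0] by simp

lemma tp_one_inject: "tp e r 1 = tp e s 1 \<Longrightarrow> r = s"
  using tp_one_eq_zero[of e "r - s"] tp_add_left[of 1 e "r - s" s] by simp

section \<open>The carrier of the tensor product and Galois descent\<close>

lemma tclass_eq_iff: "tclass B f = tclass B g \<longleftrightarrow> teq B f g"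
proof
  assume "tclass B f = tclass B g"
  moreover have "f \<in> tclass B f" by (simp add: tclass_def)
  ultimately show "teq B f g" by (simp add: tclass_def)
next
  assume *: "teq B f g"
  show "tclass B f = tclass B g"
    unfolding tclass_def using teq_trans[OF _ *] teq_trans[OF _ teq_sym[OF *]] by blast
qed

text \<open>Classes are formed among all integer-valued functions, but relations are themselves
  formal sums over Z[mu_e]; so every member of the class of such a sum is again one.\<close>

lemma trep_tclass:
  assumes "f \<in> fsums (ZMu e)"
  shows "trep (tclass (ZMu e) f) \<in> fsums (ZMu e)" "teq (ZMu e) (trep (tclass (ZMu e) f)) f"
proof -
  have "f \<in> tclass (ZMu e) f" by (simp add: tclass_def)
  then have "trep (tclass (ZMu e) f) \<in> tclass (ZMu e) f" unfolding trep_def by (rule someI[of "\<lambda>g. g \<in> tclass (ZMu e) f"])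
  then show t: "teq (ZMu e) (trep (tclass (ZMu e) f)) f" by (simp add: tclass_def)
  from fsums_add[OF trel_fsums_ZMu[OF t] assms] show "trep (tclass (ZMu e) f) \<in> fsums (ZMu e)" by simp
qed

text \<open>The bridge from the classes of formal sums to the ring type. Identities involving
  \<open>tadd\<close>, \<open>tmul\<close> and \<open>tsum\<close> are proved by applying it and
  computing in a ring.\<close>

definition iota :: "steinitz \<Rightarrow> 'r::ring_1 tens \<Rightarrow> 'r tq" where
  "iota e X = tfac e (trep X)"

abbreviation tinv :: "steinitz \<Rightarrow> 'r::ring_1 tq \<Rightarrow> 'r tens" where
  "tinv e \<equiv> inv_into (tcarrier (ZMu e)) (iota e)"

lemma tcarrierE:
  assumes "X \<in> tcarrier (ZMu e)"
  obtains f where "f \<in> fsums (ZMu e)" "X = tclass (ZMu e) f"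
  using assms by (auto simp: tcarrier_def)

lemma tclass_tcarrier: "f \<in> fsums B \<Longrightarrow> tclass B f \<in> tcarrier B"
  by (simp add: tcarrier_def)

lemma trep_fsums: "X \<in> tcarrier (ZMu e) \<Longrightarrow> trep X \<in> fsums (ZMu e)"
  by (auto simp: tcarrier_def trep_tclass)

lemma iota_tclass: "f \<in> fsums (ZMu e) \<Longrightarrow> iota e (tclass (ZMu e) f) = tfac e f"
  by (simp add: iota_def tfac_eq_iff trep_tclass)

lemma iota_bij: "bij_betw (iota e) (tcarrier (ZMu e)) (tqcarrier e)"
proof -
  have "iota e ` tcarrier (ZMu e) = tqcarrier e"
    by (auto simp: tcarrier_def tqcarrier_def iota_tclass image_iff)
  moreover have "inj_on (iota e) (tcarrier (ZMu e))"
    by (rule inj_onI, (erule tcarrierE)+) (simp add: iota_tclass tfac_eq_iff tclass_eq_iff)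
  ultimately show ?thesis by (simp add: bij_betw_def)
qed

lemma iota_tqcarrier: "X \<in> tcarrier (ZMu e) \<Longrightarrow> iota e X \<in> tqcarrier e"
  using iota_bij bij_betwE by blast

lemma iota_inject: "X \<in> tcarrier (ZMu e) \<Longrightarrow> Y \<in> tcarrier (ZMu e) \<Longrightarrow> iota e X = iota e Y \<longleftrightarrow> X = Y"
  using iota_bij inj_onD unfolding bij_betw_def by fastforce

lemma iota_eqI:
  "X \<in> tcarrier (ZMu e) \<Longrightarrow> Y \<in> tcarrier (ZMu e) \<Longrightarrow> iota e X = iota e Y \<Longrightarrow> X = Y"
  by (simp add: iota_inject)

lemma tinv_tcarrier: "x \<in> tqcarrier e \<Longrightarrow> tinv e x \<in> tcarrier (ZMu e)"
  using bij_betw_imp_surj_on[OF iota_bij] by (metis inv_into_into)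

lemma iota_tinv: "x \<in> tqcarrier e \<Longrightarrow> iota e (tinv e x) = x"
  using bij_betw_inv_into_right[OF iota_bij] .

lemma tinv_iota: "X \<in> tcarrier (ZMu e) \<Longrightarrow> tinv e (iota e X) = X"
  using bij_betw_inv_into_left[OF iota_bij] .

lemma tzero_tcarrier [simp]: "tzero B \<in> tcarrier B"
  by (simp add: tzero_def tclass_tcarrier)

lemma iota_tzero [simp]: "iota e (tzero (ZMu e)) = 0"
  by (simp add: tzero_def iota_tclass)

lemma iota_eq_zero: "X \<in> tcarrier (ZMu e) \<Longrightarrow> iota e X = 0 \<longleftrightarrow> X = tzero (ZMu e)"
  using iota_inject[of X e "tzero (ZMu e)"] by simp

lemma tpure_tcarrier: "u \<in> B \<Longrightarrow> tpure B r u \<in> tcarrier B"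
  by (simp add: tpure_def tclass_tcarrier)

lemma iota_tpure: "u \<in> ZMu e \<Longrightarrow> iota e (tpure (ZMu e) r u) = tp e r u"
  by (simp add: tpure_def iota_tclass tp_def)

lemma tadd_tcarrier: "X \<in> tcarrier (ZMu e) \<Longrightarrow> Y \<in> tcarrier (ZMu e) \<Longrightarrow> tadd (ZMu e) X Y \<in> tcarrier (ZMu e)"
  unfolding tadd_def by (intro tclass_tcarrier fsums_add trep_fsums)

lemma iota_tadd: "X \<in> tcarrier (ZMu e) \<Longrightarrow> Y \<in> tcarrier (ZMu e) \<Longrightarrow> iota e (tadd (ZMu e) X Y) = iota e X + iota e Y"
  by (simp add: tadd_def iota_tclass fsums_add trep_fsums tfac_add iota_def[symmetric])

lemma tmul_tcarrier: "X \<in> tcarrier (ZMu e) \<Longrightarrow> Y \<in> tcarrier (ZMu e) \<Longrightarrow> tmul (ZMu e) X Y \<in> tcarrier (ZMu e)"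
  unfolding tmul_def by (intro tclass_tcarrier fmul_fsums_ZMu trep_fsums)

lemma iota_tmul: "X \<in> tcarrier (ZMu e) \<Longrightarrow> Y \<in> tcarrier (ZMu e) \<Longrightarrow> iota e (tmul (ZMu e) X Y) = iota e X * iota e Y"
  by (simp add: tmul_def iota_tclass fmul_fsums_ZMu trep_fsums tfac_mult iota_def[symmetric])

lemma tsum_tcarrier: "(\<And>i. i \<in> I \<Longrightarrow> g i \<in> tcarrier (ZMu e)) \<Longrightarrow> tsum (ZMu e) g I \<in> tcarrier (ZMu e)"
  unfolding tsum_def by (intro tclass_tcarrier fsums_sum trep_fsums)

lemma iota_tsum:
  assumes "\<And>i. i \<in> I \<Longrightarrow> g i \<in> tcarrier (ZMu e)"
  shows "iota e (tsum (ZMu e) g I) = (\<Sum>i\<in>I. iota e (g i))"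
proof -
  have "iota e (tsum (ZMu e) g I) = tfac e (\<Sum>i\<in>I. trep (g i))"
    unfolding tsum_def by (intro iota_tclass fsums_sum trep_fsums assms)
  also have "\<dots> = (\<Sum>i\<in>I. iota e (g i))" unfolding iota_def by (intro tfac_sum trep_fsums assms)
  finally show ?thesis .
qed

section \<open>Tensor products of additive maps\<close>

lemma fpush_add: "fsupp f \<Longrightarrow> fsupp g \<Longrightarrow> fpush F (f + g) = fpush F f + fpush F g"
  by (simp add: fpush_eq_lin lin_add fsupp_add)

lemma fpush_diff: "fsupp f \<Longrightarrow> fsupp g \<Longrightarrow> fpush F (f - g) = fpush F f - fpush F g"
  by (simp add: fpush_eq_lin lin_diff fsupp_diff)

lemma fpush_fdelta: "fpush F (fdelta x) = fdelta (F x)"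
  by (simp add: fpush_eq_lin)

lemma fpush_zero: "fpush F 0 = 0"
  by (simp add: fpush_eq_lin)

lemma fpush_fsums:
  assumes "\<And>u. u \<in> B \<Longrightarrow> g u \<in> B" "f \<in> fsums B"
  shows "fpush (\<lambda>(a, b). (h a, g b)) f \<in> fsums B"
  using assms(2)
  by (induction rule: fsums_induct) (simp_all add: fpush_zero fpush_add fpush_diff fpush_fdelta fsums_fsupp assms(1) fsums_add fsums_diff)

lemma fpush_trel:
  fixes h :: "'a::ab_group_add \<Rightarrow> 'b::ab_group_add"
  assumes h: "\<And>a a'. h (a + a') = h a + h a'"
    and g: "\<And>u. u \<in> ZMu e \<Longrightarrow> g u \<in> ZMu e" "\<And>u v. u \<in> ZMu e \<Longrightarrow> v \<in> ZMu e \<Longrightarrow> g (u + v) = g u + g v"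
    and t: "t \<in> trel (ZMu e)"
  shows "fpush (\<lambda>(a, b). (h a, g b)) t \<in> trel (ZMu e)"
proof -
  have "fsupp t \<and> fpush (\<lambda>(a, b). (h a, g b)) t \<in> trel (ZMu e)"
    using t
  proof (induction rule: trel_induct)
    case (base t)
    then show ?case
      by (auto simp: tgens_def fpush_diff fpush_fdelta fsupp_diff h g intro!: trel_add_left trel_add_right)
  next
    case (diff s t)
    then show ?case by (auto simp: fpush_diff fsupp_diff trel_diff)
  qed (simp add: fpush_zero)
  then show ?thesis ..
qed

text \<open>The map h \<otimes> g, evaluated on a chosen formal sum. It is independent of the choice
  once h is additive and g is additive on Z[mu_e] and preserves it, as the following context
  assumes.\<close>

definition tmap :: "steinitz \<Rightarrow> ('a \<Rightarrow> 'b) \<Rightarrow> (complex \<Rightarrow> complex) \<Rightarrow> 'a::ring_1 tq \<Rightarrow> 'b::ring_1 tq" where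
  "tmap e h g x = tfac e (fpush (\<lambda>(a, b). (h a, g b)) (SOME f. f \<in> fsums (ZMu e) \<and> tfac e f = x))"

context
  fixes e :: steinitz and h :: "'a::ring_1 \<Rightarrow> 'b::ring_1" and g :: "complex \<Rightarrow> complex"
  assumes h: "\<And>a a'. h (a + a') = h a + h a'"
    and g: "\<And>u. u \<in> ZMu e \<Longrightarrow> g u \<in> ZMu e" "\<And>u v. u \<in> ZMu e \<Longrightarrow> v \<in> ZMu e \<Longrightarrow> g (u + v) = g u + g v"
begin

lemma tmap_tfac:
  assumes f: "f \<in> fsums (ZMu e)"
  shows "tmap e h g (tfac e f) = tfac e (fpush (\<lambda>(a, b). (h a, g b)) f)"
proof -
  define f' where "f' = (SOME f'. f' \<in> fsums (ZMu e) \<and> tfac e f' = tfac e f)"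
  have "f' \<in> fsums (ZMu e) \<and> tfac e f' = tfac e f"
    unfolding f'_def by (rule someI[of _ f]) (use f in simp)
  then have f': "f' \<in> fsums (ZMu e)" "teq (ZMu e) f' f" using f by (auto simp: tfac_eq_iff)
  from fpush_trel[OF h g f'(2)]
  have "teq (ZMu e) (fpush (\<lambda>(a, b). (h a, g b)) f') (fpush (\<lambda>(a, b). (h a, g b)) f)"
    using f f' by (simp add: fpush_diff fsums_fsupp)
  then show ?thesis
    unfolding tmap_def f'_def[symmetric] using f f'(1) g(1) by (simp add: tfac_eq_iff fpush_fsums)
qed

lemma tmap_tp: "u \<in> ZMu e \<Longrightarrow> tmap e h g (tp e r u) = tp e (h r) (g u)"
  by (simp add: tp_def tmap_tfac fpush_fdelta)

lemma tmap_zero: "tmap e h g 0 = 0"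
  using tmap_tfac[of 0] by (simp add: fpush_zero)

lemma tmap_add: "x \<in> tqcarrier e \<Longrightarrow> y \<in> tqcarrier e \<Longrightarrow> tmap e h g (x + y) = tmap e h g x + tmap e h g y"
  using g(1) by (auto simp: tqcarrier_def tfac_add[symmetric] tmap_tfac fsums_add fpush_fsums fpush_add fsums_fsupp)

lemma tmap_tqcarrier: "x \<in> tqcarrier e \<Longrightarrow> tmap e h g x \<in> tqcarrier e"
  using g(1) by (auto simp: tqcarrier_def tmap_tfac fpush_fsums)

lemma tmap_sum: "(\<And>i. i \<in> I \<Longrightarrow> f i \<in> tqcarrier e) \<Longrightarrow> tmap e h g (sum f I) = (\<Sum>i\<in>I. tmap e h g (f i))"
  by (induction I rule: infinite_finite_induct) (auto simp: tmap_zero tmap_add tqcarrier_sum)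

end

lemma tmapL_iota:
  fixes h :: "'a::ring_1 \<Rightarrow> 'b::ring_1"
  assumes h: "\<And>a a'. h (a + a') = h a + h a'" and X: "X \<in> tcarrier (ZMu e)"
  shows "tmapL (ZMu e) h X \<in> tcarrier (ZMu e)" "iota e (tmapL (ZMu e) h X) = tmap e h (\<lambda>u. u) (iota e X)"
proof -
  have F: "fpush (\<lambda>(a, b). (h a, b)) (trep X) \<in> fsums (ZMu e)"
    using fpush_fsums[of "ZMu e" "\<lambda>u. u" "trep X" h] trep_fsums[OF X] by simp
  then show "tmapL (ZMu e) h X \<in> tcarrier (ZMu e)" by (simp add: tmapL_def tclass_tcarrier)
  show "iota e (tmapL (ZMu e) h X) = tmap e h (\<lambda>u. u) (iota e X)"
    using F trep_fsums[OF X] h by (simp add: tmapL_def iota_tclass iota_def[of e X] tmap_tfac)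
qed

lemma tmapR_iota:
  fixes X :: "'r::ring_1 tens"
  assumes g: "\<And>u. u \<in> ZMu e \<Longrightarrow> g u \<in> ZMu e" "\<And>u v. u \<in> ZMu e \<Longrightarrow> v \<in> ZMu e \<Longrightarrow> g (u + v) = g u + g v"
    and X: "X \<in> tcarrier (ZMu e)"
  shows "tmapR (ZMu e) g X \<in> tcarrier (ZMu e)" "iota e (tmapR (ZMu e) g X) = tmap e (\<lambda>r. r) g (iota e X)"
proof -
  have F: "fpush (\<lambda>(a, b). (a, g b)) (trep X) \<in> fsums (ZMu e)"
    using fpush_fsums[of "ZMu e" g "trep X" "\<lambda>r. r"] trep_fsums[OF X] g by simp
  then show "tmapR (ZMu e) g X \<in> tcarrier (ZMu e)" by (simp add: tmapR_def tclass_tcarrier)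
  show "iota e (tmapR (ZMu e) g X) = tmap e (\<lambda>r. r) g (iota e X)"
    using F trep_fsums[OF X] g by (simp add: tmapR_def iota_tclass iota_def[of e X] tmap_tfac)
qed

text \<open>Abel summation leaves n * w^n minus a multiple of the geometric sum, which vanishes for
  w different from 1. The explicit cofactor makes w - 1 a divisor of n in the ring generated by
  w.\<close>

lemma root_minus_one_dvd:
  assumes "w ^ n = (1::complex)" "w \<noteq> 1" "n > 0"
  shows "(\<Sum>j<n. of_nat j * w ^ j) * (w - 1) = of_nat n"
proof -
  have "(\<Sum>j<k. of_nat j * w ^ j) * (w - 1) = of_nat k * w ^ k - (\<Sum>j<k. w ^ Suc j)" for k
    by (induction k) (simp_all add: algebra_simps)
  moreover have "(\<Sum>j<n. w ^ Suc j) = w * (\<Sum>j<n. w ^ j)" by (simp add: sum_distrib_left)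
  ultimately show ?thesis using assms sum_powers_root_of_unity[of w n] by simp
qed

lemma act_mu_cancel:
  fixes x :: "'r::ring_1 tq"
  assumes inj: "\<And>d (r::'r). sdvd d e \<Longrightarrow> of_nat d * r = 0 \<Longrightarrow> r = 0"
    and z: "z \<in> mu e" and w: "w \<in> mu e" and x: "x \<in> tqcarrier e" and eq: "act e z x = act e w x" and ne: "z \<noteq> w"
  shows "x = 0"
proof -
  define v where "v = z * inverse w"
  have v: "v \<in> mu e" unfolding v_def by (intro mu_mult mu_inverse z w)
  have "v \<noteq> 1" using ne mu_nonzero[OF w] by (auto simp: v_def field_simps)
  obtain n where n: "sdvd n e" "v ^ n = 1" using v by (rule mu_rootsE)
  \<comment> \<open>The cofactor of v - 1, divided by w because z - w = w (v - 1); thus s * (z - w)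
    = n.\<close>
  define s where "s = (\<Sum>j<n. of_nat j * v ^ j) * inverse w"
  have s: "s \<in> ZMu e" unfolding s_def by (intro ZMu_mult ZMu_sum ZMu_of_nat ZMu_mu mu_power mu_inverse v w)
  have "s * (z - w) = (\<Sum>j<n. of_nat j * v ^ j) * (v - 1)"
    using mu_nonzero[OF w] by (simp add: s_def v_def field_simps)
  also have "\<dots> = of_nat n" by (rule root_minus_one_dvd[OF n(2) \<open>v \<noteq> 1\<close> sdvd_pos[OF n(1)]])
  finally have "act e (of_nat n) x = act e s (act e (z - w) x)"
    using s z w by (simp add: act_act ZMu_diff ZMu_mu)
  also have "\<dots> = 0" using eq z w by (simp add: act_diff_left ZMu_mu)
  finally show ?thesis by (rule act_of_nat_eq_zero[OF x _ inj[OF n(1)]])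
qed

section \<open>Traces of level n and descent to R\<close>

lemma tmap_tau_act:
  assumes a: "a \<in> zhat_units e" and w: "w \<in> mu e" and x: "x \<in> tqcarrier e"
  shows "tmap e (\<lambda>r. r) (tauZ e a) (act e w x) = act e (hpow w a) (tmap e (\<lambda>r. r) (tauZ e a) x)"
  using x
proof (induction rule: tqcarrier_induct)
  note t = tauZ_in_ZMu[OF a] tauZ_spec(3)[OF a]
  case zero show ?case using t by (simp add: tmap_zero)
next
  note t = tauZ_in_ZMu[OF a] tauZ_spec(3)[OF a]
  have hw: "hpow w a \<in> ZMu e" using hpow_mu[OF zhat_units_subset[OF a] w] by (rule ZMu_mu)
  case (add x r u)
  then show ?case using t w hw
    by (simp add: act_add tmap_add act_tqcarrier tp_tqcarrier ZMu_mu act_tp tmap_tp ZMu_mult tauZ_spec(1,4)[OF a])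
qed

text \<open>An arbitrary lift of the residue a modulo n to a profinite unit. On n-th roots of unity
  its action depends on a alone, which is all that a trace of level n needs.\<close>

definition unit_lift :: "steinitz \<Rightarrow> nat \<Rightarrow> nat \<Rightarrow> nat \<Rightarrow> int" where
  "unit_lift e n a = (SOME b. b \<in> zhat_units e \<and> b n = int a)"

lemma unit_lift:
  assumes "sdvd n e" "a < n" "coprime a n"
  shows "unit_lift e n a \<in> zhat_units e" "w ^ n = 1 \<Longrightarrow> hpow w (unit_lift e n a) = w ^ a"
proof -
  have "\<exists>b. b \<in> zhat_units e \<and> b n = int a" using zhat_units_lift[OF assms] by blast
  then have *: "unit_lift e n a \<in> zhat_units e \<and> unit_lift e n a n = int a" unfolding unit_lift_def by (rule someI_ex)
  then show "unit_lift e n a \<in> zhat_units e" ..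
  show "hpow w (unit_lift e n a) = w ^ a" if "w ^ n = 1"
    using hpow_eq[OF zhat_units_subset assms(1) that, of "unit_lift e n a"] * by simp
qed

text \<open>Each unit modulo n contributes one lift. The lifts do not matter on invariant elements
  multiplied by n-th roots of unity, nor on sums of r \<otimes> w with w an n-th root of unity;
  these are the two situations compared below.\<close>

definition trace :: "steinitz \<Rightarrow> nat \<Rightarrow> 'r::ring_1 tq \<Rightarrow> 'r tq" where
  "trace e n x = (\<Sum>a | a < n \<and> coprime a n. tmap e (\<lambda>r. r) (tauZ e (unit_lift e n a)) x)"

lemma trace_add:
  assumes "sdvd n e" "x \<in> tqcarrier e" "y \<in> tqcarrier e"
  shows "trace e n (x + y) = trace e n x + trace e n y"
  unfolding trace_def sum.distrib[symmetric]
  by (intro sum.cong refl tmap_add tauZ_in_ZMu tauZ_spec(3)) (use assms unit_lift in auto)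

text \<open>The conjugates of r \<otimes> w add up to r \<otimes> c with c a Ramanujan sum, and the
  integer c can be moved to the left.\<close>

lemma trace_tp:
  assumes n: "sdvd n e" and w: "w ^ n = 1"
  shows "\<exists>s. trace e n (tp e r w) = tp e s 1"
proof -
  have wm: "w \<in> mu e" using assms by (rule mu_rootsI)
  have "tmap e (\<lambda>r. r) (tauZ e (unit_lift e n a)) (tp e r w) = tp e r (w ^ a)" if "a < n \<and> coprime a n" for a
    using unit_lift[OF n, of a] that tauZ_in_ZMu tauZ_spec(1,3) wm w by (simp add: tmap_tp ZMu_mu)
  then have "trace e n (tp e r w) = (\<Sum>a | a < n \<and> coprime a n. tp e r (w ^ a))"
    unfolding trace_def by (intro sum.cong) auto
  also have "\<dots> = tp e r (\<Sum>a | a < n \<and> coprime a n. w ^ a)"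
    by (rule tp_sum_right[symmetric]) (intro ZMu_mu mu_power wm)
  finally show ?thesis using coprime_power_sum_int[OF sdvd_pos[OF n] w] tp_of_int by metis
qed

text \<open>The level m is a common multiple of the exponents killing the roots that occur in x.
  Admitting all multiples n of m lets two summands be brought to a common level in the
  induction.\<close>

lemma trace_in_R:
  assumes "x \<in> tqcarrier e"
  shows "\<exists>m. sdvd m e \<and> (\<forall>n w. sdvd n e \<longrightarrow> m dvd n \<longrightarrow> w ^ n = 1 \<longrightarrow> (\<exists>s. trace e n (act e w x) = tp e s 1))"
  using assms
proof (induction rule: tqcarrier_mu_induct)
  case zero
  have "trace e n (act e w 0) = tp e 0 1" if "sdvd n e" for n w
    using trace_add[OF that, of 0 0] by (simp add: tp_zero_left)
  then show ?case using sdvd_one by blast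
next
  case (add x r v)
  then obtain m where m: "sdvd m e"
    "\<And>n w. sdvd n e \<Longrightarrow> m dvd n \<Longrightarrow> w ^ n = 1 \<Longrightarrow> \<exists>s. trace e n (act e w x) = tp e s 1" by blast
  obtain k where k: "sdvd k e" "v ^ k = 1" using add(2) by (rule mu_rootsE)
  have "\<exists>s. trace e n (act e w (x + tp e r v)) = tp e s 1" if n: "sdvd n e" "lcm m k dvd n" and w: "w ^ n = 1" for n w
  proof -
    have wm: "w \<in> mu e" "w * v \<in> mu e" using mu_rootsI[OF n(1) w] add(2) mu_mult by auto
    have "v ^ n = 1" using k n(2) by (auto intro: power_eq_one_dvd)
    then obtain s where s: "trace e n (tp e r (w * v)) = tp e s 1"
      using trace_tp[OF n(1), of "w * v" r] w by (auto simp: power_mult_distrib)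
    obtain s' where "trace e n (act e w x) = tp e s' 1" using m(2)[OF n(1) _ w] n(2) by auto
    with s have "trace e n (act e w (x + tp e r v)) = tp e (s' + s) 1"
      using add wm n by (simp add: act_add act_tp ZMu_mu trace_add act_tqcarrier tp_tqcarrier tp_add_left)
    then show ?thesis by blast
  qed
  then show ?case using sdvd_lcm[OF m(1) k(1)] by blast
qed

text \<open>By semilinearity the conjugate of w x under a lift of a is w^a x.\<close>

lemma trace_act_invariant:
  assumes n: "sdvd n e" and w: "w ^ n = 1" and x: "x \<in> tqcarrier e"
    and invar: "\<And>a. a \<in> zhat_units e \<Longrightarrow> tmap e (\<lambda>r. r) (tauZ e a) x = x"
  shows "trace e n (act e w x) = act e (\<Sum>a | a < n \<and> coprime a n. w ^ a) x"
proof -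
  have wm: "w \<in> mu e" using n w by (rule mu_rootsI)
  have "trace e n (act e w x) = (\<Sum>a | a < n \<and> coprime a n. act e (w ^ a) x)"
    unfolding trace_def
    by (intro sum.cong refl) (use unit_lift[OF n] w wm x in \<open>simp add: tmap_tau_act invar\<close>)
  then show ?thesis using wm by (subst act_sum_left) (auto intro: ZMu_mu mu_power)
qed

text \<open>The trace sends w x, for x invariant, to an integer multiple of x on the one hand and into R on the
  other. The integers that arise generate an ideal containing a divisor of n, which can be cancelled.\<close>

lemma tau_invariant_in_R:
  fixes x :: "'r::ring_1 tq"
  assumes inj: "\<And>d (r::'r). sdvd d e \<Longrightarrow> of_nat d * r = 0 \<Longrightarrow> r = 0"
    and x: "x \<in> tqcarrier e" and invar: "\<And>a. a \<in> zhat_units e \<Longrightarrow> tmap e (\<lambda>r. r) (tauZ e a) x = x"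
  shows "\<exists>r. x = tp e r 1"
proof -
  obtain n where n: "sdvd n e" and tr: "\<And>w. w ^ n = 1 \<Longrightarrow> \<exists>s. trace e n (act e w x) = tp e s 1"
    using trace_in_R[OF x] dvd_refl by blast
  obtain z :: complex where z: "z ^ n = 1" "inj_on (\<lambda>k. z ^ k) {..<n}"
    using primitive_root_exists[OF sdvd_pos[OF n]] by blast
  have zk: "(z ^ k) ^ n = 1" for k by (metis z(1) mult.commute power_mult power_one)
  have zm: "z \<in> mu e" using n z(1) by (rule mu_rootsI)
  let ?U = "{a. a < n \<and> coprime a n}"
  have "\<forall>k. \<exists>c::int. (\<Sum>a\<in>?U. (z ^ k) ^ a) = of_int c"
    using coprime_power_sum_int[OF sdvd_pos[OF n] zk] by blast
  then obtain c :: "nat \<Rightarrow> int" where c: "\<And>k. (\<Sum>a\<in>?U. (z ^ k) ^ a) = of_int (c k)" by metis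
  have "\<forall>k. \<exists>s. act e (of_int (c k)) x = tp e s 1"
    using tr[OF zk] trace_act_invariant[OF n zk x invar] unfolding c by auto
  then obtain s where s: "\<And>k. act e (of_int (c k)) x = tp e (s k) 1" by metis
  obtain m where m: "\<And>k. k < n \<Longrightarrow> (\<Sum>j<n. m j * c j) dvd c k" using bezout_finite[of "{..<n}" c] by auto
  define g where "g = (\<Sum>j<n. m j * c j)"
  \<comment> \<open>The c k are the Fourier coefficients of the indicator function of the units
    modulo n. Fourier inversion at the unit 1 writes n as a combination of them with coefficients in
    Z[mu_e]. The residue has to be \<open>1 mod n\<close>, which is 0 for n = 1.\<close>
  have char_sum: "(\<Sum>k<n. of_int (c k) * inverse z ^ k) = of_nat n"
  proof -
    have "(\<Sum>k<n. of_int (c k) * inverse z ^ k) = (\<Sum>k<n. \<Sum>a\<in>?U. (z ^ a * inverse z) ^ k)"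
      by (simp add: c[symmetric] sum_distrib_right sum_distrib_left power_mult_distrib power_mult[symmetric] mult.commute)
    also have "\<dots> = (\<Sum>a\<in>?U. \<Sum>k<n. (z ^ a * inverse z) ^ k)" by (rule sum.swap)
    also have "\<dots> = (\<Sum>a\<in>?U. if a = 1 mod n then of_nat n else 0)"
    proof (rule sum.cong[OF refl])
      fix a assume a: "a \<in> ?U"
      have "(z ^ a * inverse z) ^ n = 1" using zk z(1) by (simp add: power_mult_distrib power_inverse)
      moreover have "z ^ a * inverse z = 1 \<longleftrightarrow> a = 1 mod n"
      proof -
        have "z ^ a * inverse z = 1 \<longleftrightarrow> z ^ a = z ^ (1 mod n)"
          using mu_nonzero[OF zm] power_mod_order[OF z(1), of 1] by (auto simp: field_simps)
        also have "\<dots> \<longleftrightarrow> a = 1 mod n"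
          using a sdvd_pos[OF n] by (intro inj_on_eq_iff[OF z(2)]) auto
        finally show ?thesis .
      qed
      ultimately show "(\<Sum>k<n. (z ^ a * inverse z) ^ k) = (if a = 1 mod n then of_nat n else 0)"
        using sum_powers_root_of_unity sdvd_pos[OF n] by auto
    qed
    also have "\<dots> = of_nat n"
    proof -
      have "1 mod n \<in> ?U" using sdvd_pos[OF n] by (cases "n = 1") auto
      then show ?thesis by (simp add: sum.delta')
    qed
    finally show ?thesis .
  qed
  \<comment> \<open>Division of this identity by g gives g * q = n with q in Z[mu_e], so |g| divides
    n already in Z and therefore divides \<open>e\<close>. The sign of g is not known, hence the
    factors sgn g below.\<close>
  define q where "q = (\<Sum>k<n. of_int (c k div g) * inverse z ^ k)"
  have q: "q \<in> ZMu e" unfolding q_def by (intro ZMu_sum ZMu_mult ZMu_of_int ZMu_mu mu_power mu_inverse zm)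
  have "of_int g * q = (\<Sum>k<n. of_int (g * (c k div g)) * inverse z ^ k)"
    by (simp add: q_def sum_distrib_left mult.assoc)
  also have "\<dots> = of_nat n" using m unfolding char_sum[symmetric] g_def by (intro sum.cong) auto
  finally have gq: "of_int g * q = of_nat n" .
  then have g0: "g \<noteq> 0" using sdvd_pos[OF n] by auto
  define h where "h = nat \<bar>g\<bar>"
  have gs: "\<bar>g\<bar> = sgn g * g" by (simp add: abs_sgn mult.commute)
  have hg: "of_nat h = (of_int (sgn g) * of_int g :: complex)"
    unfolding h_def by (metis gs of_int_mult of_int_of_nat_eq nat_0_le abs_ge_zero)
  have "int h dvd int n"
  proof (rule ZMu_int_dvd)
    show "of_int (sgn g) * q \<in> ZMu e" using q by (intro ZMu_mult ZMu_of_int)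
    have "of_int (sgn g) * of_int (sgn g) = (1 :: complex)" using g0 by (auto simp: sgn_if)
    then show "of_int (int n) = of_nat h * (of_int (sgn g) * q)" using gq hg by (simp add: algebra_simps)
    show "h > 0" using g0 by (simp add: h_def)
  qed
  then have h: "sdvd h e" using n sdvd_dvd by simp
  have "act e (of_int g) x = (\<Sum>k<n. act e (of_int (m k)) (act e (of_int (c k)) x))"
    unfolding g_def by (simp add: act_sum_left ZMu_mult act_act)
  also have "\<dots> = (\<Sum>k<n. tp e (of_int (m k) * s k) 1)"
    by (simp add: s act_tp tp_of_int)
  also have "\<dots> = tp e (\<Sum>k<n. of_int (m k) * s k) 1" by (simp add: tp_sum_left)
  finally have "act e (of_nat h) x = tp e (of_int (sgn g) * (\<Sum>k<n. of_int (m k) * s k)) 1"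
    unfolding hg by (simp add: act_act[symmetric] act_tp tp_of_int)
  \<comment> \<open>The element h x lies in R and is a multiple of h in the tensor product, so it is
    h t with t in R. As h divides \<open>e\<close>, it can be cancelled in h (x - t) = 0.\<close>
  then obtain t where "tp e (of_nat h * t) 1 = act e (of_nat h) x"
    using tp_eq_act_of_nat[OF x] by metis
  then have "act e (of_nat h) (x - tp e t 1) = 0"
    using tp_of_int[of e t "int h"] act_add[of e "of_nat h" "x - tp e t 1" "tp e t 1"] by (simp add: act_tp)
  then have "x - tp e t 1 = 0"
    using act_of_nat_eq_zero[OF tqcarrier_diff[OF x tp_tqcarrier]] inj[OF h] by simp
  then show ?thesis by auto
qed

section \<open>From gradings to automorphisms\<close>

locale graded_algebra =
  fixes e :: steinitz and phi :: "'k::comm_ring_1 \<Rightarrow> 'r::ring_1" and G :: "complex \<Rightarrow> 'r set"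
  assumes kalg: "kalg phi" and grading: "G \<in> gradings e phi"
    and inj: "\<And>d (r::'r). sdvd d e \<Longrightarrow> of_nat d * r = 0 \<Longrightarrow> r = 0"
begin

lemma phi_add: "phi (a + b) = phi a + phi b"
  using kalg by (simp add: kalg_def)

lemma G_outside: "z \<notin> mu e \<Longrightarrow> G z = {0}"
  using grading by (simp add: gradings_def)

lemma G_zero: "0 \<in> G z"
  using grading by (cases "z \<in> mu e") (auto simp: gradings_def)

lemma G_add: "r \<in> G z \<Longrightarrow> s \<in> G z \<Longrightarrow> r + s \<in> G z"
  using grading by (cases "z \<in> mu e") (auto simp: gradings_def)

lemma G_scale: "z \<in> mu e \<Longrightarrow> r \<in> G z \<Longrightarrow> phi c * r \<in> G z"
  using grading by (simp add: gradings_def)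

lemma G_one: "1 \<in> G 1"
  using grading by (simp add: gradings_def)

lemma G_mult: "z \<in> mu e \<Longrightarrow> w \<in> mu e \<Longrightarrow> r \<in> G z \<Longrightarrow> s \<in> G w \<Longrightarrow> r * s \<in> G (z * w)"
  using grading by (simp add: gradings_def)

definition hcomps :: "'r \<Rightarrow> (complex \<Rightarrow> 'r) \<Rightarrow> bool" where
  "hcomps r g \<longleftrightarrow> (\<forall>z. g z \<in> G z) \<and> finite {z. g z \<noteq> 0} \<and> r = (\<Sum>z | g z \<noteq> 0. g z)"

definition hcomp :: "complex \<Rightarrow> 'r \<Rightarrow> 'r" where
  "hcomp z r = (THE g. hcomps r g) z"

lemma hcomps_unique: "\<exists>!g. hcomps r g"
  using grading unfolding gradings_def hcomps_def mem_Collect_eq by (elim conjE allE)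

lemma hcomps_hcomp: "hcomps r (\<lambda>z. hcomp z r)"
  unfolding hcomp_def using theI'[OF hcomps_unique] by simp

lemma hcomp_eqI: "hcomps r g \<Longrightarrow> hcomp z r = g z"
  using hcomps_unique[of r] hcomps_hcomp[of r] by metis

lemma hcomp_G: "hcomp z r \<in> G z"
  using hcomps_hcomp[of r] by (simp add: hcomps_def)

lemma finite_hcomp: "finite {z. hcomp z r \<noteq> 0}"
  using hcomps_hcomp[of r] by (simp add: hcomps_def)

lemma sum_hcomp: "(\<Sum>z | hcomp z r \<noteq> 0. hcomp z r) = r"
  using hcomps_hcomp[of r] by (simp add: hcomps_def)

lemma hcompsI:
  assumes "\<And>z. g z \<in> G z" "finite S" "{z. g z \<noteq> 0} \<subseteq> S" "r = (\<Sum>z\<in>S. g z)"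
  shows "hcomps r g"
  unfolding hcomps_def
proof (intro conjI allI)
  show "finite {z. g z \<noteq> 0}" using assms finite_subset by blast
  show "r = (\<Sum>z | g z \<noteq> 0. g z)"
    unfolding assms(4) by (rule sum.mono_neutral_right) (use assms in auto)
qed (rule assms)

lemma hcomp_add: "hcomp z (r + s) = hcomp z r + hcomp z s"
proof (rule hcomp_eqI)
  let ?S = "{z. hcomp z r \<noteq> 0} \<union> {z. hcomp z s \<noteq> 0}"
  have fin: "finite ?S" by (simp add: finite_hcomp)
  have sum: "(\<Sum>z\<in>?S. hcomp z t) = t" if "{z. hcomp z t \<noteq> 0} \<subseteq> ?S" for t
    using sum.mono_neutral_left[OF fin that, of "\<lambda>z. hcomp z t"] sum_hcomp[of t] by simp
  show "hcomps (r + s) (\<lambda>z. hcomp z r + hcomp z s)"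
  proof (rule hcompsI[OF _ fin])
    show "hcomp z r + hcomp z s \<in> G z" for z by (intro G_add hcomp_G)
    show "{z. hcomp z r + hcomp z s \<noteq> 0} \<subseteq> ?S" by auto
    show "r + s = (\<Sum>z\<in>?S. hcomp z r + hcomp z s)"
      unfolding sum.distrib using sum[of r] sum[of s] by simp
  qed
qed

lemma hcomp_homogeneous:
  assumes "r \<in> G w" shows "hcomp z r = (if z = w then r else 0)"
  by (rule hcomp_eqI, rule hcompsI[where S = "{w}"]) (use assms G_zero in auto)

lemma hcomp_outside: "z \<notin> mu e \<Longrightarrow> hcomp z r = 0"
  using hcomp_G[of z r] G_outside by auto

definition tproj :: "complex \<Rightarrow> 'r tq \<Rightarrow> 'r tq" where
  "tproj z = tmap e (hcomp z) (\<lambda>u. u)"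

lemma tproj_tp: "u \<in> ZMu e \<Longrightarrow> tproj z (tp e r u) = tp e (hcomp z r) u"
  by (simp add: tproj_def tmap_tp hcomp_add)

lemma tproj_zero [simp]: "tproj z 0 = 0"
  by (simp add: tproj_def tmap_zero hcomp_add)

lemma tproj_add: "x \<in> tqcarrier e \<Longrightarrow> y \<in> tqcarrier e \<Longrightarrow> tproj z (x + y) = tproj z x + tproj z y"
  by (simp add: tproj_def tmap_add hcomp_add)

lemma tproj_tqcarrier: "x \<in> tqcarrier e \<Longrightarrow> tproj z x \<in> tqcarrier e"
  by (simp add: tproj_def tmap_tqcarrier hcomp_add)

lemma tproj_sum: "(\<And>i. i \<in> I \<Longrightarrow> f i \<in> tqcarrier e) \<Longrightarrow> tproj z (sum f I) = (\<Sum>i\<in>I. tproj z (f i))"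
  by (simp add: tproj_def tmap_sum hcomp_add)

lemma tproj_outside: "x \<in> tqcarrier e \<Longrightarrow> z \<notin> mu e \<Longrightarrow> tproj z x = 0"
  by (induction rule: tqcarrier_induct) (auto simp: tproj_add tp_tqcarrier tproj_tp hcomp_outside tp_zero_left)

lemma tproj_homogeneous: "r \<in> G w \<Longrightarrow> u \<in> ZMu e \<Longrightarrow> tproj z (tp e r u) = (if z = w then tp e r u else 0)"
  by (simp add: tproj_tp hcomp_homogeneous tp_zero_left)

text \<open>Splitting the left entry into its components shows that pure tensors with homogeneous
  left entry generate the carrier; additive identities need checking only there.\<close>

lemma tqcarrier_homogeneous_induct [consumes 1, case_names zero add homogeneous]:
  assumes "x \<in> tqcarrier e" and "P 0" and add: "\<And>x y. x \<in> tqcarrier e \<Longrightarrow> y \<in> tqcarrier e \<Longrightarrow> P x \<Longrightarrow> P y \<Longrightarrow> P (x + y)"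
    and hom: "\<And>z r u. z \<in> mu e \<Longrightarrow> r \<in> G z \<Longrightarrow> u \<in> ZMu e \<Longrightarrow> P (tp e r u)"
  shows "P x"
  using assms(1)
proof (induction rule: tqcarrier_induct)
  case (add x r u)
  have "P (\<Sum>z\<in>S. tp e (hcomp z r) u)" for S
  proof (induction S rule: infinite_finite_induct)
    case (insert z S)
    have "P (tp e (hcomp z r) u)"
    proof (cases "z \<in> mu e")
      case True then show ?thesis using assms(4) hcomp_G add(2) by blast
    next
      case False then show ?thesis using assms(2) add(2) by (simp add: hcomp_outside tp_zero_left)
    qed
    with insert show ?case using add(2) by (simp add: assms(3) tp_tqcarrier tqcarrier_sum)
  qed (simp_all add: assms(2))
  from this[of "{z. hcomp z r \<noteq> 0}"] have "P (tp e r u)"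
    using add(2) by (simp add: tp_sum_left[symmetric] sum_hcomp)
  then show ?case using add by (intro assms(3) tp_tqcarrier)
qed (fact assms(2))

lemma finite_tproj: "x \<in> tqcarrier e \<Longrightarrow> finite {z. tproj z x \<noteq> 0}"
proof (induction rule: tqcarrier_homogeneous_induct)
  case (add x y)
  have "{z. tproj z (x + y) \<noteq> 0} \<subseteq> {z. tproj z x \<noteq> 0} \<union> {z. tproj z y \<noteq> 0}"
    using add by (auto simp: tproj_add)
  then show ?case using add finite_subset by blast
next
  case (homogeneous z r u)
  then have "{w. tproj w (tp e r u) \<noteq> 0} \<subseteq> {z}" by (auto simp: tproj_homogeneous split: if_splits)
  then show ?case using finite_subset by blast
qed simp

text \<open>An arbitrary factor c z in degree z covers all maps that are needed: the automorphism
  itself for the identity function, its inverse for \<open>inverse\<close>, its a-th power for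
  exponentiation by a, and scalar multiplication for constant c.\<close>

definition twist :: "(complex \<Rightarrow> complex) \<Rightarrow> 'r tq \<Rightarrow> 'r tq" where
  "twist c x = (\<Sum>z | tproj z x \<noteq> 0. act e (c z) (tproj z x))"

lemma twist_superset:
  assumes "finite S" "{z. tproj z x \<noteq> 0} \<subseteq> S"
  shows "twist c x = (\<Sum>z\<in>S. act e (c z) (tproj z x))"
  unfolding twist_def by (rule sum.mono_neutral_left) (use assms in auto)

lemma twist_zero [simp]: "twist c 0 = 0"
  by (simp add: twist_def)

lemma twist_add:
  assumes "x \<in> tqcarrier e" "y \<in> tqcarrier e" shows "twist c (x + y) = twist c x + twist c y"
proof -
  let ?S = "{z. tproj z x \<noteq> 0} \<union> {z. tproj z y \<noteq> 0}"
  have S: "finite ?S" using assms finite_tproj by simp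
  have "{z. tproj z (x + y) \<noteq> 0} \<subseteq> ?S" using assms by (auto simp: tproj_add)
  from twist_superset[OF S this] twist_superset[OF S, of x] twist_superset[OF S, of y] assms
  show ?thesis by (simp add: tproj_add act_add sum.distrib)
qed

lemma twist_homogeneous:
  assumes "r \<in> G z" "u \<in> ZMu e" "c z \<in> ZMu e" shows "twist c (tp e r u) = tp e r (c z * u)"
proof -
  have "twist c (tp e r u) = (\<Sum>w\<in>{z}. act e (c w) (tproj w (tp e r u)))"
    by (rule twist_superset) (use assms in \<open>auto simp: tproj_homogeneous split: if_splits\<close>)
  then show ?thesis using assms by (simp add: tproj_homogeneous act_tp)
qed

context
  fixes c :: "complex \<Rightarrow> complex" assumes c: "\<And>z. z \<in> mu e \<Longrightarrow> c z \<in> ZMu e"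
begin

lemma twist_tqcarrier: "x \<in> tqcarrier e \<Longrightarrow> twist c x \<in> tqcarrier e"
  by (induction rule: tqcarrier_homogeneous_induct) (auto simp: twist_add tqcarrier_add twist_homogeneous c tp_tqcarrier ZMu_mult)

lemma tproj_twist:
  assumes w: "w \<in> mu e" and x: "x \<in> tqcarrier e" shows "tproj w (twist c x) = act e (c w) (tproj w x)"
  using x
  by (induction rule: tqcarrier_homogeneous_induct)
     (auto simp: twist_add tproj_add twist_tqcarrier act_add twist_homogeneous c tproj_homogeneous ZMu_mult act_tp w)

lemma twist_twist:
  assumes d: "\<And>z. z \<in> mu e \<Longrightarrow> d z \<in> ZMu e" and x: "x \<in> tqcarrier e"
  shows "twist d (twist c x) = twist (\<lambda>z. d z * c z) x"
  using x
  by (induction rule: tqcarrier_homogeneous_induct)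
     (auto simp: twist_add twist_tqcarrier twist_homogeneous c d ZMu_mult mult.assoc)

lemma twist_mult:
  assumes m: "\<And>z w. z \<in> mu e \<Longrightarrow> w \<in> mu e \<Longrightarrow> c (z * w) = c z * c w" and x: "x \<in> tqcarrier e" and y: "y \<in> tqcarrier e"
  shows "twist c (x * y) = twist c x * twist c y"
  using x
proof (induction rule: tqcarrier_homogeneous_induct)
  case (add x x')
  then show ?case using y by (simp add: ring_distribs twist_add tqcarrier_mult)
next
  case (homogeneous z r u)
  note zru = homogeneous
  show ?case
    using y
  proof (induction rule: tqcarrier_homogeneous_induct)
    case (add y y')
    then show ?case using zru by (simp add: ring_distribs twist_add tqcarrier_mult tp_tqcarrier)
  next
    case (homogeneous w s v)
    then have "twist c (tp e r u * tp e s v) = tp e (r * s) (c (z * w) * (u * v))"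
      using zru G_mult[OF zru(1) homogeneous(1)] by (simp add: tp_mult twist_homogeneous c mu_mult ZMu_mult)
    then show ?case using zru homogeneous by (simp add: twist_homogeneous c m tp_mult ZMu_mult mult_ac)
  qed simp
qed simp

end

lemma twist_cong: "x \<in> tqcarrier e \<Longrightarrow> (\<And>z. z \<in> mu e \<Longrightarrow> c z = d z) \<Longrightarrow> twist c x = twist d x"
  unfolding twist_def by (rule sum.cong) (use tproj_outside[of x] in force)+

lemma twist_one: "x \<in> tqcarrier e \<Longrightarrow> twist (\<lambda>_. 1) x = x"
  by (induction rule: tqcarrier_homogeneous_induct) (auto simp: twist_add twist_homogeneous)

lemma sum_tproj: "x \<in> tqcarrier e \<Longrightarrow> (\<Sum>z | tproj z x \<noteq> 0. tproj z x) = x"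
  using twist_one[of x] unfolding twist_def by (simp add: act_one tproj_tqcarrier)

definition tsigma :: "'r tq \<Rightarrow> 'r tq" where
  "tsigma = twist (\<lambda>z. z)"

lemma tsigma_zero [simp]: "tsigma 0 = 0"
  by (simp add: tsigma_def)

lemma tsigma_tqcarrier: "x \<in> tqcarrier e \<Longrightarrow> tsigma x \<in> tqcarrier e"
  unfolding tsigma_def by (rule twist_tqcarrier) (rule ZMu_mu)

lemma tsigma_add: "x \<in> tqcarrier e \<Longrightarrow> y \<in> tqcarrier e \<Longrightarrow> tsigma (x + y) = tsigma x + tsigma y"
  by (simp add: tsigma_def twist_add)

lemma tsigma_mult: "x \<in> tqcarrier e \<Longrightarrow> y \<in> tqcarrier e \<Longrightarrow> tsigma (x * y) = tsigma x * tsigma y"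
  unfolding tsigma_def by (rule twist_mult) (auto intro: ZMu_mu)

lemma tsigma_homogeneous: "z \<in> mu e \<Longrightarrow> r \<in> G z \<Longrightarrow> u \<in> ZMu e \<Longrightarrow> tsigma (tp e r u) = tp e r (z * u)"
  by (simp add: tsigma_def twist_homogeneous ZMu_mu)

lemma tsigma_bij: "bij_betw tsigma (tqcarrier e) (tqcarrier e)"
proof (rule bij_betwI[where g = "twist inverse"])
  have i: "inverse z \<in> ZMu e" if "z \<in> mu e" for z using that mu_inverse ZMu_mu by blast
  show "tsigma \<in> tqcarrier e \<rightarrow> tqcarrier e" using tsigma_tqcarrier by auto
  show "twist inverse \<in> tqcarrier e \<rightarrow> tqcarrier e" using twist_tqcarrier i by auto
  have one: "twist (\<lambda>z. inverse z * z) x = x" "twist (\<lambda>z. z * inverse z) x = x" if "x \<in> tqcarrier e" for x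
    using twist_cong[OF that, of "\<lambda>z. inverse z * z" "\<lambda>_. 1"] twist_cong[OF that, of "\<lambda>z. z * inverse z" "\<lambda>_. 1"]
      twist_one[OF that] mu_nonzero by auto
  show "twist inverse (tsigma x) = x" "tsigma (twist inverse x) = x" if "x \<in> tqcarrier e" for x
    unfolding tsigma_def using that by (simp_all add: twist_twist i ZMu_mu one)
qed

lemma tsigma_tproj: "x \<in> tqcarrier e \<Longrightarrow> z \<in> mu e \<Longrightarrow> tsigma (tproj z x) = act e z (tproj z x)"
proof (induction rule: tqcarrier_homogeneous_induct)
  case (add x y) then show ?case by (simp add: tproj_add tsigma_add tproj_tqcarrier act_add)
next
  case (homogeneous w r u)
  then show ?case by (auto simp: tproj_homogeneous tsigma_homogeneous act_tp ZMu_mu)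
qed simp

text \<open>In degree z the eigenvalue equation reads z x_z = w x_z for the component x_z of x, and
  \<open>act_mu_cancel\<close> kills x_z unless z = w.\<close>

lemma tsigma_eigenvector:
  assumes x: "x \<in> tqcarrier e" and w: "w \<in> mu e" and eq: "tsigma x = act e w x"
  shows "tproj z x = (if z = w then x else 0)"
proof -
  \<comment> \<open>As a twist by a constant function, multiplication by w commutes with the
    projections.\<close>
  have "act e w x = twist (\<lambda>_. w) x"
    using x by (induction rule: tqcarrier_homogeneous_induct) (auto simp: act_add twist_add act_tp twist_homogeneous w ZMu_mu)
  then have pw: "tproj z (act e w x) = act e w (tproj z x)" if "z \<in> mu e" for z
    using tproj_twist[of "\<lambda>_. w", OF _ that x] w ZMu_mu by simp
  have 0: "tproj z x = 0" if "z \<noteq> w" for z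
  proof (cases "z \<in> mu e")
    case True
    have "act e z (tproj z x) = act e w (tproj z x)"
      using tproj_twist[of "\<lambda>z. z", OF ZMu_mu True x] pw[OF True] eq by (simp add: tsigma_def)
    then show ?thesis
      by (rule act_mu_cancel[of e z w "tproj z x", OF _ True w tproj_tqcarrier[OF x] _ that, rotated]) (erule (1) inj)
  qed (rule tproj_outside[OF x])
  then have "(\<Sum>z | tproj z x \<noteq> 0. tproj z x) = (\<Sum>z\<in>{w}. tproj z x)"
    by (intro sum.mono_neutral_left) auto
  then have "tproj w x = x" by (simp add: sum_tproj[OF x])
  with 0 show ?thesis by simp
qed

text \<open>Scalars have degree 1, because phi k = phi k * 1 lies in \<open>G 1\<close>. So the
  image of k' is fixed, and k'-linearity follows from multiplicativity.\<close>

lemma tsigma_phi: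
  assumes "y \<in> tqcarrier e" shows "tsigma (tmap e phi (\<lambda>u. u) y) = tmap e phi (\<lambda>u. u) y"
  using assms
proof (induction rule: tqcarrier_induct)
  case zero show ?case by (simp add: tmap_zero phi_add tsigma_def)
next
  case (add y k u)
  have "phi k \<in> G 1" using G_scale[OF one_in_mu G_one, of k] by simp
  then have "tsigma (tp e (phi k) u) = tp e (phi k) u"
    using tsigma_homogeneous[OF one_in_mu _ add(2)] by simp
  then show ?case using add by (simp add: tmap_add phi_add tp_tqcarrier tmap_tp tsigma_add tmap_tqcarrier)
qed

definition sigma :: "'r tens \<Rightarrow> 'r tens" where
  "sigma = restrict (\<lambda>X. tinv e (tsigma (iota e X))) (tcarrier (ZMu e))"

lemma sigma_tcarrier: "X \<in> tcarrier (ZMu e) \<Longrightarrow> sigma X \<in> tcarrier (ZMu e)"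
  by (simp add: sigma_def tinv_tcarrier tsigma_tqcarrier iota_tqcarrier)

lemma iota_sigma: "X \<in> tcarrier (ZMu e) \<Longrightarrow> iota e (sigma X) = tsigma (iota e X)"
  by (simp add: sigma_def iota_tinv tsigma_tqcarrier iota_tqcarrier)

lemma sigma_tadd:
  "X \<in> tcarrier (ZMu e) \<Longrightarrow> Y \<in> tcarrier (ZMu e) \<Longrightarrow> sigma (tadd (ZMu e) X Y) = tadd (ZMu e) (sigma X) (sigma Y)"
  by (rule iota_eqI[where e = e]) (simp_all add: sigma_tcarrier tadd_tcarrier iota_sigma iota_tadd tsigma_add iota_tqcarrier)

lemma sigma_tmul:
  "X \<in> tcarrier (ZMu e) \<Longrightarrow> Y \<in> tcarrier (ZMu e) \<Longrightarrow> sigma (tmul (ZMu e) X Y) = tmul (ZMu e) (sigma X) (sigma Y)"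
  by (rule iota_eqI[where e = e]) (simp_all add: sigma_tcarrier tmul_tcarrier iota_sigma iota_tmul tsigma_mult iota_tqcarrier)

lemma sigma_scalar:
  fixes c :: "'k tens"
  assumes c: "c \<in> tcarrier (ZMu e)" and X: "X \<in> tcarrier (ZMu e)"
  shows "sigma (tmul (ZMu e) (tmapL (ZMu e) phi c) X) = tmul (ZMu e) (tmapL (ZMu e) phi c) (sigma X)"
proof -
  note t = tmapL_iota[OF phi_add c]
  have "sigma (tmapL (ZMu e) phi c) = tmapL (ZMu e) phi c"
    by (rule iota_eqI[where e = e]) (use t c in \<open>simp_all add: sigma_tcarrier iota_sigma tsigma_phi iota_tqcarrier\<close>)
  then show ?thesis using sigma_tmul[OF t(1) X] by simp
qed

lemma sigma_tpure:
  assumes "z \<in> mu e" "r \<in> G z" "u \<in> ZMu e"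
  shows "sigma (tpure (ZMu e) r u) = tpure (ZMu e) r (z * u)"
  by (rule iota_eqI[where e = e]) (use assms in \<open>simp_all add: sigma_tcarrier tpure_tcarrier iota_sigma iota_tpure tsigma_homogeneous ZMu_mult ZMu_mu\<close>)

lemma grad_map_prop_sigma: "grad_map_prop e phi G sigma"
  unfolding grad_map_prop_def Let_def
  using sigma_tcarrier sigma_tadd sigma_scalar sigma_tpure by (auto simp: sigma_def)

text \<open>The values are prescribed on pure tensors with homogeneous left entry, which generate
  the carrier additively; outside the carrier extensionality fixes them.\<close>

lemma grad_map_prop_unique:
  assumes "grad_map_prop e phi G s" shows "s = sigma"
proof -
  have s: "s \<in> extensional (tcarrier (ZMu e))" "\<And>X. X \<in> tcarrier (ZMu e) \<Longrightarrow> s X \<in> tcarrier (ZMu e)"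
    "\<And>X Y. X \<in> tcarrier (ZMu e) \<Longrightarrow> Y \<in> tcarrier (ZMu e) \<Longrightarrow> s (tadd (ZMu e) X Y) = tadd (ZMu e) (s X) (s Y)"
    "\<And>z r u. z \<in> mu e \<Longrightarrow> r \<in> G z \<Longrightarrow> u \<in> ZMu e \<Longrightarrow> s (tpure (ZMu e) r u) = tpure (ZMu e) r (z * u)"
    using assms by (auto simp: grad_map_prop_def Let_def)
  define f where "f x = iota e (s (tinv e x))" for x
  have f_iota: "f (iota e X) = iota e (s X)" if "X \<in> tcarrier (ZMu e)" for X
    using that by (simp add: f_def tinv_iota)
  have f_add: "f (x + y) = f x + f y" if "x \<in> tqcarrier e" "y \<in> tqcarrier e" for x y
    using f_iota[of "tadd (ZMu e) (tinv e x) (tinv e y)"] that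
    by (simp add: f_def s tadd_tcarrier tinv_tcarrier iota_tadd iota_tinv)
  have "f x = tsigma x" if "x \<in> tqcarrier e" for x
    using that
  proof (induction rule: tqcarrier_homogeneous_induct)
    case zero show ?case using f_add[of 0 0] by (simp add: tsigma_def)
  next
    case (add x y) then show ?case by (simp add: f_add tsigma_add)
  next
    case (homogeneous z r u)
    then show ?case using f_iota[of "tpure (ZMu e) r u"]
      by (simp add: tpure_tcarrier iota_tpure s tsigma_homogeneous ZMu_mult ZMu_mu)
  qed
  then have "iota e (s X) = iota e (sigma X)" if "X \<in> tcarrier (ZMu e)" for X
    using f_iota[OF that] iota_sigma[OF that] iota_tqcarrier[OF that] by simp
  then have "s X = sigma X" if "X \<in> tcarrier (ZMu e)" for X
    using that s(2) sigma_tcarrier by (intro iota_eqI[where e = e]) auto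
  then show ?thesis
    by (intro extensionalityI[OF s(1)]) (auto simp: sigma_def)
qed

lemma Phi_eq_sigma: "Phi e phi G = sigma"
  unfolding Phi_def using grad_map_prop_sigma grad_map_prop_unique by (rule the_equality)

end

section \<open>From automorphisms to gradings\<close>

text \<open>The counterpart of \<open>decomp\<close> along \<open>iota\<close>, where the
  decomposition is an honest finite sum in a ring.\<close>

definition tdecomp :: "steinitz \<Rightarrow> ('r::ring_1 tq \<Rightarrow> 'r tq) \<Rightarrow> 'r tq \<Rightarrow> (complex \<Rightarrow> 'r tq) \<Rightarrow> bool" where
  "tdecomp e st x g \<longleftrightarrow> (\<forall>z. z \<notin> mu e \<longrightarrow> g z = 0) \<and> finite {z. g z \<noteq> 0} \<and>
     (\<forall>z\<in>mu e. g z \<in> tqcarrier e \<and> st (g z) = act e z (g z)) \<and> x = (\<Sum>z | g z \<noteq> 0. g z)"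

lemma tdecomp_tqcarrier: "tdecomp e st x g \<Longrightarrow> g z \<in> tqcarrier e"
  by (cases "z \<in> mu e") (auto simp: tdecomp_def)

text \<open>One endomorphism in both models, \<open>s\<close> on classes and \<open>st\<close> on
  the ring type. It serves both directions of the bijection, so eigenspaces, diagonalizability and
  powers are translated only once.\<close>

locale tens_endo =
  fixes e :: steinitz and s :: "'r::ring_1 tens \<Rightarrow> 'r tens" and st :: "'r tq \<Rightarrow> 'r tq"
  assumes s: "\<And>X. X \<in> tcarrier (ZMu e) \<Longrightarrow> s X \<in> tcarrier (ZMu e)"
    and st: "\<And>X. X \<in> tcarrier (ZMu e) \<Longrightarrow> iota e (s X) = st (iota e X)"
begin

lemma eig_iff:
  assumes "z \<in> mu e"
  shows "X \<in> eig e s z \<longleftrightarrow> X \<in> tcarrier (ZMu e) \<and> st (iota e X) = act e z (iota e X)"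
proof -
  have "s X = tmul (ZMu e) (tpure (ZMu e) 1 z) X \<longleftrightarrow> st (iota e X) = act e z (iota e X)" if X: "X \<in> tcarrier (ZMu e)"
  proof -
    have P: "tpure (ZMu e) (1 :: 'r) z \<in> tcarrier (ZMu e)" using assms by (intro tpure_tcarrier ZMu_mu)
    have "iota e (tmul (ZMu e) (tpure (ZMu e) 1 z) X) = act e z (iota e X)"
      using P X assms by (simp add: iota_tmul iota_tpure ZMu_mu act_def)
    then show ?thesis
      unfolding st[OF X, symmetric] by (simp only: iota_inject[OF s[OF X] tmul_tcarrier[OF P X], symmetric])
  qed
  then show ?thesis by (auto simp: eig_def)
qed

lemma decomp_tcarrier: "decomp e s X g \<Longrightarrow> g z \<in> tcarrier (ZMu e)"
  unfolding decomp_def by (cases "z \<in> mu e") (auto simp: eig_def)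

lemma decomp_iff:
  assumes X: "X \<in> tcarrier (ZMu e)" and g: "\<And>z. g z \<in> tcarrier (ZMu e)"
  shows "decomp e s X g \<longleftrightarrow> tdecomp e st (iota e X) (\<lambda>z. iota e (g z))"
proof -
  have "X = tsum (ZMu e) g {z. g z \<noteq> tzero (ZMu e)} \<longleftrightarrow> iota e X = (\<Sum>z | g z \<noteq> tzero (ZMu e). iota e (g z))"
    using iota_inject[OF X tsum_tcarrier[of _ g]] g by (simp add: iota_tsum)
  then show ?thesis
    unfolding decomp_def tdecomp_def using g eig_iff by (auto simp: iota_eq_zero iota_tqcarrier)
qed

lemma mu_diag_iff: "mu_diag e s \<longleftrightarrow> (\<forall>x\<in>tqcarrier e. \<exists>!g. tdecomp e st x g)"
proof -
  have "(\<exists>!g. decomp e s X g) \<longleftrightarrow> (\<exists>!g. tdecomp e st (iota e X) g)" if X: "X \<in> tcarrier (ZMu e)" for X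
  proof
    assume "\<exists>!g. decomp e s X g"
    then obtain g where g: "decomp e s X g" "\<And>g'. decomp e s X g' \<Longrightarrow> g' = g" by blast
    show "\<exists>!g. tdecomp e st (iota e X) g"
    proof (rule ex1I[of _ "\<lambda>z. iota e (g z)"])
      show "tdecomp e st (iota e X) (\<lambda>z. iota e (g z))"
        using g(1) decomp_iff[OF X] decomp_tcarrier by blast
      fix h assume h: "tdecomp e st (iota e X) h"
      have "decomp e s X (\<lambda>z. tinv e (h z))"
        using h by (subst decomp_iff[OF X]) (simp_all add: tinv_tcarrier iota_tinv tdecomp_tqcarrier[OF h])
      then have "(\<lambda>z. tinv e (h z)) = g" by (rule g(2))
      then show "h = (\<lambda>z. iota e (g z))" using iota_tinv[OF tdecomp_tqcarrier[OF h]] by auto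
    qed
  next
    assume "\<exists>!g. tdecomp e st (iota e X) g"
    then obtain h where h: "tdecomp e st (iota e X) h" "\<And>h'. tdecomp e st (iota e X) h' \<Longrightarrow> h' = h" by blast
    show "\<exists>!g. decomp e s X g"
    proof (rule ex1I[of _ "\<lambda>z. tinv e (h z)"])
      show "decomp e s X (\<lambda>z. tinv e (h z))"
        using h(1) by (subst decomp_iff[OF X]) (simp_all add: tinv_tcarrier iota_tinv tdecomp_tqcarrier[OF h(1)])
      fix g assume g: "decomp e s X g"
      have "(\<lambda>z. iota e (g z)) = h"
        by (rule h(2)) (use g decomp_iff[OF X] decomp_tcarrier[OF g] in blast)
      then show "g = (\<lambda>z. tinv e (h z))" using tinv_iota[OF decomp_tcarrier[OF g]] by auto
    qed
  qed
  then have "mu_diag e s \<longleftrightarrow> (\<forall>X\<in>tcarrier (ZMu e). \<exists>!g. tdecomp e st (iota e X) g)"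
    unfolding mu_diag_def by (rule ball_cong[OF refl])
  also have "\<dots> \<longleftrightarrow> (\<forall>x\<in>iota e ` tcarrier (ZMu e). \<exists>!g. tdecomp e st x g)"
    by (rule ball_simps(9)[symmetric])
  also have "iota e ` tcarrier (ZMu e) = (tqcarrier e :: 'r tq set)" by (rule bij_betw_imp_surj_on[OF iota_bij])
  finally show ?thesis .
qed

lemma iota_spow:
  assumes diag: "mu_diag e s" and a: "a \<in> zhat e" and X: "X \<in> tcarrier (ZMu e)" and g: "tdecomp e st (iota e X) g"
  shows "spow e s a X \<in> tcarrier (ZMu e)" "iota e (spow e s a X) = (\<Sum>z | g z \<noteq> 0. act e (hpow z a) (g z))"
proof -
  have d: "decomp e s X (\<lambda>z. tinv e (g z))"
    using g by (subst decomp_iff[OF X]) (simp_all add: tinv_tcarrier iota_tinv tdecomp_tqcarrier[OF g])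
  have the: "(THE g. decomp e s X g) = (\<lambda>z. tinv e (g z))"
    by (rule the1_equality[where P = "decomp e s X"]) (use diag X d in \<open>simp_all add: mu_diag_def\<close>)
  have nz: "tinv e (g z) \<noteq> tzero (ZMu e) \<longleftrightarrow> g z \<noteq> 0" for z
    using iota_eq_zero[OF tinv_tcarrier[OF tdecomp_tqcarrier[OF g, of z]]] by (simp add: iota_tinv tdecomp_tqcarrier[OF g])
  have zm: "hpow z a \<in> ZMu e" if "g z \<noteq> 0" for z
    using that g hpow_mu[OF a] ZMu_mu unfolding tdecomp_def by blast
  have c: "tmul (ZMu e) (tpure (ZMu e) 1 (hpow z a)) (tinv e (g z)) \<in> tcarrier (ZMu e)" if "g z \<noteq> 0" for z
    using zm[OF that] tdecomp_tqcarrier[OF g] by (intro tmul_tcarrier tpure_tcarrier tinv_tcarrier)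
  show "spow e s a X \<in> tcarrier (ZMu e)"
    unfolding spow_def the Let_def nz by (intro tsum_tcarrier) (use c in auto)
  have "iota e (spow e s a X) = (\<Sum>z | g z \<noteq> 0. iota e (tmul (ZMu e) (tpure (ZMu e) 1 (hpow z a)) (tinv e (g z))))"
    unfolding spow_def the Let_def nz by (intro iota_tsum) (use c in auto)
  also have "\<dots> = (\<Sum>z | g z \<noteq> 0. act e (hpow z a) (g z))"
    using zm by (intro sum.cong refl)
      (simp add: iota_tmul tpure_tcarrier tinv_tcarrier tdecomp_tqcarrier[OF g] iota_tpure iota_tinv act_def)
  finally show "iota e (spow e s a X) = (\<Sum>z | g z \<noteq> 0. act e (hpow z a) (g z))" .
qed

end

section \<open>The Galois action on the tensor product\<close>

abbreviation ttau :: "steinitz \<Rightarrow> (nat \<Rightarrow> int) \<Rightarrow> 'r::ring_1 tq \<Rightarrow> 'r tq" where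
  "ttau e a \<equiv> tmap e (\<lambda>r. r) (tauZ e a)"

lemma tau_iota:
  fixes X :: "'r::ring_1 tens"
  assumes a: "a \<in> zhat_units e" and X: "X \<in> tcarrier (ZMu e)"
  shows "tau e a X \<in> tcarrier (ZMu e)" "iota e (tau e a X) = ttau e a (iota e X)"
  unfolding tau_def using tmapR_iota[OF tauZ_in_ZMu[OF a] tauZ_spec(3)[OF a] X] by auto

lemma ttau_tp: "a \<in> zhat_units e \<Longrightarrow> u \<in> ZMu e \<Longrightarrow> ttau e a (tp e r u) = tp e r (tauZ e a u)"
  by (simp add: tmap_tp tauZ_in_ZMu tauZ_spec(3))

lemma ttau_add: "a \<in> zhat_units e \<Longrightarrow> x \<in> tqcarrier e \<Longrightarrow> y \<in> tqcarrier e \<Longrightarrow> ttau e a (x + y) = ttau e a x + ttau e a y"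
  by (simp add: tmap_add tauZ_in_ZMu tauZ_spec(3))

lemma ttau_zero: "a \<in> zhat_units e \<Longrightarrow> ttau e a 0 = 0"
  by (simp add: tmap_zero tauZ_in_ZMu tauZ_spec(3))

lemma ttau_sum: "a \<in> zhat_units e \<Longrightarrow> (\<And>i. i \<in> I \<Longrightarrow> f i \<in> tqcarrier e) \<Longrightarrow> ttau e a (sum f I) = (\<Sum>i\<in>I. ttau e a (f i))"
  by (simp add: tmap_sum tauZ_in_ZMu tauZ_spec(3))

lemma ttau_tqcarrier: "a \<in> zhat_units e \<Longrightarrow> x \<in> tqcarrier e \<Longrightarrow> ttau e a x \<in> tqcarrier e"
  by (simp add: tmap_tqcarrier tauZ_in_ZMu tauZ_spec(3))

lemma ttau_inverse:
  assumes a: "a \<in> zhat_units e" and b: "b \<in> zhat_units e"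
    and ab: "\<And>z. z \<in> mu e \<Longrightarrow> hpow (hpow z a) b = z" and x: "x \<in> tqcarrier e"
  shows "ttau e b (ttau e a x) = x"
  using x
  by (induction rule: tqcarrier_induct)
     (simp_all add: a b ttau_zero ttau_add ttau_tqcarrier tp_tqcarrier ttau_tp tauZ_in_ZMu tauZ_inverse[OF a b ab])

text \<open>The inverse is \<open>tau e b\<close> for the inverse unit b. This gives
  \<open>inv_into\<close> in the definition of \<open>Xe\<close> its intended meaning.\<close>

lemma tau_bij:
  assumes a: "a \<in> zhat_units e"
  shows "bij_betw (tau e a) (tcarrier (ZMu e)) (tcarrier (ZMu e) :: 'r::ring_1 tens set)"
proof -
  obtain b where b: "b \<in> zhat_units e" "\<And>z. z \<in> mu e \<Longrightarrow> hpow (hpow z a) b = z" "\<And>z. z \<in> mu e \<Longrightarrow> hpow (hpow z b) a = z"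
    by (rule zhat_units_inverse[OF a], rule that)
  have 1: "tau e b (tau e a X) = X" if "X \<in> tcarrier (ZMu e)" for X :: "'r tens"
    by (rule iota_eqI[where e = e]) (simp_all add: that tau_iota a b(1) ttau_inverse[OF a b(1,2)] iota_tqcarrier)
  have 2: "tau e a (tau e b X) = X" if "X \<in> tcarrier (ZMu e)" for X :: "'r tens"
    by (rule iota_eqI[where e = e]) (simp_all add: that tau_iota a b(1) ttau_inverse[OF b(1) a b(3)] iota_tqcarrier)
  show ?thesis
    by (rule bij_betwI[where g = "tau e b"]) (use 1 2 tau_iota(1) a b(1) in auto)
qed

text \<open>Substituting X = \<open>tau e a Y\<close> turns the conjugation condition into a
  commutation rule free of \<open>inv_into\<close>.\<close>

lemma tau_conj_iff:
  fixes s :: "'r::ring_1 tens \<Rightarrow> 'r tens"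
  assumes a: "a \<in> zhat_units e"
  shows "(\<forall>X\<in>tcarrier (ZMu e). tau e a (s (inv_into (tcarrier (ZMu e)) (tau e a) X)) = spow e s a X) \<longleftrightarrow>
    (\<forall>Y\<in>tcarrier (ZMu e). tau e a (s Y) = spow e s a (tau e a Y))"
proof -
  note bij = tau_bij[OF a, where 'r = 'r]
  let ?inv = "inv_into (tcarrier (ZMu e)) (tau e a :: 'r tens \<Rightarrow> 'r tens)"
  show ?thesis
  proof (intro iffI ballI)
    fix Y :: "'r tens" assume *: "\<forall>X\<in>tcarrier (ZMu e). tau e a (s (?inv X)) = spow e s a X" and Y: "Y \<in> tcarrier (ZMu e)"
    show "tau e a (s Y) = spow e s a (tau e a Y)"
      using bspec[OF * tau_iota(1)[OF a Y]] bij_betw_inv_into_left[OF bij Y] by simp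
  next
    fix X :: "'r tens" assume *: "\<forall>Y\<in>tcarrier (ZMu e). tau e a (s Y) = spow e s a (tau e a Y)" and X: "X \<in> tcarrier (ZMu e)"
    have "?inv X \<in> tcarrier (ZMu e)" using bij_betwE[OF bij_betw_inv_into[OF bij]] X by blast
    from bspec[OF * this] bij_betw_inv_into_right[OF bij X]
    show "tau e a (s (?inv X)) = spow e s a X" by simp
  qed
qed

section \<open>The automorphism of a grading lies in \<open>Xe\<close> and returns the
  grading\<close>

context graded_algebra
begin

text \<open>Eigenvectors are homogeneous by \<open>tsigma_eigenvector\<close>, so projecting any
  eigendecomposition of x to degree z leaves exactly its z-term.\<close>

lemma sigma_tdecomp_unique:
  assumes x: "x \<in> tqcarrier e" shows "tdecomp e tsigma x g \<longleftrightarrow> g = (\<lambda>z. tproj z x)"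
proof
  assume g: "tdecomp e tsigma x g"
  show "g = (\<lambda>z. tproj z x)"
  proof
    fix z
    have gz: "tproj z (g w) = (if z = w then g w else 0)" for w
      using tsigma_eigenvector[OF tdecomp_tqcarrier[OF g]] g by (cases "w \<in> mu e") (auto simp: tdecomp_def)
    have "tproj z x = (\<Sum>w | g w \<noteq> 0. tproj z (g w))"
      using g tproj_sum[of "{w. g w \<noteq> 0}" g z] tdecomp_tqcarrier[OF g] by (auto simp: tdecomp_def)
    also have "\<dots> = g z" using g by (simp add: gz tdecomp_def)
    finally show "g z = tproj z x" by simp
  qed
next
  assume "g = (\<lambda>z. tproj z x)"
  then show "tdecomp e tsigma x g"
    using x by (simp add: tdecomp_def tproj_outside finite_tproj tproj_tqcarrier tsigma_tproj sum_tproj)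
qed

sublocale sigma: tens_endo e sigma tsigma
  by unfold_locales (fact sigma_tcarrier, fact iota_sigma)

lemma sigma_mu_diag: "mu_diag e sigma"
  unfolding sigma.mu_diag_iff by (auto simp: sigma_tdecomp_unique)

lemma sigma_kp_aut: "kp_aut e phi sigma"
proof -
  have "bij_betw (\<lambda>X. tinv e (tsigma (iota e X))) (tcarrier (ZMu e)) (tcarrier (ZMu e))"
    using bij_betw_trans[OF bij_betw_trans[OF iota_bij tsigma_bij] bij_betw_inv_into[OF iota_bij]] by (simp add: comp_def)
  then have "bij_betw sigma (tcarrier (ZMu e)) (tcarrier (ZMu e))"
    by (rule bij_betw_cong[THEN iffD1, rotated]) (simp add: sigma_def)
  moreover have "sigma (tpure (ZMu e) 1 1) = tpure (ZMu e) 1 1"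
    using sigma_tpure[OF one_in_mu G_one ZMu_one] by simp
  ultimately show ?thesis
    unfolding kp_aut_def Let_def using sigma_tadd sigma_tmul sigma_scalar by (auto simp: sigma_def)
qed

text \<open>On r \<otimes> u with r of degree z both sides are r \<otimes> z^a u', where u' is the
  conjugate of u. The twist on the right is the a-th power of the automorphism.\<close>

lemma ttau_tsigma:
  assumes a: "a \<in> zhat_units e" and x: "x \<in> tqcarrier e"
  shows "ttau e a (tsigma x) = twist (\<lambda>z. hpow z a) (ttau e a x)"
  using x
proof (induction rule: tqcarrier_homogeneous_induct)
  case zero show ?case by (simp add: ttau_zero a)
next
  case (add x y)
  then show ?case by (simp add: tsigma_add ttau_add a tsigma_tqcarrier ttau_tqcarrier twist_add)
next
  case (homogeneous z r u)
  have "hpow z a \<in> ZMu e" using hpow_mu[OF zhat_units_subset[OF a] homogeneous(1)] by (rule ZMu_mu)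
  then show ?case using homogeneous
    by (simp add: tsigma_homogeneous ttau_tp a ZMu_mult ZMu_mu tauZ_spec(1,4)[OF a] twist_homogeneous tauZ_in_ZMu)
qed

lemma sigma_Xe: "sigma \<in> Xe e phi"
proof -
  have "tau e a (sigma Y) = spow e sigma a (tau e a Y)" if a: "a \<in> zhat_units e" and Y: "Y \<in> tcarrier (ZMu e)" for a Y
  proof (rule iota_eqI[where e = e])
    note t = tau_iota[OF a Y] and az = zhat_units_subset[OF a]
    have td: "tdecomp e tsigma (iota e (tau e a Y)) (\<lambda>z. tproj z (iota e (tau e a Y)))"
      using sigma_tdecomp_unique[OF iota_tqcarrier[OF t(1)]] by simp
    note sp = sigma.iota_spow[OF sigma_mu_diag az t(1) td]
    show "tau e a (sigma Y) \<in> tcarrier (ZMu e)" by (intro tau_iota(1) a sigma_tcarrier Y)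
    show "spow e sigma a (tau e a Y) \<in> tcarrier (ZMu e)" by (rule sp(1))
    have "iota e (tau e a (sigma Y)) = ttau e a (tsigma (iota e Y))"
      using tau_iota(2)[OF a sigma_tcarrier[OF Y]] iota_sigma[OF Y] by simp
    also have "\<dots> = twist (\<lambda>z. hpow z a) (iota e (tau e a Y))"
      using ttau_tsigma[OF a iota_tqcarrier[OF Y]] t(2) by simp
    also have "\<dots> = iota e (spow e sigma a (tau e a Y))" unfolding sp(2) twist_def ..
    finally show "iota e (tau e a (sigma Y)) = iota e (spow e sigma a (tau e a Y))" .
  qed
  then show ?thesis
    unfolding Xe_def using sigma_kp_aut sigma_mu_diag by (simp add: tau_conj_iff)
qed

text \<open>An eigenvector r \<otimes> 1 for z equals its own projection to degree z; as R embeds in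
  the tensor product, r is its own component of degree z.\<close>

lemma Psi_sigma: "Psi e sigma = G"
proof
  fix z
  show "Psi e sigma z = G z"
  proof (cases "z \<in> mu e")
    case False then show ?thesis by (simp add: Psi_def G_outside)
  next
    case True
    have "tpure (ZMu e) r 1 \<in> eig e sigma z \<longleftrightarrow> r \<in> G z" for r
    proof -
      have "tpure (ZMu e) r 1 \<in> eig e sigma z \<longleftrightarrow> tsigma (tp e r 1) = act e z (tp e r 1)"
        by (simp add: sigma.eig_iff[OF True] tpure_tcarrier iota_tpure)
      also have "\<dots> \<longleftrightarrow> r \<in> G z"
      proof
        assume "tsigma (tp e r 1) = act e z (tp e r 1)"
        from tsigma_eigenvector[OF tp_tqcarrier[OF ZMu_one] True this, of z]
        have "tp e (hcomp z r) 1 = tp e r 1" by (simp add: tproj_tp)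
        then show "r \<in> G z" using tp_one_inject hcomp_G by metis
      next
        assume "r \<in> G z"
        then show "tsigma (tp e r 1) = act e z (tp e r 1)" using True by (simp add: tsigma_homogeneous act_tp ZMu_mu)
      qed
      finally show ?thesis .
    qed
    then show ?thesis using True by (simp add: Psi_def)
  qed
qed

end

section \<open>The eigenspaces of an element of \<open>Xe\<close> meet R in a grading\<close>

locale galois_automorphism =
  fixes e :: steinitz and phi :: "'k::comm_ring_1 \<Rightarrow> 'r::ring_1" and s :: "'r tens \<Rightarrow> 'r tens"
  assumes kalg: "kalg phi" and Xe: "s \<in> Xe e phi"
    and inj: "\<And>d (r::'r). sdvd d e \<Longrightarrow> of_nat d * r = 0 \<Longrightarrow> r = 0"
begin

lemma kp_aut: "kp_aut e phi s" and diag: "mu_diag e s"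
  and conj: "a \<in> zhat_units e \<Longrightarrow> Y \<in> tcarrier (ZMu e) \<Longrightarrow> tau e a (s Y) = spow e s a (tau e a Y)"
  using Xe tau_conj_iff[of a e s] unfolding Xe_def by auto

lemma phi_add: "phi (a + b) = phi a + phi b" and phi_one: "phi 1 = 1"
  using kalg by (auto simp: kalg_def)

lemma s_ext: "s \<in> extensional (tcarrier (ZMu e))"
  using kp_aut by (simp add: kp_aut_def Let_def)

lemma s_tcarrier: "X \<in> tcarrier (ZMu e) \<Longrightarrow> s X \<in> tcarrier (ZMu e)"
  using kp_aut bij_betwE unfolding kp_aut_def Let_def by blast

lemma s_tadd: "X \<in> tcarrier (ZMu e) \<Longrightarrow> Y \<in> tcarrier (ZMu e) \<Longrightarrow> s (tadd (ZMu e) X Y) = tadd (ZMu e) (s X) (s Y)"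
  using kp_aut by (simp add: kp_aut_def Let_def)

lemma s_tmul: "X \<in> tcarrier (ZMu e) \<Longrightarrow> Y \<in> tcarrier (ZMu e) \<Longrightarrow> s (tmul (ZMu e) X Y) = tmul (ZMu e) (s X) (s Y)"
  using kp_aut by (simp add: kp_aut_def Let_def)

lemma s_scalar:
  fixes c :: "'k tens"
  shows "c \<in> tcarrier (ZMu e) \<Longrightarrow> X \<in> tcarrier (ZMu e) \<Longrightarrow>
    s (tmul (ZMu e) (tmapL (ZMu e) phi c) X) = tmul (ZMu e) (tmapL (ZMu e) phi c) (s X)"
  using kp_aut by (simp add: kp_aut_def Let_def)

definition st :: "'r tq \<Rightarrow> 'r tq" where
  "st x = iota e (s (tinv e x))"

lemma iota_s: "X \<in> tcarrier (ZMu e) \<Longrightarrow> iota e (s X) = st (iota e X)"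
  by (simp add: st_def tinv_iota)

sublocale endo: tens_endo e s st
  by unfold_locales (fact s_tcarrier, fact iota_s)

lemma st_add:
  assumes "x \<in> tqcarrier e" "y \<in> tqcarrier e" shows "st (x + y) = st x + st y"
  using iota_s[of "tadd (ZMu e) (tinv e x) (tinv e y)"] assms
  by (simp add: tadd_tcarrier tinv_tcarrier iota_tadd s_tadd s_tcarrier iota_s iota_tinv)

lemma st_zero: "st 0 = 0"
  using st_add[of 0 0] by simp

lemma st_mult:
  assumes "x \<in> tqcarrier e" "y \<in> tqcarrier e" shows "st (x * y) = st x * st y"
  using iota_s[of "tmul (ZMu e) (tinv e x) (tinv e y)"] assms
  by (simp add: tmul_tcarrier tinv_tcarrier iota_tmul s_tmul s_tcarrier iota_s iota_tinv)

lemma st_scalar: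
  assumes u: "u \<in> ZMu e" and x: "x \<in> tqcarrier e"
  shows "st (tp e (phi k) u * x) = tp e (phi k) u * st x"
proof -
  have c: "tpure (ZMu e) k u \<in> tcarrier (ZMu e)" using u by (rule tpure_tcarrier)
  note t = tmapL_iota[OF phi_add c]
  have it: "iota e (tmapL (ZMu e) phi (tpure (ZMu e) k u)) = tp e (phi k) u"
    using u t(2) by (simp add: iota_tpure tmap_tp phi_add)
  have "st (iota e (tmul (ZMu e) (tmapL (ZMu e) phi (tpure (ZMu e) k u)) (tinv e x))) =
    iota e (tmul (ZMu e) (tmapL (ZMu e) phi (tpure (ZMu e) k u)) (s (tinv e x)))"
    using s_scalar[OF c tinv_tcarrier[OF x]] iota_s[OF tmul_tcarrier[OF t(1) tinv_tcarrier[OF x]]] by simp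
  then show ?thesis
    using x by (simp add: iota_tmul t(1) tinv_tcarrier it iota_tinv s_tcarrier iota_s)
qed

text \<open>Z[mu_e] acts through the elements 1 \<otimes> u of k', so this is contained in
  k'-linearity.\<close>

lemma st_act: "u \<in> ZMu e \<Longrightarrow> x \<in> tqcarrier e \<Longrightarrow> st (act e u x) = act e u (st x)"
  using st_scalar[of u x 1] by (simp add: act_def phi_one)

lemma st_one: "st (tp e 1 1) = tp e 1 1"
proof -
  have "s (tpure (ZMu e) 1 1) = tpure (ZMu e) 1 1" using kp_aut by (simp add: kp_aut_def Let_def)
  then show ?thesis using iota_s[of "tpure (ZMu e) 1 1"] by (simp add: tpure_tcarrier iota_tpure)
qed

lemma tdecomp_exists: "x \<in> tqcarrier e \<Longrightarrow> \<exists>g. tdecomp e st x g"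
  and tdecomp_unique: "x \<in> tqcarrier e \<Longrightarrow> tdecomp e st x g \<Longrightarrow> tdecomp e st x h \<Longrightarrow> g = h"
  using diag unfolding endo.mu_diag_iff by blast+

lemma ttau_st:
  assumes a: "a \<in> zhat_units e" and y: "y \<in> tqcarrier e" and g: "tdecomp e st (ttau e a y) g"
  shows "ttau e a (st y) = (\<Sum>z | g z \<noteq> 0. act e (hpow z a) (g z))"
proof -
  define Y where "Y = tinv e y"
  have Y: "Y \<in> tcarrier (ZMu e)" "iota e Y = y" using y by (simp_all add: Y_def tinv_tcarrier iota_tinv)
  note t = tau_iota[OF a Y(1)]
  have g': "tdecomp e st (iota e (tau e a Y)) g" using g by (simp add: t Y)
  have "ttau e a (st y) = iota e (tau e a (s Y))" using tau_iota(2)[OF a s_tcarrier[OF Y(1)]] iota_s[OF Y(1)] Y(2) by simp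
  also have "\<dots> = iota e (spow e s a (tau e a Y))" by (simp add: conj[OF a Y(1)])
  also have "\<dots> = (\<Sum>z | g z \<noteq> 0. act e (hpow z a) (g z))"
    by (rule endo.iota_spow(2)[OF diag zhat_units_subset[OF a] t(1) g'])
  finally show ?thesis .
qed

text \<open>The relation between tau and s says that tau maps the eigenspace of s for z into that of the power of s by a for
  the a-th power of z, which is the eigenspace of s for z again.\<close>

lemma ttau_eigenspace:
  assumes a: "a \<in> zhat_units e" and z: "z \<in> mu e" and x: "x \<in> tqcarrier e" and ev: "st x = act e z x"
  shows "st (ttau e a x) = act e z (ttau e a x)"
proof -
  note az = zhat_units_subset[OF a]
  have hz: "hpow w a \<in> ZMu e" if "w \<in> mu e" for w using hpow_mu[OF az that] by (rule ZMu_mu)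
  obtain g where g: "tdecomp e st (ttau e a x) g" using tdecomp_exists[OF ttau_tqcarrier[OF a x]] by blast
  have gQ: "g w \<in> tqcarrier e" for w by (rule tdecomp_tqcarrier[OF g])
  have g_mu: "w \<in> mu e" if "g w \<noteq> 0" for w using g that by (auto simp: tdecomp_def)
  have fin: "finite {w. g w \<noteq> 0}" using g by (simp add: tdecomp_def)
  \<comment> \<open>Write tau for the action of a. Then tau (s x) is computed twice: as the sum of
    the w^a g w by the condition on s, and as z^a times the sum of the g w by semilinearity. The
    differences h w are eigenvectors of s that sum to 0.\<close>
  define h where "h w = (if w \<in> mu e then act e (hpow w a - hpow z a) (g w) else 0)" for w
  have hs: "{w. h w \<noteq> 0} \<subseteq> {w. g w \<noteq> 0}" by (auto simp: h_def)
  have "(\<Sum>w | h w \<noteq> 0. h w) = (\<Sum>w | g w \<noteq> 0. h w)"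
    by (rule sum.mono_neutral_left) (use fin hs in auto)
  also have "\<dots> = (\<Sum>w | g w \<noteq> 0. act e (hpow w a) (g w) - act e (hpow z a) (g w))"
    by (rule sum.cong) (auto simp: h_def g_mu act_diff_left hz z)
  also have "\<dots> = ttau e a (st x) - act e (hpow z a) (ttau e a x)"
    using ttau_st[OF a x g] g by (simp add: sum_subtractf act_sum[symmetric] tdecomp_def)
  also have "\<dots> = 0" unfolding ev by (simp add: tmap_tau_act[OF a z x])
  finally have "tdecomp e st 0 h"
    using finite_subset[OF hs fin] g
    by (simp add: tdecomp_def h_def act_tqcarrier ZMu_diff hz z st_act act_act ZMu_mu mult.commute)
  moreover have "tdecomp e st 0 (\<lambda>_. 0)" by (simp add: tdecomp_def st_zero)
  ultimately have h0: "h = (\<lambda>_. 0)" by (rule tdecomp_unique[OF tqcarrier_zero])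
  obtain b where b: "\<And>z. z \<in> mu e \<Longrightarrow> hpow (hpow z a) b = z" using zhat_units_inverse[OF a] by metis
  \<comment> \<open>Uniqueness of the decomposition of 0 gives w^a g w = z^a g w. Exponentiation by
    the unit a is injective on \<open>mu e\<close>, so the two scalars differ and g w
    vanishes.\<close>
  have gw: "g w = 0" if "w \<noteq> z" for w
  proof (cases "w \<in> mu e")
    case True
    have "act e (hpow w a) (g w) = act e (hpow z a) (g w)"
      using fun_cong[OF h0, of w] True by (simp add: h_def act_diff_left hz z)
    moreover have "hpow w a \<noteq> hpow z a" using b[OF True] b[OF z] that by metis
    ultimately show ?thesis
      by (rule act_mu_cancel[of e "hpow w a" "hpow z a" "g w", OF _ hpow_mu[OF az True] hpow_mu[OF az z] gQ, rotated])
         (erule (1) inj)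
  qed (use g_mu in blast)
  then have "{w. g w \<noteq> 0} \<subseteq> {z}" by auto
  then have "(\<Sum>w | g w \<noteq> 0. g w) = (\<Sum>w\<in>{z}. g w)" by (intro sum.mono_neutral_left) auto
  then have "ttau e a x = g z" using g by (simp add: tdecomp_def)
  moreover have "st (g z) = act e z (g z)" using g z by (simp add: tdecomp_def)
  ultimately show ?thesis by (simp only:)
qed

text \<open>A Galois automorphism fixes r \<otimes> 1 and preserves each eigenspace, so it carries
  the decomposition to another one with the same indices. Uniqueness makes every component
  invariant, and descent applies.\<close>

lemma tdecomp_in_R:
  assumes g: "tdecomp e st (tp e r 1) g"
  shows "\<exists>t. g z = tp e t 1"
proof (rule tau_invariant_in_R)
  show "g z \<in> tqcarrier e" by (rule tdecomp_tqcarrier[OF g])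
  fix a assume a: "a \<in> zhat_units e"
  have gQ: "g w \<in> tqcarrier e" for w by (rule tdecomp_tqcarrier[OF g])
  obtain b where b: "b \<in> zhat_units e" "\<And>z. z \<in> mu e \<Longrightarrow> hpow (hpow z a) b = z"
    using zhat_units_inverse[OF a] by metis
  have nz: "ttau e a (g w) \<noteq> 0 \<longleftrightarrow> g w \<noteq> 0" for w
    using ttau_inverse[OF a b gQ[of w]] ttau_zero[OF a] ttau_zero[OF b(1)] by metis
  have "ttau e a (\<Sum>w | g w \<noteq> 0. g w) = (\<Sum>w | g w \<noteq> 0. ttau e a (g w))"
    by (rule ttau_sum[OF a gQ])
  moreover have "ttau e a (tp e r 1) = tp e r 1" using ttau_tp[OF a ZMu_one] tauZ_spec(2)[OF a] by simp
  moreover have "st (ttau e a (g w)) = act e w (ttau e a (g w))" if "w \<in> mu e" for w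
    by (rule ttau_eigenspace[OF a that gQ]) (use g that in \<open>simp add: tdecomp_def\<close>)
  ultimately have "tdecomp e st (tp e r 1) (\<lambda>w. ttau e a (g w))"
    using g gQ by (simp add: tdecomp_def nz ttau_tqcarrier[OF a] ttau_zero[OF a])
  from tdecomp_unique[OF tp_tqcarrier[OF ZMu_one] g this] show "ttau e a (g z) = g z" by metis
qed (erule (1) inj)

lemma Psi_iff: "z \<in> mu e \<Longrightarrow> r \<in> Psi e s z \<longleftrightarrow> st (tp e r 1) = act e z (tp e r 1)"
  by (simp add: Psi_def endo.eig_iff tpure_tcarrier iota_tpure)

lemma Psi_outside: "z \<notin> mu e \<Longrightarrow> Psi e s z = {0}"
  by (simp add: Psi_def)

lemma tdecomp_Psi:
  assumes "\<And>z. g z \<in> Psi e s z" "finite {z. g z \<noteq> 0}"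
  shows "tdecomp e st (tp e (\<Sum>z | g z \<noteq> 0. g z) 1) (\<lambda>z. tp e (g z) 1)"
proof -
  have nz: "tp e (g z) 1 \<noteq> 0 \<longleftrightarrow> g z \<noteq> 0" for z using tp_one_eq_zero tp_zero_left[OF ZMu_one] by metis
  have "g z = 0" if "z \<notin> mu e" for z using assms(1)[of z] Psi_outside[OF that] by simp
  moreover have "st (tp e (g z) 1) = act e z (tp e (g z) 1)" if "z \<in> mu e" for z using assms(1) Psi_iff[OF that] by blast
  ultimately show ?thesis
    using assms(2) by (simp add: tdecomp_def nz tp_zero_left tp_tqcarrier tp_sum_left)
qed

text \<open>The eigencomponents of r \<otimes> 1 all have the form t \<otimes> 1; since R embeds in
  the tensor product, existence and uniqueness of the decomposition pass to R.\<close>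

lemma Psi_decomposition: "\<exists>!g. (\<forall>z. g z \<in> Psi e s z) \<and> finite {z. g z \<noteq> 0} \<and> r = (\<Sum>z\<in>{z. g z \<noteq> 0}. g z)"
proof (rule ex_ex1I)
  obtain g where g: "tdecomp e st (tp e r 1) g" using tdecomp_exists[OF tp_tqcarrier[OF ZMu_one]] by blast
  obtain t where t: "\<And>z. g z = tp e (t z) 1" using tdecomp_in_R[OF g] by metis
  have nz: "g z \<noteq> 0 \<longleftrightarrow> t z \<noteq> 0" for z using t tp_one_eq_zero tp_zero_left[OF ZMu_one] by metis
  have "t z \<in> Psi e s z" for z
  proof (cases "z \<in> mu e")
    case True then show ?thesis using g by (simp add: Psi_iff tdecomp_def t)
  next
    case False
    then have "g z = 0" using g by (simp add: tdecomp_def)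
    then show ?thesis using nz False by (simp add: Psi_outside)
  qed
  moreover have "finite {z. t z \<noteq> 0}" using g by (simp add: tdecomp_def nz)
  moreover have "r = (\<Sum>z\<in>{z. t z \<noteq> 0}. t z)"
  proof (rule tp_one_inject)
    show "tp e r 1 = tp e (\<Sum>z\<in>{z. t z \<noteq> 0}. t z) 1"
      using g unfolding tdecomp_def nz by (simp add: tp_sum_left t)
  qed
  ultimately show "\<exists>g. (\<forall>z. g z \<in> Psi e s z) \<and> finite {z. g z \<noteq> 0} \<and> r = (\<Sum>z\<in>{z. g z \<noteq> 0}. g z)" by blast
next
  fix g h
  assume g: "(\<forall>z. g z \<in> Psi e s z) \<and> finite {z. g z \<noteq> 0} \<and> r = (\<Sum>z\<in>{z. g z \<noteq> 0}. g z)"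
    and h: "(\<forall>z. h z \<in> Psi e s z) \<and> finite {z. h z \<noteq> 0} \<and> r = (\<Sum>z\<in>{z. h z \<noteq> 0}. h z)"
  have "tdecomp e st (tp e r 1) (\<lambda>z. tp e (g z) 1)" using tdecomp_Psi[of g] g by simp
  moreover have "tdecomp e st (tp e r 1) (\<lambda>z. tp e (h z) 1)" using tdecomp_Psi[of h] h by simp
  ultimately have eq: "(\<lambda>z. tp e (g z) 1) = (\<lambda>z. tp e (h z) 1)" by (rule tdecomp_unique[OF tp_tqcarrier[OF ZMu_one]])
  show "g = h"
    by (rule ext, rule tp_one_inject) (rule fun_cong[OF eq])
qed

lemma Psi_gradings: "Psi e s \<in> gradings e phi"
  unfolding gradings_def mem_Collect_eq
proof (intro conjI allI ballI impI)
  show "\<exists>!g. (\<forall>z. g z \<in> Psi e s z) \<and> finite {z. g z \<noteq> 0} \<and> r = (\<Sum>z\<in>{z. g z \<noteq> 0}. g z)" for r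
    by (rule Psi_decomposition)
  show "Psi e s z = {0}" if "z \<notin> mu e" for z using that by (rule Psi_outside)
  show "1 \<in> Psi e s 1" by (simp add: Psi_iff st_one act_tp)
  fix z assume z: "z \<in> mu e"
  show "0 \<in> Psi e s z" using z by (simp add: Psi_iff tp_zero_left st_zero)
  show "x + y \<in> Psi e s z" if "x \<in> Psi e s z" "y \<in> Psi e s z" for x y
    using that z by (simp add: Psi_iff tp_add_left st_add tp_tqcarrier act_add)
  show "phi c * x \<in> Psi e s z" if "x \<in> Psi e s z" for c x
  proof -
    have "st (tp e (phi c * x) 1) = tp e (phi c) 1 * st (tp e x 1)"
      using st_scalar[of 1 "tp e x 1" c] by (simp add: tp_mult tp_tqcarrier)
    then show ?thesis using that z by (simp add: Psi_iff act_tp ZMu_mu tp_mult)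
  qed
  fix w x y assume w: "w \<in> mu e" and x: "x \<in> Psi e s z" and y: "y \<in> Psi e s w"
  have "tp e (x * y) 1 = tp e x 1 * tp e y 1" by (simp add: tp_mult)
  then have "st (tp e (x * y) 1) = act e z (tp e x 1) * act e w (tp e y 1)"
    using x y z w by (simp add: st_mult tp_tqcarrier Psi_iff)
  also have "\<dots> = act e (z * w) (tp e (x * y) 1)"
    using z w by (simp add: act_mult ZMu_mu tp_tqcarrier tp_mult)
  finally show "x * y \<in> Psi e s (z * w)" using z w by (simp add: Psi_iff mu_mult)
qed

text \<open>Linearity over Z[mu_e] determines s on r \<otimes> u from its value on r \<otimes> 1.
  Thus s has the property that characterises the automorphism of the grading \<open>Psi e s\<close>,
  and uniqueness identifies the two.\<close>

lemma grad_map_prop_Psi: "grad_map_prop e phi (Psi e s) s"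
proof -
  have "s (tpure (ZMu e) r u) = tpure (ZMu e) r (z * u)" if z: "z \<in> mu e" and r: "r \<in> Psi e s z" and u: "u \<in> ZMu e" for z r u
  proof -
    have "st (tp e r u) = act e u (st (tp e r 1))"
      using st_act[OF u tp_tqcarrier[OF ZMu_one, of e r]] u by (simp add: act_tp)
    also have "\<dots> = tp e r (z * u)" using r z u by (simp add: Psi_iff act_tp ZMu_mu ZMu_mult mult.commute)
    finally show ?thesis
      using u z iota_inject[of "s (tpure (ZMu e) r u)" e "tpure (ZMu e) r (z * u)"]
      by (simp add: s_tcarrier tpure_tcarrier ZMu_mult ZMu_mu iota_s iota_tpure)
  qed
  then show ?thesis
    unfolding grad_map_prop_def Let_def using s_ext s_tcarrier s_tadd s_scalar by auto
qed

lemma Phi_Psi: "Phi e phi (Psi e s) = s"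
proof -
  interpret g: graded_algebra e phi "Psi e s"
    by unfold_locales (fact kalg, fact Psi_gradings, erule (1) inj)
  show ?thesis using g.grad_map_prop_unique[OF grad_map_prop_Psi] g.Phi_eq_sigma by simp
qed

end

text \<open>The unique existence asserted first is what makes the definite description in
  \<open>Phi\<close> denote the map of the statement.\<close>

theorem mainTheorem5:
  fixes e :: steinitz and phi :: "'k::comm_ring_1 \<Rightarrow> 'r::ring_1"
  assumes "kalg phi"
    and "\<And>d (r::'r). sdvd d e \<Longrightarrow> of_nat d * r = 0 \<Longrightarrow> r = 0"
  shows "(\<forall>G\<in>gradings e phi. \<exists>!s. grad_map_prop e phi G s)
       \<and> (\<forall>G\<in>gradings e phi. Phi e phi G \<in> Xe e phi)
       \<and> (\<forall>s\<in>Xe e phi. Psi e s \<in> gradings e phi)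
       \<and> (\<forall>G\<in>gradings e phi. Psi e (Phi e phi G) = G)
       \<and> (\<forall>s\<in>Xe e phi. Phi e phi (Psi e s) = s)
       \<and> bij_betw (Phi e phi) (gradings e phi) (Xe e phi)"
proof -
  have grad: "graded_algebra e phi G" if "G \<in> gradings e phi" for G
    by (rule graded_algebra.intro[OF assms(1) that]) (erule (1) assms(2))
  have gal: "galois_automorphism e phi s" if "s \<in> Xe e phi" for s
    by (rule galois_automorphism.intro[OF assms(1) that]) (erule (1) assms(2))
  have 1: "\<exists>!s. grad_map_prop e phi G s" if "G \<in> gradings e phi" for G
    using graded_algebra.grad_map_prop_sigma[OF grad[OF that]] graded_algebra.grad_map_prop_unique[OF grad[OF that]]
    by (rule ex1I)
  have 2: "Phi e phi G \<in> Xe e phi" "Psi e (Phi e phi G) = G" if "G \<in> gradings e phi" for G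
    using graded_algebra.sigma_Xe[OF grad[OF that]] graded_algebra.Psi_sigma[OF grad[OF that]]
      graded_algebra.Phi_eq_sigma[OF grad[OF that]] by simp_all
  have 3: "Psi e s \<in> gradings e phi" "Phi e phi (Psi e s) = s" if "s \<in> Xe e phi" for s
    using galois_automorphism.Psi_gradings[OF gal[OF that]] galois_automorphism.Phi_Psi[OF gal[OF that]] by simp_all
  have "bij_betw (Phi e phi) (gradings e phi) (Xe e phi)"
    by (rule bij_betwI[where g = "Psi e"]) (use 2 3 in auto)
  with 1 2 3 show ?thesis by blast
qed

end
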